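(* Let $k$ be a field and let $Y,Z$ be objects of $\mathcal S_2(k)$ of the same partition type. If $Y\leq_{\rm hom}Z$, then $Y\leq_{\rm arc}Z$.
   Context: For a partition $\alpha$ let $N_\alpha=\bigoplus_ik[T]/(T^{\alpha_i})$. $\mathcal S(k)$: objects are triples $(N_\alpha,N_\beta,f)$ with $f$ an injective $k[T]$-map; morphisms are pairs of $k[T]$-maps commuting with the $f$'s. $\mathcal S_2(k)$: full subcategory with $\alpha_1\le2$. Partition type $(\alpha,\beta,\gamma)$: $\operatorname{Coker}f\cong N_\gamma$. $Y\leq_{\rm hom}Z$: $\dim_k\operatorname{Hom}(X,Y)\le\dim_k\operatorname{Hom}(X,Z)$ for all objects $X$ of $\mathcal S(k)$. Indecomposables of $\mathcal S_2(k)$: pickets $P_\ell^m=(N_{(\ell)},N_{(m)},\iota)$, $0\le\ell\le\min\{2,m\}$, and bipickets $B_2^{m,r}=(N_{(2)},N_{(m,r)},\delta)$, $1\le r\le m-2$, $\delta(1)=(T^{m-2},T^{r-1})$; each object is uniquely a direct sum of these. Arc diagram of an object: an arc $(m,r)$ for each summand $B_2^{m,r}$, an arc $(m,m-1)$ for each summand $P_2^m$, a pole at $m$ for each summand $P_1^m$. Moves: for $m>n>r>s$, (A) replaces arcs $(m,r),(n,s)$ by $(m,s),(n,r)$; (C) replaces arcs $(m,r),(n,s)$ by $(m,n),(r,s)$; for $m>r>s$, (B) replaces arc $(m,s)$ and pole at $r$ by arc $(m,r)$ and pole at $s$; (D) replaces arc $(m,s)$ and pole at $r$ by pole at $m$ and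 arc $(r,s)$. $Y\leq_{\rm arc}Z$: the arc diagram of $Y$ is obtained from that of $Z$ by a finite (possibly empty) sequence of moves. *)

theory Defs
  imports Complex_Main "HOL-Library.Multiset" "HOL-Library.Function_Algebras" "HOL-Library.Product_Plus"
begin

text \<open>N_alpha = direct sum of k[T]/(T^(alpha_i)) has k-basis e_(i,j), i < length alpha,
  j < alpha_i, with T e_(i,j) = e_(i,j+1) (and = 0 if j+1 = alpha_i).
  A k-linear map N_alpha -> N_beta is a matrix M with M p q = coefficient of e_p in the
  image of e_q, supported on idx beta x idx alpha.\<close>

type_synonym 'k mat = "nat \<times> nat \<Rightarrow> nat \<times> nat \<Rightarrow> 'k"

definition idx :: "nat list \<Rightarrow> (nat \<times> nat) set" where
  "idx \<alpha> = {(i, j). i < length \<alpha> \<and> j < \<alpha> ! i}"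

definition partition :: "nat list \<Rightarrow> bool" where
  "partition \<alpha> \<longleftrightarrow> sorted_wrt (\<ge>) \<alpha> \<and> 0 \<notin> set \<alpha>"

definition tmat :: "nat list \<Rightarrow> 'k::field mat" where
  "tmat \<alpha> p q = (if q \<in> idx \<alpha> \<and> p \<in> idx \<alpha> \<and> p = (fst q, Suc (snd q)) then 1 else 0)"

definition idmat :: "nat list \<Rightarrow> 'k::field mat" where
  "idmat \<alpha> p q = (if p \<in> idx \<alpha> \<and> p = q then 1 else 0)"

definition mmul :: "(nat \<times> nat) set \<Rightarrow> 'k::field mat \<Rightarrow> 'k mat \<Rightarrow> 'k mat" where
  "mmul I A B p r = (\<Sum>q\<in>I. A p q * B q r)"

definition mapp :: "(nat \<times> nat) set \<Rightarrow> 'k::field mat \<Rightarrow> (nat \<times> nat \<Rightarrow> 'k) \<Rightarrow> (nat \<times> nat \<Rightarrow> 'k)" where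
  "mapp I M v p = (\<Sum>q\<in>I. M p q * v q)"

definition supported :: "(nat \<times> nat \<Rightarrow> 'k::zero) \<Rightarrow> (nat \<times> nat) set \<Rightarrow> bool" where
  "supported v I \<longleftrightarrow> (\<forall>p. v p \<noteq> 0 \<longrightarrow> p \<in> I)"

definition is_hom :: "nat list \<Rightarrow> nat list \<Rightarrow> 'k::field mat \<Rightarrow> bool" where
  "is_hom \<alpha> \<beta> M \<longleftrightarrow>
     (\<forall>p q. M p q \<noteq> 0 \<longrightarrow> p \<in> idx \<beta> \<and> q \<in> idx \<alpha>) \<and>
     mmul (idx \<beta>) (tmat \<beta>) M = mmul (idx \<alpha>) M (tmat \<alpha>)"

definition inj_hom :: "nat list \<Rightarrow> 'k::field mat \<Rightarrow> bool" where
  "inj_hom \<alpha> M \<longleftrightarrow> (\<forall>v. supported v (idx \<alpha>) \<longrightarrow> mapp (idx \<alpha>) M v = (\<lambda>_. 0) \<longrightarrow> v = (\<lambda>_. 0))"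

definition surj_hom :: "nat list \<Rightarrow> nat list \<Rightarrow> 'k::field mat \<Rightarrow> bool" where
  "surj_hom \<alpha> \<beta> M \<longleftrightarrow> (\<forall>w. supported w (idx \<beta>) \<longrightarrow>
      (\<exists>v. supported v (idx \<alpha>) \<and> mapp (idx \<alpha>) M v = w))"

text \<open>a triple (N_alpha, N_beta, f)\<close>
type_synonym 'k obj = "nat list \<times> nat list \<times> 'k mat"

fun obj_S :: "'k::field obj \<Rightarrow> bool" where
  "obj_S (\<alpha>, \<beta>, f) \<longleftrightarrow> partition \<alpha> \<and> partition \<beta> \<and> is_hom \<alpha> \<beta> f \<and> inj_hom \<alpha> f"

fun obj_S2 :: "'k::field obj \<Rightarrow> bool" where
  "obj_S2 (\<alpha>, \<beta>, f) \<longleftrightarrow> obj_S (\<alpha>, \<beta>, f) \<and> (\<forall>a\<in>set \<alpha>. a \<le> 2)"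

fun is_morph :: "'k::field obj \<Rightarrow> 'k obj \<Rightarrow> 'k mat \<times> 'k mat \<Rightarrow> bool" where
  "is_morph (\<alpha>, \<beta>, f) (\<alpha>', \<beta>', f') (g1, g2) \<longleftrightarrow>
     is_hom \<alpha> \<alpha>' g1 \<and> is_hom \<beta> \<beta>' g2 \<and>
     mmul (idx \<alpha>') f' g1 = mmul (idx \<beta>) g2 f"

definition Hom :: "'k::field obj \<Rightarrow> 'k obj \<Rightarrow> ('k mat \<times> 'k mat) set" where
  "Hom X Y = {g. is_morph X Y g}"

definition hom_scale :: "'k::field \<Rightarrow> 'k mat \<times> 'k mat \<Rightarrow> 'k mat \<times> 'k mat" where
  "hom_scale c g = (\<lambda>p q. c * fst g p q, \<lambda>p q. c * snd g p q)"

definition dimHom :: "'k::field obj \<Rightarrow> 'k obj \<Rightarrow> nat" where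
  "dimHom X Y = vector_space.dim hom_scale (Hom X Y)"

definition hom_le :: "'k::field obj \<Rightarrow> 'k obj \<Rightarrow> bool" where
  "hom_le Y Z \<longleftrightarrow> (\<forall>X. obj_S X \<longrightarrow> dimHom X Y \<le> dimHom X Z)"

text \<open>isomorphism of triples (also used for triples with non-sorted lists, e.g. direct sums)\<close>
fun obj_iso :: "'k::field obj \<Rightarrow> 'k obj \<Rightarrow> bool" where
  "obj_iso (\<alpha>, \<beta>, f) (\<alpha>', \<beta>', f') \<longleftrightarrow>
    (\<exists>g1 g2 h1 h2. is_morph (\<alpha>, \<beta>, f) (\<alpha>', \<beta>', f') (g1, g2) \<and>
                   is_morph (\<alpha>', \<beta>', f') (\<alpha>, \<beta>, f) (h1, h2) \<and>
                   mmul (idx \<alpha>') h1 g1 = idmat \<alpha> \<and> mmul (idx \<alpha>) g1 h1 = idmat \<alpha>' \<and>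
                   mmul (idx \<beta>') h2 g2 = idmat \<beta> \<and> mmul (idx \<beta>) g2 h2 = idmat \<beta>')"

fun coker_is :: "'k::field obj \<Rightarrow> nat list \<Rightarrow> bool" where
  "coker_is (\<alpha>, \<beta>, f) \<gamma> \<longleftrightarrow> partition \<gamma> \<and>
     (\<exists>g. is_hom \<beta> \<gamma> g \<and> surj_hom \<beta> \<gamma> g \<and>
          (\<forall>w. supported w (idx \<beta>) \<longrightarrow>
               (mapp (idx \<beta>) g w = (\<lambda>_. 0) \<longleftrightarrow>
                (\<exists>v. supported v (idx \<alpha>) \<and> mapp (idx \<alpha>) f v = w))))"

fun has_ptype :: "'k::field obj \<Rightarrow> nat list \<times> nat list \<times> nat list \<Rightarrow> bool" where
  "has_ptype (\<alpha>, \<beta>, f) (a, b, c) \<longleftrightarrow> \<alpha> = a \<and> \<beta> = b \<and> coker_is (\<alpha>, \<beta>, f) c"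

definition same_ptype :: "'k::field obj \<Rightarrow> 'k obj \<Rightarrow> bool" where
  "same_ptype Y Z \<longleftrightarrow> (\<exists>t. has_ptype Y t \<and> has_ptype Z t)"

definition part1 :: "nat \<Rightarrow> nat list" where
  "part1 l = (if l = 0 then [] else [l])"

text \<open>P_l^m = (N_(l), N_(m), iota), iota(1) = T^(m-l)\<close>
definition picket :: "nat \<Rightarrow> nat \<Rightarrow> 'k::field obj" where
  "picket l m = (part1 l, part1 m,
     \<lambda>p q. if q \<in> idx (part1 l) \<and> p \<in> idx (part1 m) \<and> p = (0, m - l + snd q) then 1 else 0)"

text \<open>B_2^(m,r) = (N_(2), N_(m,r), delta), delta(1) = (T^(m-2), T^(r-1))\<close>
definition bipicket :: "nat \<Rightarrow> nat \<Rightarrow> 'k::field obj" where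
  "bipicket m r = ([2], [m, r],
     \<lambda>p q. if q \<in> idx [2] \<and> p \<in> idx [m, r] \<and>
               (p = (0, m - 2 + snd q) \<or> p = (1, r - 1 + snd q)) then 1 else 0)"

datatype summand = Picket nat nat | Bipicket nat nat

fun valid_summand :: "summand \<Rightarrow> bool" where
  "valid_summand (Picket l m) \<longleftrightarrow> l \<le> min 2 m"
| "valid_summand (Bipicket m r) \<longleftrightarrow> 1 \<le> r \<and> r + 2 \<le> m"

fun summand_obj :: "summand \<Rightarrow> 'k::field obj" where
  "summand_obj (Picket l m) = picket l m"
| "summand_obj (Bipicket m r) = bipicket m r"

fun dsum :: "'k::field obj \<Rightarrow> 'k obj \<Rightarrow> 'k obj" where
  "dsum (\<alpha>1, \<beta>1, f1) (\<alpha>2, \<beta>2, f2) =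
     (\<alpha>1 @ \<alpha>2, \<beta>1 @ \<beta>2,
      \<lambda>p q. if fst p < length \<beta>1 \<and> fst q < length \<alpha>1 then f1 p q
            else if length \<beta>1 \<le> fst p \<and> length \<alpha>1 \<le> fst q
            then f2 (fst p - length \<beta>1, snd p) (fst q - length \<alpha>1, snd q) else 0)"

definition sum_obj :: "summand list \<Rightarrow> 'k::field obj" where
  "sum_obj L = foldr (\<lambda>s X. dsum (summand_obj s) X) L ([], [], \<lambda>_ _. 0)"

text \<open>an arc diagram: multiset of arcs (m, r) and multiset of poles\<close>
type_synonym diagram = "(nat \<times> nat) multiset \<times> nat multiset"

fun summand_arcs :: "summand \<Rightarrow> (nat \<times> nat) multiset" where
  "summand_arcs (Bipicket m r) = {#(m, r)#}"
| "summand_arcs (Picket l m) = (if l = 2 then {#(m, m - 1)#} else {#})"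

fun summand_poles :: "summand \<Rightarrow> nat multiset" where
  "summand_poles (Picket l m) = (if l = 1 then {#m#} else {#})"
| "summand_poles (Bipicket m r) = {#}"

definition diagram_of :: "summand list \<Rightarrow> diagram" where
  "diagram_of L = (\<Sum>s\<leftarrow>L. summand_arcs s, \<Sum>s\<leftarrow>L. summand_poles s)"

text \<open>D is the arc diagram of Y (decomposition into pickets / bipickets is unique)\<close>
definition arc_diagram :: "'k::field obj \<Rightarrow> diagram \<Rightarrow> bool" where
  "arc_diagram Y D \<longleftrightarrow>
     (\<exists>L. (\<forall>s\<in>set L. valid_summand s) \<and> obj_iso Y (sum_obj L) \<and> D = diagram_of L)"

inductive arc_move :: "diagram \<Rightarrow> diagram \<Rightarrow> bool" where
  moveA: "m > n \<Longrightarrow> n > r \<Longrightarrow> r > s \<Longrightarrow>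
    arc_move (A + {#(m, r), (n, s)#}, P) (A + {#(m, s), (n, r)#}, P)"
| moveC: "m > n \<Longrightarrow> n > r \<Longrightarrow> r > s \<Longrightarrow>
    arc_move (A + {#(m, r), (n, s)#}, P) (A + {#(m, n), (r, s)#}, P)"
| moveB: "m > r \<Longrightarrow> r > s \<Longrightarrow>
    arc_move (A + {#(m, s)#}, P + {#r#}) (A + {#(m, r)#}, P + {#s#})"
| moveD: "m > r \<Longrightarrow> r > s \<Longrightarrow>
    arc_move (A + {#(m, s)#}, P + {#r#}) (A + {#(r, s)#}, P + {#m#})"

definition arc_le :: "'k::field obj \<Rightarrow> 'k obj \<Rightarrow> bool" where
  "arc_le Y Z \<longleftrightarrow>
     (\<exists>DY DZ. arc_diagram Y DY \<and> arc_diagram Z DZ \<and> arc_move\<^sup>*\<^sup>* DZ DY)"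

end

theory Submission
  imports Defs "HOL-Combinatorics.Permutations"
begin

text \<open>Write an object as \<open>A \<subseteq> B\<close>. A decomposition is produced by splitting off summands belonging to the
  nilpotency index \<open>n\<close> of \<open>T\<close> on \<open>B\<close>: linear functionals vanishing on suitable subspaces define a
  complementary \<open>k[T]\<close>-submodule compatible with \<open>A\<close>. For a decomposed object and \<open>v \<le> u\<close> the dimension of
  \<open>A \<inter> (T^u (ker T^(u+2)) + T^v (ker T^(v+1)))\<close> counts, up to terms determined by the multiset of end
  points, the arcs inside the interval from \<open>v+1\<close> to \<open>u+1\<close>, with a minus sign. The partition type fixes it
  for \<open>u = v\<close>, and for \<open>v < u\<close> it is \<open>dim Hom(B_2^(u+2,v+1), -)\<close> minus a number depending on \<open>\<beta>\<close> only.
  So \<open>Y \<le>hom Z\<close> means that no interval contains more arcs of \<open>Z\<close> than of \<open>Y\<close>.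

  Poles are treated as arcs to a common point above all others; then each of the four moves replaces
  two crossing arcs by one of the two non-crossing pairs on the same four points. Doubling of points
  is removed by spreading them out, so that diagrams become fixed-point-free involutions. That the
  interval counts then force a chain of moves is proved as for the Bruhat order: if \<open>Y\<close> has
  non-crossing arcs at the neighbouring points \<open>p, p+1\<close>, exchange these points in \<open>Y\<close>, and also in
  \<open>Z\<close> unless the arcs of \<open>Z\<close> cross there; a lifting property carries the chain back.\<close>

section \<open>Uncrossing fixed-point-free involutions\<close>

text \<open>Resolving crossings of \<open>Z\<close> greedily may overshoot \<open>Y\<close>, and the
  counts do not show which crossing to resolve. Hence the induction simplifies \<open>Y\<close>:
  exchanging two neighbouring points affects only intervals with an end at the single cut between
  them, and there a crossing of \<open>Z\<close> has the smallest count that the two adjacent cuts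
  permit. The process stops at an involution all of whose arcs cross each other, and no other
  involution has counts bounded by those of this one. Two kinds of intervals are not controlled by
  dimensions. Cuts between copies of one point arise only from the spreading; with \<open>Y\<close>
  spread as uncrossed and \<open>Z\<close> as crossed as possible, the counts of \<open>Y\<close>
  are concave and those of \<open>Z\<close> convex across such cuts, so the inequality extends to
  them. Intervals containing the extra top point are settled by the end points together with the
  counts of initial intervals.\<close>

definition matching :: "nat \<Rightarrow> (nat \<Rightarrow> nat) \<Rightarrow> bool" where
  "matching n V \<longleftrightarrow> (\<forall>x. V (V x) = x) \<and> (\<forall>x. V x \<noteq> x \<longleftrightarrow> x < n)"

text \<open>The equation \<open>(a < b) = (V a < b)\<close> says that \<open>b\<close> lies outside
  the interval spanned by \<open>a\<close> and \<open>V a\<close>, so the last conjunct says that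
  exactly one of \<open>b\<close>, \<open>V b\<close> lies inside. In this form the two ends of an
  arc need not be ordered.\<close>

definition crossing :: "(nat \<Rightarrow> nat) \<Rightarrow> nat \<Rightarrow> nat \<Rightarrow> bool" where
  "crossing V a b \<longleftrightarrow> V a \<noteq> a \<and> V b \<noteq> b \<and> b \<noteq> a \<and> b \<noteq> V a \<and>
     ((a < b) = (V a < b)) \<noteq> ((a < V b) = (V a < V b))"

text \<open>Replacing \<open>b\<close> by \<open>V b\<close> gives the other non-crossing pairing of
  the same four points, so letting the named ends vary yields both resolutions of a
  crossing.\<close>

definition uncross :: "(nat \<Rightarrow> nat) \<Rightarrow> nat \<Rightarrow> nat \<Rightarrow> nat \<Rightarrow> nat" where
  "uncross V a b = V(a := b, b := a, V a := V b, V b := V a)"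

definition uncrossing :: "(nat \<Rightarrow> nat) \<Rightarrow> (nat \<Rightarrow> nat) \<Rightarrow> bool" where
  "uncrossing V W \<longleftrightarrow> (\<exists>a b. crossing V a b \<and> W = uncross V a b)"

definition conj_swap :: "nat \<Rightarrow> (nat \<Rightarrow> nat) \<Rightarrow> nat \<Rightarrow> nat" where
  "conj_swap p V x = transpose p (Suc p) (V (transpose p (Suc p) x))"

text \<open>Both ends of an arc are counted, so the value is twice the number of arcs inside the
  half-open interval; this is the origin of the increments by 2 below.\<close>

definition inner_count :: "(nat \<Rightarrow> nat) \<Rightarrow> nat \<Rightarrow> nat \<Rightarrow> nat" where
  "inner_count V i j = card {x. V x \<noteq> x \<and> i \<le> x \<and> x < j \<and> i \<le> V x \<and> V x < j}"

lemma matchingD: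
  assumes "matching n V"
  shows "V (V x) = x" "x < n \<Longrightarrow> V x \<noteq> x" "n \<le> x \<Longrightarrow> V x = x" "x < n \<Longrightarrow> V x < n"
    "V x = V y \<longleftrightarrow> x = y"
proof -
  show 1: "\<And>x. V (V x) = x" and 2: "x < n \<Longrightarrow> V x \<noteq> x" and 3: "\<And>x. n \<le> x \<Longrightarrow> V x = x"
    using assms unfolding matching_def by (auto simp: not_less[symmetric])
  show "x < n \<Longrightarrow> V x < n" using 1 2 3 by (metis not_le)
  show "V x = V y \<longleftrightarrow> x = y" using 1 by metis
qed

lemma transpose_simps [simp]:
  "transpose p (Suc p) p = Suc p" "transpose p (Suc p) (Suc p) = p"
  "transpose p (Suc p) (transpose p (Suc p) x) = x"
  by (auto simp: transpose_def)

lemma conj_swap_conj_swap [simp]: "conj_swap p (conj_swap p V) = V"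
  by (rule ext) (simp add: conj_swap_def)

lemma matching_conj_swap:
  assumes "matching n V" "Suc p < n"
  shows "matching n (conj_swap p V)"
  unfolding matching_def
proof (intro conjI allI)
  fix x
  let ?t = "transpose p (Suc p)"
  show "conj_swap p V (conj_swap p V x) = x"
    using assms by (simp add: conj_swap_def matchingD)
  have "conj_swap p V x \<noteq> x \<longleftrightarrow> V (?t x) \<noteq> ?t x"
    unfolding conj_swap_def by (metis transpose_simps(3))
  also have "\<dots> \<longleftrightarrow> ?t x < n" using assms(1) by (simp add: matching_def)
  also have "\<dots> \<longleftrightarrow> x < n" using assms(2) by (auto simp: transpose_def)
  finally show "conj_swap p V x \<noteq> x \<longleftrightarrow> x < n" .
qed

lemma crossing_sym:
  assumes "matching n V"
  shows "crossing V a b \<longleftrightarrow> crossing V b a" "crossing V (V a) b \<longleftrightarrow> crossing V a b"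
    "crossing V a (V b) \<longleftrightarrow> crossing V a b"
proof -
  obtain c d where cd: "c = V a" "d = V b" by auto
  have V: "V a = c" "V b = d" "V c = a" "V d = b" using cd matchingD(1)[OF assms(1)] by auto
  have ne: "a = b \<longleftrightarrow> c = d" "a = d \<longleftrightarrow> b = c" using V by metis+
  show "crossing V a b \<longleftrightarrow> crossing V b a"
    unfolding crossing_def V using ne by (cases "a < b"; cases "a < d"; cases "c < b"; cases "c < d") auto
  show "crossing V (V a) b \<longleftrightarrow> crossing V a b" "crossing V a (V b) \<longleftrightarrow> crossing V a b"
    unfolding crossing_def V using ne by auto
qed

text \<open>Exchanging the points \<open>p\<close> and \<open>Suc p\<close> joins each of them to
  the former partner of the other. If the two arcs cross, this pairing is one of the two resolutions
  of the crossing, so the conjugation is an uncrossing.\<close>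

lemma crossing_uncross_swap:
  assumes "matching n V" "crossing V p (Suc p)"
  shows "uncross V p (V (Suc p)) = conj_swap p V"
proof
  fix x
  obtain c d where cd: "c = V p" "d = V (Suc p)" by auto
  have V: "V p = c" "V (Suc p) = d" "V c = p" "V d = Suc p"
    using cd matchingD(1)[OF assms(1)] by auto
  have ne: "p \<noteq> c" "p \<noteq> d" "Suc p \<noteq> c" "Suc p \<noteq> d" "c \<noteq> d"
    using assms(2) V unfolding crossing_def by auto
  have o: "V x \<noteq> p" "V x \<noteq> Suc p" if "x \<notin> {c, d}"
    using that V matchingD(1)[OF assms(1), of x] by auto
  show "uncross V p (V (Suc p)) x = conj_swap p V x"
    using ne o unfolding uncross_def conj_swap_def V transpose_def
    by (auto simp: V)
qed

text \<open>The exchange reverses only the relative order of two adjacent ends of different arcs,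
  which turns a crossing into a non-crossing and conversely.\<close>

lemma conj_swap_crossing:
  assumes "matching n V" "Suc p < n" "V p \<noteq> Suc p"
  shows "crossing (conj_swap p V) p (Suc p) \<longleftrightarrow> \<not> crossing V p (Suc p)"
proof -
  obtain x y where xy: "x = V p" "y = V (Suc p)" by auto
  have ne: "x \<noteq> p" "y \<noteq> Suc p" "x \<noteq> Suc p" "y \<noteq> p" "x \<noteq> y"
    using assms matchingD(1,2,5)[OF assms(1)] unfolding xy by (metis Suc_lessD n_not_Suc_n)+
  then have "conj_swap p V p = y" "conj_swap p V (Suc p) = x"
    using xy by (auto simp: conj_swap_def transpose_def)
  then show ?thesis unfolding crossing_def xy[symmetric] using ne by auto
qed

lemma uncrossing_conj_swap:
  assumes "matching n V" "crossing V p (Suc p)"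
  shows "uncrossing V (conj_swap p V)"
proof -
  have "crossing V p (V (Suc p))" using assms crossing_sym(3) by simp
  then show ?thesis using crossing_uncross_swap[OF assms] unfolding uncrossing_def by metis
qed

lemma crossing_lt:
  assumes "matching n V" "crossing V a b"
  shows "a < n" "b < n" "V a < n" "V b < n"
  using assms unfolding crossing_def by (metis matchingD(3,4) not_le)+

lemma matching_uncross:
  assumes "matching n V" "crossing V a b"
  shows "matching n (uncross V a b)"
proof -
  obtain c d where cd: "c = V a" "d = V b" by auto
  have lt: "a < n" "b < n" "c < n" "d < n" using crossing_lt[OF assms] cd by auto
  have V: "V a = c" "V b = d" "V c = a" "V d = b" using cd matchingD(1)[OF assms(1)] by auto
  have ne: "a \<noteq> b" "a \<noteq> c" "b \<noteq> c" "b \<noteq> d" "a \<noteq> d" "c \<noteq> d"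
    using assms(2) cd V unfolding crossing_def by metis+
  have W: "uncross V a b = V(a := b, b := a, c := d, d := c)" using V by (simp add: uncross_def)
  have o: "V x \<notin> {a, b, c, d}" if "x \<notin> {a, b, c, d}" for x
    using that V matchingD(1)[OF assms(1)] by (metis insert_iff singletonD)
  show ?thesis unfolding matching_def
  proof (intro conjI allI)
    fix x
    show "uncross V a b (uncross V a b x) = x"
      using ne o[of x] matchingD(1)[OF assms(1)] unfolding W by auto
    show "uncross V a b x \<noteq> x \<longleftrightarrow> x < n"
      using ne lt assms(1) unfolding W matching_def by auto
  qed
qed

lemma matching_uncrossing: "matching n V \<Longrightarrow> uncrossing V W \<Longrightarrow> matching n W"
  unfolding uncrossing_def using matching_uncross by blast

lemma matching_uncrossings: "uncrossing\<^sup>*\<^sup>* V W \<Longrightarrow> matching n V \<Longrightarrow> matching n W"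
  by (induction rule: rtranclp_induct) (auto intro: matching_uncrossing)

section \<open>The lifting property for exchanges of neighbouring points\<close>

definition down :: "nat \<Rightarrow> (nat \<Rightarrow> nat) \<Rightarrow> nat \<Rightarrow> nat" where
  "down p V = (if crossing V p (Suc p) then conj_swap p V else V)"

lemma uncross_sym:
  assumes "matching n V" "crossing V a b"
  shows "uncross V a b = uncross V b a" "uncross V a b = uncross V (V a) (V b)"
proof -
  obtain c d where cd: "c = V a" "d = V b" by auto
  have V: "V a = c" "V b = d" "V c = a" "V d = b" using cd matchingD(1)[OF assms(1)] by auto
  have ne: "a \<noteq> b" "a \<noteq> c" "b \<noteq> c" "b \<noteq> d" "a \<noteq> d" "c \<noteq> d"
    using assms(2) cd V unfolding crossing_def by metis+
  show "uncross V a b = uncross V b a" "uncross V a b = uncross V (V a) (V b)"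
    using ne unfolding uncross_def V by (auto simp: fun_eq_iff)
qed

lemma conj_swap_eq:
  assumes V: "matching n V" "crossing V p (Suc p)" "V p = x" "V (Suc p) = w"
  shows "conj_swap p V = V(p := w, w := p, x := Suc p, Suc p := x)"
proof -
  have V': "V x = p" "V w = Suc p" using V matchingD(1)[OF V(1)] by auto
  show ?thesis
    using crossing_uncross_swap[OF V(1,2)] unfolding uncross_def V V' by simp
qed

text \<open>Crossing is invariant under rotation, so the points may be read on a circle starting at
  \<open>p\<close>, with \<open>Suc p\<close> represented by \<open>p\<close>. The hypothesis
  \<open>cr\<close> says that the arcs p-x and (p+1)-w cross and puts \<open>x\<close> before
  \<open>w\<close>. The further hypotheses force the order p, v, x, w, u in the first claim and p,
  u, x, w, v in the second; both conclusions are read off from it.\<close>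

lemma cyclic_order:
  fixes p x w u v :: nat
  assumes ne: "p \<noteq> x" "p \<noteq> w" "x \<noteq> w" "u \<noteq> v" "u \<noteq> p" "u \<noteq> x" "u \<noteq> w" "v \<noteq> p" "v \<noteq> x" "v \<noteq> w"
    and cr: "(x < p) \<noteq> ((p < w) = (x < w))"
  shows "((p < u) = (x < u)) \<noteq> ((p < v) = (x < v)) \<Longrightarrow> (u < p) = ((p < w) = (u < w)) \<Longrightarrow>
      (((p < u) = (w < u)) \<noteq> ((p < v) = (w < v))) \<and> (((p < w) = (x < w)) \<noteq> ((p < v) = (x < v)))"
    and "((p < u) = (w < u)) \<noteq> ((p < v) = (w < v)) \<Longrightarrow> (x < p) = ((p < u) = (x < u)) \<Longrightarrow>
      (((p < u) = (x < u)) \<noteq> ((p < v) = (x < v))) \<and> (((p < x) = (w < x)) \<noteq> ((p < v) = (w < v)))"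
proof -
  have i: "a < c" if "a < b" "b < c" for a b c :: nat using that by simp
  have t: "a < b \<longleftrightarrow> \<not> b < a" if "a \<noteq> b" for a b :: nat using that by auto
  note facts = cr ne t[of p x] t[of p w] t[of p u] t[of p v]
      t[of x w] t[of x u] t[of x v] t[of w u] t[of w v]
      i[of p x w] i[of p w x] i[of x p w] i[of w p x] i[of x w p] i[of w x p]
      i[of p x u] i[of p u x] i[of x p u] i[of u p x] i[of x u p] i[of u x p]
      i[of p x v] i[of p v x] i[of x p v] i[of v p x] i[of x v p] i[of v x p]
      i[of p w u] i[of p u w] i[of w p u] i[of u p w] i[of w u p] i[of u w p]
      i[of p w v] i[of p v w] i[of w p v] i[of v p w] i[of w v p] i[of v w p]
      i[of x w u] i[of x u w] i[of w x u] i[of u x w] i[of w u x] i[of u w x]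
      i[of x w v] i[of x v w] i[of w x v] i[of v x w] i[of w v x] i[of v w x]
  show "(((p < u) = (w < u)) \<noteq> ((p < v) = (w < v))) \<and> (((p < w) = (x < w)) \<noteq> ((p < v) = (x < v)))"
    if "((p < u) = (x < u)) \<noteq> ((p < v) = (x < v))" "(u < p) = ((p < w) = (u < w))"
    using that facts by (smt (verit))
  show "(((p < u) = (x < u)) \<noteq> ((p < v) = (x < v))) \<and> (((p < x) = (w < x)) \<noteq> ((p < v) = (w < v)))"
    if "((p < u) = (w < u)) \<noteq> ((p < v) = (w < v))" "(x < p) = ((p < u) = (x < u))"
    using that facts by (smt (verit))
qed

text \<open>The uncrossing involves one arc at \<open>p\<close> or \<open>Suc p\<close> and a
  further arc u-v. After the exchange \<open>V\<close> has the arcs p-w and (p+1)-x. If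
  \<open>W\<close> still crosses at \<open>p\<close>, the same uncrossing with \<open>p\<close> and
  \<open>Suc p\<close> interchanged leads to the exchanged \<open>W\<close>. Otherwise
  \<open>W\<close> itself has to be reached, which takes two uncrossings.\<close>

lemma lifting_aux:
  fixes p x w u v :: nat
  assumes V: "matching n V" "crossing V p (Suc p)" "V p = x" "V (Suc p) = w"
    and a: "a = p \<or> a = Suc p" and u: "V u = v" "crossing V a u" "u \<notin> {p, Suc p, x, w}"
    and W: "W = uncross V a u"
  shows "uncrossing\<^sup>*\<^sup>* (conj_swap p V) (down p W)"
proof -
  have V': "V x = p" "V w = Suc p" "V v = u" using V u matchingD(1)[OF V(1)] by auto
  have ne: "p \<noteq> x" "p \<noteq> w" "Suc p \<noteq> x" "Suc p \<noteq> w" "x \<noteq> w"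
    using V(2,3,4) V' unfolding crossing_def by (metis n_not_Suc_n)+
  have ne2: "u \<noteq> v" "u \<noteq> p" "u \<noteq> Suc p" "u \<noteq> x" "u \<noteq> w" using u unfolding crossing_def by auto
  have ne3: "v \<noteq> p" "v \<noteq> Suc p" "v \<noteq> x" "v \<noteq> w" using V V' u by auto
  have cr: "((p < Suc p) = (x < Suc p)) \<noteq> ((p < w) = (x < w))"
    using V(2) unfolding crossing_def V by auto
  have lt: "(Suc p < y) = (p < y)" "(y < Suc p) = (y < p)" if "y \<noteq> p" "y \<noteq> Suc p" for y using that by auto
  note lts = lt[of x] lt[of w] lt[of u] lt[of v]
  have cr': "(x < p) \<noteq> ((p < w) = (x < w))" using cr lts ne by auto
  note cyc = cyclic_order[OF ne(1,2,5) ne2(1,2,4,5) ne3(1,3,4) cr']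
  note S = conj_swap_eq[OF V]
  have mW: "matching n W" using matching_uncross[OF V(1) u(2)] W by simp
  have vals: "conj_swap p V p = w" "conj_swap p V (Suc p) = x" "conj_swap p V u = v"
    "conj_swap p V x = Suc p" "conj_swap p V w = p" "conj_swap p V v = u"
    unfolding S using ne ne2 ne3 u(1) V' by auto
  show ?thesis
  proof (cases "a = p")
    case True
    have W': "W = V(p := u, u := p, x := v, v := x)"
      using True by (simp add: W uncross_def V u)
    have Wv: "W p = u" "W (Suc p) = w" unfolding W' using ne ne2 ne3 V by auto
    have cr2: "((p < u) = (x < u)) \<noteq> ((p < v) = (x < v))"
      using u(2) unfolding True crossing_def V u by auto
    show ?thesis
    proof (cases "crossing W p (Suc p)")
      case cW: True
      have "((Suc p < u) = (x < u)) \<noteq> ((Suc p < v) = (x < v))"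
        using ne2 ne3 cr2 lts by simp
      then have "crossing (conj_swap p V) (Suc p) u"
        unfolding crossing_def vals using ne ne2 ne3 by auto
      moreover have "conj_swap p W = uncross (conj_swap p V) (Suc p) u"
        unfolding conj_swap_eq[OF mW cW Wv] uncross_def vals unfolding S W'
        by (rule ext) (use ne ne2 ne3 in simp)
      ultimately show ?thesis using cW unfolding uncrossing_def down_def by (auto intro: r_into_rtranclp)
    next
      case cW: False
      then have ncr: "((p < Suc p) = (u < Suc p)) = ((p < w) = (u < w))"
        using ne ne2 Wv unfolding crossing_def by auto
      \<comment> \<open>The cyclic order is now p, p+1, v, x, w, u. The arc p-w is resolved against
        u-v into p-u and w-v, and then (p+1)-x against w-v into (p+1)-w and x-v, which gives
        \<open>W\<close>.\<close>
      define W1 where "W1 = uncross (conj_swap p V) p u"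
      have W1: "W1 = V(p := u, u := p, w := v, v := w, x := Suc p, Suc p := x)"
        unfolding W1_def uncross_def vals unfolding S by (rule ext) (use ne ne2 ne3 in simp)
      have W1v: "W1 (Suc p) = x" "W1 w = v" unfolding W1 using ne ne2 ne3 by auto
      have "(u < p) = ((p < w) = (u < w))" using ncr lts ne2 by simp
      note o = cyc(1)[OF cr2 this]
      then have "((p < u) = (w < u)) \<noteq> ((p < v) = (w < v))" by blast
      then have "crossing (conj_swap p V) p u"
        unfolding crossing_def vals using ne ne2 ne3 by auto
      moreover have "((Suc p < w) = (x < w)) \<noteq> ((Suc p < v) = (x < v))"
        using o ne ne3 lts by simp
      then have "crossing W1 (Suc p) w"
        unfolding crossing_def W1v using ne ne2 ne3 by auto
      moreover have "W = uncross W1 (Suc p) w"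
        unfolding uncross_def W1v unfolding W1 W' by (rule ext) (use ne ne2 ne3 V V' in simp)
      ultimately have "uncrossing (conj_swap p V) W1" "uncrossing W1 W"
        unfolding uncrossing_def W1_def by blast+
      then show ?thesis using cW by (simp add: down_def)
    qed
  next
    case False
    then have True: "a = Suc p" using a by simp
    have W': "W = V(Suc p := u, u := Suc p, w := v, v := w)"
      using True by (simp add: W uncross_def V u)
    have Wv: "W p = x" "W (Suc p) = u" unfolding W' using ne ne2 ne3 V by auto
    have cr2: "((Suc p < u) = (w < u)) \<noteq> ((Suc p < v) = (w < v))"
      using u(2) unfolding True crossing_def V u by auto
    show ?thesis
    proof (cases "crossing W p (Suc p)")
      case cW: True
      have "((p < u) = (w < u)) \<noteq> ((p < v) = (w < v))"
        using ne2 ne3 cr2 lts by simp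
      then have "crossing (conj_swap p V) p u"
        unfolding crossing_def vals using ne ne2 ne3 by auto
      moreover have "conj_swap p W = uncross (conj_swap p V) p u"
        unfolding conj_swap_eq[OF mW cW Wv] uncross_def vals unfolding S W'
        by (rule ext) (use ne ne2 ne3 in simp)
      ultimately show ?thesis using cW unfolding uncrossing_def down_def by (auto intro: r_into_rtranclp)
    next
      case cW: False
      then have ncr: "((p < Suc p) = (x < Suc p)) = ((p < u) = (x < u))"
        using ne ne2 Wv unfolding crossing_def by auto
      \<comment> \<open>The mirror image, with cyclic order p, p+1, u, x, w, v: first (p+1)-x is
        resolved against u-v, then p-w against x-v.\<close>
      define W1 where "W1 = uncross (conj_swap p V) (Suc p) u"
      have W1: "W1 = V(Suc p := u, u := Suc p, x := v, v := x, w := p, p := w)"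
        unfolding W1_def uncross_def vals unfolding S by (rule ext) (use ne ne2 ne3 in simp)
      have W1v: "W1 p = w" "W1 x = v" unfolding W1 using ne ne2 ne3 by auto
      have "(x < p) = ((p < u) = (x < u))" "((p < u) = (w < u)) \<noteq> ((p < v) = (w < v))"
        using ncr cr2 lts ne ne2 ne3 by simp_all
      note o = cyc(2)[OF this(2,1)]
      then have "((Suc p < u) = (x < u)) \<noteq> ((Suc p < v) = (x < v))" using ne2 ne3 lts by simp
      then have "crossing (conj_swap p V) (Suc p) u"
        unfolding crossing_def vals using ne ne2 ne3 by auto
      moreover have "((p < x) = (w < x)) \<noteq> ((p < v) = (w < v))"
        using o by blast
      then have "crossing W1 p x"
        unfolding crossing_def W1v using ne ne2 ne3 by auto
      moreover have "W = uncross W1 p x"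
        unfolding uncross_def W1v unfolding W1 W' by (rule ext) (use ne ne2 ne3 V V' in simp)
      ultimately have "uncrossing (conj_swap p V) W1" "uncrossing W1 W"
        unfolding uncrossing_def W1_def by blast+
      then show ?thesis using cW by (simp add: down_def)
    qed
  qed
qed

text \<open>If \<open>V\<close> crosses at \<open>p\<close>, the uncrossing involves both arcs at
  \<open>p\<close> and \<open>Suc p\<close>, or one of them, or neither. In the first case
  \<open>W\<close> is the exchanged \<open>V\<close>, because the other resolution would join
  \<open>p\<close> to \<open>Suc p\<close>. The second case is \<open>lifting_aux\<close>. In the
  third the uncrossing commutes with the exchange.\<close>

lemma lifting:
  assumes V: "matching n V" and W: "uncrossing V W" and p: "Suc p < n" "W p \<noteq> Suc p"
  shows "uncrossing\<^sup>*\<^sup>* (down p V) (down p W)"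
proof (cases "crossing V p (Suc p)")
  case False
  have "uncrossing\<^sup>*\<^sup>* W (down p W)"
    using uncrossing_conj_swap[OF matching_uncrossing[OF V W]] by (auto simp: down_def)
  then show ?thesis using False W by (auto simp: down_def intro: converse_rtranclp_into_rtranclp)
next
  case True
  obtain a b where ab: "crossing V a b" "W = uncross V a b" using W unfolding uncrossing_def by blast
  obtain x w where xw: "V p = x" "V (Suc p) = w" by auto
  have V': "V x = p" "V w = Suc p" using xw matchingD(1)[OF V] by auto
  have ne: "p \<noteq> x" "p \<noteq> w" "Suc p \<noteq> x" "Suc p \<noteq> w" "x \<noteq> w"
    using True V' unfolding crossing_def xw by (metis n_not_Suc_n xw)+
  \<comment> \<open>One uncrossing has several descriptions by ends. \<open>H\<close> is closed
    under interchanging the two arcs and under passing to both partners, so an end lying on an arc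
    at \<open>p\<close> or \<open>Suc p\<close> can be moved to \<open>p\<close> or
    \<open>Suc p\<close> itself.\<close>
  define H where "H a b \<longleftrightarrow> crossing V a b \<and> W = uncross V a b" for a b
  have H: "H a b" using ab by (simp add: H_def)
  have Hs: "H b a" "H (V a) (V b)" if "H a b" for a b
    using that crossing_sym[OF V] uncross_sym[OF V] unfolding H_def by metis+
  have Hv: "W a = b \<and> W b = a" if "H a b" for a b
  proof -
    have "crossing V a b" "W = uncross V a b" using that unfolding H_def by auto
    then show ?thesis using matchingD(1)[OF V] unfolding crossing_def uncross_def
      by (simp add: fun_upd_def)
  qed
  have key: "uncrossing\<^sup>*\<^sup>* (down p V) (down p W)" if "H a b" "a = p \<or> a = Suc p" for a b
  proof (cases "b \<in> {p, Suc p, x, w}")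
    case False
    show ?thesis using lifting_aux[OF V True xw that(2) refl _ False] that(1) True
      unfolding H_def down_def by auto
  next
    case b: True
    have "b \<noteq> a" "b \<noteq> V a" using that(1) unfolding H_def crossing_def by auto
    then have "(a = p \<and> (b = Suc p \<or> b = w)) \<or> (a = Suc p \<and> (b = p \<or> b = x))"
      using that(2) b xw by auto
    moreover have "W a = b" "W b = a" using Hv that(1) by auto
    moreover have "H w p" if "a = Suc p" "b = x" using Hs(2)[OF \<open>H a b\<close>] that xw V' by simp
    moreover have "H p w" if "H w p" using Hs(1)[OF that] .
    ultimately have "W p = Suc p \<or> W = uncross V p w"
      using that(1) unfolding H_def by metis
    then have "W = conj_swap p V" using p(2) crossing_uncross_swap[OF V True] xw by auto
    moreover have "V p \<noteq> Suc p" using ne xw by auto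
    ultimately have "down p W = W" "down p V = W"
      using conj_swap_crossing[OF V p(1)] True unfolding down_def by auto
    then show ?thesis by simp
  qed
  show ?thesis
  proof (cases "a \<in> {p, Suc p, x, w} \<or> b \<in> {p, Suc p, x, w}")
    case True
    then show ?thesis using key[OF H] key[OF Hs(1)[OF H]] key[OF Hs(2)[OF H]]
        key[OF Hs(1)[OF Hs(2)[OF H]]] V' by auto
  next
    case False
    obtain c d where cd: "V a = c" "V b = d" by auto
    have V2: "V c = a" "V d = b" using cd matchingD(1)[OF V] by auto
    have nab: "a \<noteq> p" "a \<noteq> Suc p" "a \<noteq> x" "a \<noteq> w" "b \<noteq> p" "b \<noteq> Suc p" "b \<noteq> x" "b \<noteq> w"
      "c \<noteq> p" "c \<noteq> Suc p" "c \<noteq> x" "c \<noteq> w" "d \<noteq> p" "d \<noteq> Suc p" "d \<noteq> x" "d \<noteq> w"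
      using False V2 xw V' by auto
    have ne2: "a \<noteq> b" "a \<noteq> c" "b \<noteq> c" "b \<noteq> d" "a \<noteq> d" "c \<noteq> d"
      using ab(1) cd V2 unfolding crossing_def by metis+
    have W': "W = V(a := b, b := a, c := d, d := c)" using ab cd by (simp add: uncross_def)
    have Wv: "W p = x" "W (Suc p) = w" unfolding W' using nab xw by auto
    have cW: "crossing W p (Suc p)" using True unfolding crossing_def Wv xw by simp
    note mW = matching_uncrossing[OF V W]
    note S = conj_swap_eq[OF V True xw]
    have vals: "conj_swap p V a = c" "conj_swap p V b = d" unfolding S using nab cd by auto
    have "crossing (conj_swap p V) a b" using ab(1) unfolding crossing_def vals cd by simp
    moreover have "conj_swap p W = uncross (conj_swap p V) a b"
      unfolding conj_swap_eq[OF mW cW Wv] uncross_def vals unfolding S W'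
      by (rule ext) (use ne nab ne2 in simp)
    ultimately show ?thesis using cW True unfolding uncrossing_def down_def
      by (auto intro: r_into_rtranclp)
  qed
qed

section \<open>Counting arcs inside intervals\<close>

lemma finite_inner: "finite {x. V x \<noteq> x \<and> i \<le> x \<and> x < (j::nat) \<and> i \<le> V x \<and> V x < j}"
  by (rule finite_subset[of _ "{..<j}"]) auto

lemma inner_count_Suc_right:
  assumes "matching n V"
  shows "inner_count V i (Suc j) = inner_count V i j + (if i \<le> V j \<and> V j < j then 2 else 0)"
proof -
  let ?S = "\<lambda>j. {x. V x \<noteq> x \<and> i \<le> x \<and> x < j \<and> i \<le> V x \<and> V x < j}"
  have *: "V (V x) = x" for x using matchingD(1)[OF assms] .
  have **: "V x = j \<longleftrightarrow> x = V j" for x using * by metis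
  show ?thesis
  proof (cases "i \<le> V j \<and> V j < j")
    case True
    have eq: "?S (Suc j) = insert j (insert (V j) (?S j))"
    proof (intro set_eqI)
      fix x
      show "x \<in> ?S (Suc j) \<longleftrightarrow> x \<in> insert j (insert (V j) (?S j))"
        using True *[of j] **[of x] by (cases "x = j"; cases "x = V j") (auto simp: less_Suc_eq)
    qed
    have "j \<notin> insert (V j) (?S j)" "V j \<notin> ?S j" using True * by auto
    then show ?thesis using True finite_inner[of V i j] unfolding inner_count_def eq by simp
  next
    case False
    have "?S (Suc j) = ?S j"
    proof (intro set_eqI)
      fix x
      show "x \<in> ?S (Suc j) \<longleftrightarrow> x \<in> ?S j"
        using False **[of x] by (cases "x = j"; cases "x = V j") (auto simp: less_Suc_eq)
    qed
    then show ?thesis using False by (simp add: inner_count_def)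
  qed
qed

lemma inner_count_Suc_left:
  assumes "matching n V"
  shows "inner_count V i j = inner_count V (Suc i) j + (if i < V i \<and> V i < j then 2 else 0)"
proof -
  let ?S = "\<lambda>i. {x. V x \<noteq> x \<and> i \<le> x \<and> x < j \<and> i \<le> V x \<and> V x < j}"
  have *: "V (V x) = x" for x using matchingD(1)[OF assms] .
  have **: "V x = i \<longleftrightarrow> x = V i" for x using * by metis
  show ?thesis
  proof (cases "i < V i \<and> V i < j")
    case True
    have eq: "?S i = insert i (insert (V i) (?S (Suc i)))"
    proof (intro set_eqI)
      fix x
      show "x \<in> ?S i \<longleftrightarrow> x \<in> insert i (insert (V i) (?S (Suc i)))"
        using True *[of i] **[of x] by (cases "x = i"; cases "x = V i") auto
    qed
    have "i \<notin> insert (V i) (?S (Suc i))" "V i \<notin> ?S (Suc i)" using True * by auto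
    then show ?thesis using True finite_inner[of V "Suc i" j] unfolding inner_count_def eq by simp
  next
    case False
    have "?S i = ?S (Suc i)"
    proof (intro set_eqI)
      fix x
      show "x \<in> ?S i \<longleftrightarrow> x \<in> ?S (Suc i)"
        using False **[of x] by (cases "x = i"; cases "x = V i") auto
    qed
    then show ?thesis using False by (simp add: inner_count_def)
  qed
qed

lemma inner_count_empty: "j \<le> i \<Longrightarrow> inner_count V i j = 0"
  unfolding inner_count_def by (rule card_eq_0_iff[THEN iffD2]) auto

text \<open>A cut different from \<open>Suc p\<close> has \<open>p\<close> and \<open>Suc p\<close>
  on the same side, so the transposition preserves membership in the interval.\<close>

lemma inner_count_conj_swap:
  assumes "i \<noteq> Suc p" "j \<noteq> Suc p"
  shows "inner_count (conj_swap p V) i j = inner_count V i j"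
proof -
  let ?t = "transpose p (Suc p)"
  let ?S = "\<lambda>V. {x. V x \<noteq> x \<and> i \<le> x \<and> x < j \<and> i \<le> V x \<and> V x < j}"
  have t: "i \<le> ?t x \<longleftrightarrow> i \<le> x" "?t x < j \<longleftrightarrow> x < j" for x
    using assms by (auto simp: transpose_def)
  have inj: "?t x = ?t y \<longleftrightarrow> x = y" for x y by (metis transpose_simps(3))
  have "?S (conj_swap p V) = ?t ` ?S V"
  proof (intro set_eqI iffI)
    fix x assume x: "x \<in> ?S (conj_swap p V)"
    have "?t x \<in> ?S V" using x t inj[of "V (?t x)" "?t x"] by (auto simp: conj_swap_def)
    then show "x \<in> ?t ` ?S V" by (intro image_eqI[of _ _ "?t x"]) simp_all
  next
    fix x assume "x \<in> ?t ` ?S V"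
    then obtain y where y: "x = ?t y" "y \<in> ?S V" by blast
    have "conj_swap p V x = ?t (V y)" using y by (simp add: conj_swap_def)
    then show "x \<in> ?S (conj_swap p V)" using y(2) unfolding y(1) by (simp add: t inj)
  qed
  moreover have "inj_on ?t (?S V)" by (rule inj_onI) (simp only: inj)
  ultimately show ?thesis unfolding inner_count_def by (simp add: card_image)
qed

lemma inner_count_split:
  assumes "V a = c" "V b = d" "V c = a" "V d = b" and ne: "a \<noteq> b" "a \<noteq> c" "b \<noteq> c" "b \<noteq> d" "a \<noteq> d" "c \<noteq> d"
  shows "inner_count V i j = card {x. x \<notin> {a, b, c, d} \<and> V x \<noteq> x \<and> i \<le> x \<and> x < j \<and> i \<le> V x \<and> V x < j}
     + (if {a, c} \<subseteq> {i..<j} then 2 else 0) + (if {b, d} \<subseteq> {i..<j} then 2 else 0)"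
proof -
  let ?S = "{x. V x \<noteq> x \<and> i \<le> x \<and> x < j \<and> i \<le> V x \<and> V x < j}"
  let ?R = "{x. x \<notin> {a, b, c, d} \<and> V x \<noteq> x \<and> i \<le> x \<and> x < j \<and> i \<le> V x \<and> V x < j}"
  define A where "A = (if {a, c} \<subseteq> {i..<j} then {a, c} else {})"
  define B where "B = (if {b, d} \<subseteq> {i..<j} then {b, d} else {})"
  have AB: "A \<subseteq> {a, c}" "B \<subseteq> {b, d}" by (auto simp: A_def B_def)
  have "?S = ?R \<union> A \<union> B"
  proof (intro set_eqI)
    fix x
    consider "x = a" | "x = b" | "x = c" | "x = d" | "x \<notin> {a, b, c, d}" by blast
    then show "x \<in> ?S \<longleftrightarrow> x \<in> ?R \<union> A \<union> B"
      by cases (use ne assms(1-4) in \<open>auto simp: A_def B_def\<close>)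
  qed
  moreover have "finite ?R" by (rule finite_subset[OF _ finite_inner[of V i j]]) auto
  moreover have "?R \<inter> A = {}" "(?R \<union> A) \<inter> B = {}" using ne AB by blast+
  moreover have "finite A" "finite B" using AB by (auto intro: finite_subset)
  ultimately have "card ?S = card ?R + card A + card B"
    by (simp only: card_Un_disjoint finite_UnI)
  moreover have "card A = (if {a, c} \<subseteq> {i..<j} then 2 else 0)" "card B = (if {b, d} \<subseteq> {i..<j} then 2 else 0)"
    using ne by (simp_all add: A_def B_def)
  ultimately show ?thesis unfolding inner_count_def by simp
qed

text \<open>An interval containing a whole arc also contains one end of any arc crossing it, hence
  three of the four points, and any three of them include both ends of a new arc. If it contains
  both old arcs, it contains both new ones.\<close>

lemma inner_count_uncross:
  assumes "matching n V" "crossing V a b"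
  shows "inner_count V i j \<le> inner_count (uncross V a b) i j"
proof -
  obtain c d where cd: "c = V a" "d = V b" by auto
  have V: "V a = c" "V b = d" "V c = a" "V d = b" using cd matchingD(1)[OF assms(1)] by auto
  have ne: "a \<noteq> b" "a \<noteq> c" "b \<noteq> c" "b \<noteq> d" "a \<noteq> d" "c \<noteq> d"
    using assms(2) cd V unfolding crossing_def by metis+
  have cr: "((a < b) = (c < b)) \<noteq> ((a < d) = (c < d))"
    using assms(2) V unfolding crossing_def by auto
  define W where "W = uncross V a b"
  have W: "W = V(a := b, b := a, c := d, d := c)" using V by (simp add: uncross_def W_def)
  have Wv: "W a = b" "W c = d" "W b = a" "W d = c" unfolding W using ne by auto
  let ?R = "\<lambda>V. {x. x \<notin> {a, b, c, d} \<and> V x \<noteq> x \<and> i \<le> x \<and> x < j \<and> i \<le> V x \<and> V x < j}"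
  have R: "?R W = ?R V" unfolding W by auto
  have "inner_count W i j = card (?R W) + (if {a, b} \<subseteq> {i..<j} then 2 else 0) + (if {c, d} \<subseteq> {i..<j} then 2 else 0)"
    using inner_count_split[of W, OF Wv, of i j] ne by (auto simp: insert_commute)
  moreover have "inner_count V i j = card (?R V) + (if {a, c} \<subseteq> {i..<j} then 2 else 0) + (if {b, d} \<subseteq> {i..<j} then 2 else 0)"
    using inner_count_split[of V, OF V ne, of i j] .
  moreover have "b \<in> {i..<j} \<or> d \<in> {i..<j}" if "{a, c} \<subseteq> {i..<j}"
  proof -
    have "i \<le> a" "a < j" "i \<le> c" "c < j" using that by auto
    then have "(i \<le> b \<and> b < j) \<or> (i \<le> d \<and> d < j)" using cr ne
      by (cases "a < b"; cases "c < b"; cases "a < d"; cases "c < d") auto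
    then show ?thesis by simp
  qed
  moreover have "a \<in> {i..<j} \<or> c \<in> {i..<j}" if "{b, d} \<subseteq> {i..<j}"
  proof -
    have "i \<le> b" "b < j" "i \<le> d" "d < j" using that by auto
    then have "(i \<le> a \<and> a < j) \<or> (i \<le> c \<and> c < j)" using cr ne
      by (cases "a < b"; cases "c < b"; cases "a < d"; cases "c < d") auto
    then show ?thesis by simp
  qed
  ultimately show ?thesis unfolding W_def[symmetric] R by auto
qed

lemma inner_count_uncrossing:
  "matching n V \<Longrightarrow> uncrossing V W \<Longrightarrow> inner_count V i j \<le> inner_count W i j"
  unfolding uncrossing_def using inner_count_uncross by blast

text \<open>Expresses by counts that \<open>p\<close> and \<open>Suc p\<close> are joined, so that
  this property can be transported along inequalities between counts.\<close>

lemma inner_count_joined: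
  assumes "matching n V" "Suc p < n"
  shows "inner_count V p (Suc (Suc p)) = (if V p = Suc p then 2 else 0)"
proof -
  have "V (Suc p) = p \<longleftrightarrow> V p = Suc p" using matchingD(1)[OF assms(1)] by metis
  then show ?thesis
    using assms inner_count_Suc_right[OF assms(1), of p "Suc p"] inner_count_Suc_right[OF assms(1), of p p]
      inner_count_empty[of p p] by auto
qed

text \<open>At the cut between the points \<open>p\<close> and \<open>Suc p\<close> a crossing makes the count as small as its
  two neighbours allow, and a non-crossing as large.\<close>
lemma inner_count_crossing_right:
  assumes V: "matching n V" "crossing V p (Suc p)"
  shows "inner_count V i (Suc p) = inner_count V i p \<or> inner_count V i (Suc p) + 2 = inner_count V i (Suc (Suc p))"
proof -
  obtain x w where xw: "V p = x" "V (Suc p) = w" by auto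
  have "x \<noteq> p" "w \<noteq> Suc p" "x \<noteq> Suc p" "x \<noteq> w" "w \<noteq> p" "((p < Suc p) = (x < Suc p)) \<noteq> ((p < w) = (x < w))"
    using V(2) xw matchingD(1)[OF V(1)] unfolding crossing_def by (metis n_not_Suc_n)+
  then have "i \<le> x \<and> x < p \<Longrightarrow> i \<le> w \<and> w < Suc p" by auto
  then show ?thesis
    using inner_count_Suc_right[OF V(1), of i p] inner_count_Suc_right[OF V(1), of i "Suc p"] xw
    by auto
qed

lemma inner_count_crossing_left:
  assumes V: "matching n V" "crossing V p (Suc p)"
  shows "inner_count V (Suc p) j = inner_count V (Suc (Suc p)) j \<or> inner_count V (Suc p) j + 2 = inner_count V p j"
proof -
  obtain x w where xw: "V p = x" "V (Suc p) = w" by auto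
  have "x \<noteq> p" "w \<noteq> Suc p" "x \<noteq> Suc p" "x \<noteq> w" "w \<noteq> p" "((p < Suc p) = (x < Suc p)) \<noteq> ((p < w) = (x < w))"
    using V(2) xw matchingD(1)[OF V(1)] unfolding crossing_def by (metis n_not_Suc_n)+
  then have "Suc p < w \<and> w < j \<Longrightarrow> p < x \<and> x < j" by auto
  then show ?thesis
    using inner_count_Suc_left[OF V(1), of p j] inner_count_Suc_left[OF V(1), of "Suc p" j] xw
    by auto
qed

text \<open>Concavity in the right end at the cut \<open>Suc p\<close>: if adding the point
  \<open>Suc p\<close> completes an arc, then the arc at \<open>p\<close> is nested inside it and
  was completed when \<open>p\<close> was added.\<close>

lemma inner_count_noncrossing_right:
  assumes V: "matching n V" "\<not> crossing V p (Suc p)" "Suc p < n" "V p \<noteq> Suc p"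
  shows "inner_count V i p + inner_count V i (Suc (Suc p)) \<le> 2 * inner_count V i (Suc p)"
proof -
  obtain x w where xw: "V p = x" "V (Suc p) = w" by auto
  have ne: "x \<noteq> p" "w \<noteq> Suc p" "x \<noteq> Suc p" "x \<noteq> w" "w \<noteq> p"
    using V(3,4) xw matchingD(1,2,5)[OF V(1)] by (metis Suc_lessD n_not_Suc_n)+
  then have "((p < Suc p) = (x < Suc p)) = ((p < w) = (x < w))"
    using V(2) xw unfolding crossing_def by auto
  then have "i \<le> w \<and> w < Suc p \<Longrightarrow> i \<le> x \<and> x < p" using ne by auto
  then show ?thesis
    using inner_count_Suc_right[OF V(1), of i p] inner_count_Suc_right[OF V(1), of i "Suc p"] xw
    by auto
qed

lemma inner_count_noncrossing_left:
  assumes V: "matching n V" "\<not> crossing V p (Suc p)" "Suc p < n" "V p \<noteq> Suc p"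
  shows "inner_count V p j + inner_count V (Suc (Suc p)) j \<le> 2 * inner_count V (Suc p) j"
proof -
  obtain x w where xw: "V p = x" "V (Suc p) = w" by auto
  have ne: "x \<noteq> p" "w \<noteq> Suc p" "x \<noteq> Suc p" "x \<noteq> w" "w \<noteq> p"
    using V(3,4) xw matchingD(1,2,5)[OF V(1)] by (metis Suc_lessD n_not_Suc_n)+
  then have "((p < Suc p) = (x < Suc p)) = ((p < w) = (x < w))"
    using V(2) xw unfolding crossing_def by auto
  then have "p < x \<and> x < j \<Longrightarrow> Suc p < w \<and> w < j" using ne by auto
  then show ?thesis
    using inner_count_Suc_left[OF V(1), of p j] inner_count_Suc_left[OF V(1), of "Suc p" j] xw
    by auto
qed

definition total_count :: "nat \<Rightarrow> (nat \<Rightarrow> nat) \<Rightarrow> nat" where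
  "total_count n V = (\<Sum>i\<le>n. \<Sum>j\<le>n. inner_count V i j)"

text \<open>The measure of the main induction drops. \<open>V\<close> is an uncrossing of the
  exchanged involution, so no count increases. Strictness comes from an interval ending just after
  \<open>p\<close> or starting at \<open>Suc p\<close> that exactly spans an arc of
  \<open>V\<close>: after the exchange the same inner point is joined to a point outside.\<close>

lemma total_count_conj_swap:
  assumes V: "matching n V" "\<not> crossing V p (Suc p)" "Suc p < n" "V p \<noteq> Suc p"
  shows "total_count n (conj_swap p V) < total_count n V"
proof -
  let ?W = "conj_swap p V"
  have W: "matching n ?W" "crossing ?W p (Suc p)"
    using matching_conj_swap[OF V(1,3)] conj_swap_crossing[OF V(1,3,4)] V(2) by auto
  have step: "uncrossing ?W V" using uncrossing_conj_swap[OF W] by simp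
  have le: "inner_count ?W i j \<le> inner_count V i j" for i j
    using inner_count_uncrossing[OF W(1) step] .
  obtain x w where xw: "V p = x" "V (Suc p) = w" by auto
  have ne: "x \<noteq> p" "w \<noteq> Suc p" "x \<noteq> Suc p" "x \<noteq> w" "w \<noteq> p"
    using V(3,4) xw matchingD(1,2,5)[OF V(1)] by (metis Suc_lessD n_not_Suc_n)+
  have xn: "x < n" "w < n" using matchingD(4)[OF V(1)] V(3) xw by auto
  have ncr: "((p < Suc p) = (x < Suc p)) = ((p < w) = (x < w))"
    using V(2) xw ne unfolding crossing_def by auto
  have Wv: "?W p = w" "?W (Suc p) = x" using ne xw by (auto simp: conj_swap_def transpose_def)
  have "\<exists>i\<le>n. \<exists>j\<le>n. inner_count ?W i j < inner_count V i j"
  proof (cases "x < p")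
    case True
    then have "w < x \<or> p < w" using ncr ne by auto
    then have "inner_count ?W x (Suc p) < inner_count V x (Suc p)"
      using True inner_count_Suc_right[OF V(1), of x p] inner_count_Suc_right[OF W(1), of x p]
        inner_count_conj_swap[of x p p V] xw Wv by auto
    then show ?thesis using xn V(3) by (intro exI[of _ x] conjI exI[of _ "Suc p"]) auto
  next
    case False
    then have "Suc p < w" "w < x" using ncr ne by auto
    then have "inner_count ?W (Suc p) (Suc w) < inner_count V (Suc p) (Suc w)"
      using inner_count_Suc_left[OF V(1), of "Suc p" "Suc w"] inner_count_Suc_left[OF W(1), of "Suc p" "Suc w"]
        inner_count_conj_swap[of "Suc (Suc p)" p "Suc w" V] xw Wv by auto
    then show ?thesis using xn V(3) by (intro exI[of _ "Suc p"] conjI exI[of _ "Suc w"]) auto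
  qed
  then obtain i j where ij: "i \<le> n" "j \<le> n" "inner_count ?W i j < inner_count V i j" by blast
  have "(\<Sum>j\<le>n. inner_count ?W i j) < (\<Sum>j\<le>n. inner_count V i j)"
    using ij le by (intro sum_strict_mono_ex1) auto
  then show ?thesis unfolding total_count_def
    using ij le by (intro sum_strict_mono_ex1) (auto intro!: sum_mono)
qed

text \<open>The comparison is assumed only at cuts other than \<open>Suc p\<close>, where the
  exchange is invisible. At the cut \<open>Suc p\<close> the count of a crossing \<open>Z\<close>
  equals the one at \<open>p\<close>, or is 2 below the one at \<open>Suc (Suc p)\<close>; every
  involution has at least these values relative to its own neighbouring counts, so the comparison at
  the two neighbours suffices.\<close>

lemma inner_count_le_conj_swap:
  assumes Y: "matching n Y" and Z: "matching n Z" "crossing Z p (Suc p)" and p: "Suc p < n"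
    and le: "\<And>i j. i \<noteq> Suc p \<Longrightarrow> j \<noteq> Suc p \<Longrightarrow> inner_count Z i j \<le> inner_count Y i j"
  shows "inner_count Z i j \<le> inner_count (conj_swap p Y) i j"
proof -
  let ?W = "conj_swap p Y"
  note W = matching_conj_swap[OF Y p]
  have le': "inner_count Z i j \<le> inner_count ?W i j" if "i \<noteq> Suc p" "j \<noteq> Suc p" for i j
    using le[OF that] inner_count_conj_swap[OF that] by simp
  consider "i \<noteq> Suc p" "j \<noteq> Suc p" | "i \<noteq> Suc p" "j = Suc p" | "i = Suc p" "j \<noteq> Suc p" | "i = Suc p" "j = Suc p"
    by blast
  then show ?thesis
  proof cases
    case 1
    then show ?thesis by (rule le')
  next
    case 2
    then show ?thesis
      using inner_count_crossing_right[OF Z, of i] le'[of i p] le'[of i "Suc (Suc p)"]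
        inner_count_Suc_right[OF W, of i p] inner_count_Suc_right[OF W, of i "Suc p"]
      by (auto split: if_splits)
  next
    case 3
    then show ?thesis
      using inner_count_crossing_left[OF Z, of j] le'[of p j] le'[of "Suc (Suc p)" j]
        inner_count_Suc_left[OF W, of p j] inner_count_Suc_left[OF W, of "Suc p" j]
      by (auto split: if_splits)
  next
    case 4
    then show ?thesis by (simp add: inner_count_empty)
  qed
qed

section \<open>The involution in which all arcs cross\<close>

lemma shift_unique:
  fixes f :: "nat \<Rightarrow> nat"
  assumes bij: "bij_betw f {..<k} {k..<k+k}" and le: "\<And>p. p < k \<Longrightarrow> k + p \<le> f p" and p: "p < k"
  shows "f p = k + p"
proof (rule ccontr)
  assume "f p \<noteq> k + p"
  then have "k + p < f p" using le[OF p] by simp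
  \<comment> \<open>Both sums equal the sum of \<open>k\<close>, ..., \<open>2k - 1\<close>, so not
    even one inequality can be strict.\<close>
  then have "(\<Sum>p<k. k + p) < (\<Sum>p<k. f p)" using p le by (intro sum_strict_mono_ex1) auto
  also have "\<dots> = \<Sum>{k..<k+k}" using sum.reindex_bij_betw[OF bij, of "\<lambda>x. x"] by simp
  also have "\<dots> = (\<Sum>p<k. k + p)"
    using sum.shift_bounds_nat_ivl[of "\<lambda>x. x" 0 k k] by (simp add: atLeast0LessThan add.commute)
  finally show False by simp
qed

lemma initial_segment:
  assumes "finite L" "\<And>x y. x \<in> L \<Longrightarrow> y < x \<Longrightarrow> (y::nat) \<in> L"
  shows "L = {..<card L}"
proof (cases "L = {}")
  case False
  have "L = {..Max L}"
  proof (intro set_eqI iffI)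
    fix x assume "x \<in> {..Max L}"
    then show "x \<in> L" using assms(2)[OF Max_in[OF assms(1) False], of x] Max_in[OF assms(1) False]
      by (cases "x = Max L") auto
  qed (use assms(1) in auto)
  then show ?thesis by (metis card_atMost lessThan_Suc_atMost)
qed simp

text \<open>The hypothesis on neighbours forces \<open>n = 2 * k\<close> and
  \<open>Y p = k + p\<close> for \<open>p < k\<close>. No interval of length \<open>k\<close> then
  contains an arc of \<open>Y\<close>, hence none contains an arc of \<open>Z\<close>. This pushes
  the partner of each \<open>p < k\<close> in \<open>Z\<close> up to at least \<open>k + p\<close>,
  and a bijection with this property is the shift.\<close>

lemma top_unique:
  assumes Y: "matching n Y" and top: "\<And>p. Suc p < n \<Longrightarrow> Y p = Suc p \<or> crossing Y p (Suc p)"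
    and Z: "matching n Z" and le: "\<And>i j. inner_count Z i j \<le> inner_count Y i j"
  shows "Z = Y"
proof -
  note YY = matchingD[OF Y] and ZZ = matchingD[OF Z]
  define L where "L = {x. x < Y x}"
  have Ln: "L \<subseteq> {..<n}"
  proof
    fix x assume "x \<in> L"
    then show "x \<in> {..<n}" using YY(3)[of x] unfolding L_def by (cases "x < n") auto
  qed
  then have finL: "finite L" using finite_subset by blast
  \<comment> \<open>If \<open>p\<close> were an upper and \<open>Suc p\<close> a lower end, their
    arcs would lie side by side, neither joined nor crossing.\<close>
  have low: "p \<in> L" if "Suc p \<in> L" for p
  proof (rule ccontr)
    assume "p \<notin> L"
    moreover have p: "Suc p < n" using that Ln by auto
    ultimately have "Y p < p" using YY(2)[of p] unfolding L_def by force
    then show False using top[OF p] that YY(1) unfolding crossing_def L_def by auto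
  qed
  have low': "y \<in> L" if "x \<in> L" "y < x" for x y
    using that(2,1) by (induction rule: strict_inc_induct) (auto intro: low)
  define k where "k = card L"
  have Lk: "L = {..<k}" unfolding k_def using initial_segment[OF finL] low' by blast
  have kn: "k \<le> n" using Ln Lk by (metis card_lessThan card_mono finite_lessThan)
  have U: "Y ` L = {k..<n}"
  proof (intro set_eqI iffI)
    fix y assume "y \<in> Y ` L"
    then obtain x where x: "y = Y x" "x < Y x" "x < n" using Ln unfolding L_def by auto
    then have "y \<notin> L" using YY(1) unfolding L_def by auto
    then show "y \<in> {k..<n}" using YY(4)[OF x(3)] x unfolding Lk by auto
  next
    fix y assume y: "y \<in> {k..<n}"
    then have "y \<notin> L" unfolding Lk by auto
    then have "Y y < y" using YY(2)[of y] y unfolding L_def by force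
    then have "Y y \<in> L" using YY(1) unfolding L_def by simp
    then show "y \<in> Y ` L" using YY(1) by (metis imageI)
  qed
  have "inj_on Y L" using YY(5) by (auto intro: inj_onI)
  then have bijY: "bij_betw Y L {k..<n}" using U by (simp add: bij_betw_def)
  then have n: "n = k + k" using bij_betw_same_card[OF bijY] kn by (simp add: Lk)
  have Yge: "k + p \<le> Y p" if "p < k" for p
    using that
  proof (induction p)
    case 0
    then have "Y 0 \<in> {k..<n}" using U Lk by auto
    then show ?case by simp
  next
    case (Suc p)
    then have p: "k + p \<le> Y p" "Suc p < n" "p < k" "Suc p \<in> L" using n Lk by auto
    then have "Y p < Y (Suc p)"
      using top[OF p(2)] YY(1) unfolding crossing_def L_def by auto
    then show ?case using p by simp
  qed
  have Yk: "Y p = k + p" if "p < k" for p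
    using shift_unique[of Y k p] bijY Yge that n Lk by auto
  have Y0: "inner_count Y p (k + p) = 0" for p
  proof -
    have "\<not> (Y x \<noteq> x \<and> p \<le> x \<and> x < k + p \<and> p \<le> Y x \<and> Y x < k + p)" for x
    proof
      assume a: "Y x \<noteq> x \<and> p \<le> x \<and> x < k + p \<and> p \<le> Y x \<and> Y x < k + p"
      show False
      proof (cases "x \<in> L")
        case True
        then show False using Yk a Lk by auto
      next
        case False
        then have "Y x \<in> L" using a YY(1) unfolding L_def by auto
        then show False using Yk[of "Y x"] YY(1)[of x] a Lk by auto
      qed
    qed
    then show ?thesis unfolding inner_count_def by simp
  qed
  have Zn: "\<not> (Z x \<noteq> x \<and> p \<le> x \<and> x < k + p \<and> p \<le> Z x \<and> Z x < k + p)" for x p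
  proof -
    have "inner_count Z p (k + p) = 0" using le[of p "k + p"] Y0 by simp
    then show ?thesis unfolding inner_count_def using finite_inner[of Z p "k + p"] by auto
  qed
  \<comment> \<open>The interval starting at 0 excludes partners below \<open>k\<close>, and the one
    starting at \<open>p\<close> excludes those below \<open>k + p\<close>.\<close>
  have Zge: "k + p \<le> Z p" if "p < k" for p
    using Zn[of p 0] Zn[of p p] that ZZ(2)[of p] n by force
  have "Z ` {..<k} \<subseteq> {k..<k+k}" using Zge ZZ(4) n by force
  moreover have inj: "inj_on Z {..<k}" using ZZ(5) by (auto intro: inj_onI)
  ultimately have "bij_betw Z {..<k} {k..<k+k}"
    by (simp add: bij_betw_def card_image card_subset_eq)
  then have Zk: "Z p = k + p" if "p < k" for p using shift_unique[of Z k p] Zge that by auto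
  show ?thesis
  proof
    fix x
    consider "x < k" | "k \<le> x" "x < n" | "n \<le> x" by linarith
    then show "Z x = Y x"
    proof cases
      case 2
      then obtain y where y: "x = k + y" "y < k" using n by (metis add_less_cancel_left le_Suc_ex)
      then show ?thesis using Zk Yk ZZ(1) YY(1) by metis
    qed (auto simp: Zk Yk YY(3) ZZ(3))
  qed
qed

section \<open>Chains of uncrossings obtained from counts\<close>

lemma down_uncrossings:
  assumes "uncrossing\<^sup>*\<^sup>* V W" "matching n V" "Suc p < n" "W p \<noteq> Suc p"
  shows "uncrossing\<^sup>*\<^sup>* (down p V) (down p W)"
  using assms(1,4)
proof (induction rule: rtranclp_induct)
  case (step W X)
  have W: "matching n W" "matching n X"
    using matching_uncrossings[OF step.hyps(1) assms(2)] matching_uncrossing step.hyps(2) by blast+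
  \<comment> \<open>Counts grow along uncrossings, so joined neighbours stay joined; being unjoined
    at the end of the chain implies it at every earlier stage.\<close>
  have "W p \<noteq> Suc p"
    using inner_count_uncrossing[OF W(1) step.hyps(2), of p "Suc (Suc p)"] step.prems
      inner_count_joined[OF W(1) assms(3)] inner_count_joined[OF W(2) assms(3)] by auto
  then show ?case using step.IH lifting[OF W(1) step.hyps(2) assms(3) step.prems] by auto
qed simp

theorem uncrossings_if_inner_count_le:
  assumes "matching n Y" "matching n Z" "\<And>i j. inner_count Z i j \<le> inner_count Y i j"
  shows "uncrossing\<^sup>*\<^sup>* Z Y"
  using assms
proof (induction "total_count n Y" arbitrary: Y Z rule: less_induct)
  case less
  note Y = less.prems(1) and Z = less.prems(2) and le = less.prems(3)
  show ?case
  proof (cases "\<exists>p. Suc p < n \<and> Y p \<noteq> Suc p \<and> \<not> crossing Y p (Suc p)")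
    case False
    then have "Z = Y" using top_unique[OF Y _ Z le] by blast
    then show ?thesis by simp
  next
    case True
    then obtain p where p: "Suc p < n" "Y p \<noteq> Suc p" "\<not> crossing Y p (Suc p)" by blast
    let ?Y = "conj_swap p Y"
    have mY: "matching n ?Y" and cY: "crossing ?Y p (Suc p)"
      using matching_conj_swap[OF Y p(1)] conj_swap_crossing[OF Y p(1,2)] p(3) by auto
    have lt: "total_count n ?Y < total_count n Y" using total_count_conj_swap[OF Y p(3,1,2)] .
    have Zp: "Z p \<noteq> Suc p"
      using le[of p "Suc (Suc p)"] p(2) inner_count_joined[OF Y p(1)] inner_count_joined[OF Z p(1)] by auto
    show ?thesis
    proof (cases "crossing Z p (Suc p)")
      case True
      have "uncrossing\<^sup>*\<^sup>* Z ?Y"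
        by (rule less.hyps[OF lt mY Z inner_count_le_conj_swap[OF Y Z True p(1) le]])
      then show ?thesis using uncrossing_conj_swap[OF mY cY] by simp
    next
      case False
      let ?Z = "conj_swap p Z"
      have mZ: "matching n ?Z" and cZ: "crossing ?Z p (Suc p)"
        using matching_conj_swap[OF Z p(1)] conj_swap_crossing[OF Z p(1) Zp] False by auto
      \<comment> \<open>Only cuts other than \<open>Suc p\<close> have to be compared, and there the
        exchange alters neither count.\<close>
      have "inner_count ?Z i j \<le> inner_count ?Y i j" for i j
        by (rule inner_count_le_conj_swap[OF Y mZ cZ p(1)]) (simp add: inner_count_conj_swap le)
      then have st: "uncrossing\<^sup>*\<^sup>* ?Z ?Y" by (rule less.hyps[OF lt mY mZ])
      have "?Y p \<noteq> Suc p" using cY unfolding crossing_def by auto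
      \<comment> \<open>Both exchanged involutions cross at \<open>p\<close>, so
        \<open>down p\<close> takes them back to \<open>Z\<close> and \<open>Y\<close>.\<close>
      then show ?thesis using down_uncrossings[OF st mZ p(1)] cY cZ by (simp add: down_def)
    qed
  qed
qed

section \<open>Points of equal level and arc diagrams\<close>

text \<open>The points of an involution are positions, and \<open>lev\<close> sends a position to
  the point of the diagram it is a copy of. The upper level comes first, as in an arc
  \<open>(m, r)\<close>.\<close>

definition levels :: "(nat \<Rightarrow> nat) \<Rightarrow> (nat \<Rightarrow> nat) \<Rightarrow> (nat \<times> nat) multiset" where
  "levels lev V = image_mset (\<lambda>x. (lev (V x), lev x)) (mset_set {x. x < V x})"

lemma finite_lower:
  assumes "matching n V"
  shows "finite {x. x < V x}"
proof (rule finite_subset[of _ "{..<n}"])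
  show "{x. x < V x} \<subseteq> {..<n}"
  proof
    fix x assume "x \<in> {x. x < V x}"
    then show "x \<in> {..<n}" using matchingD(3)[OF assms, of x] by (cases "x < n") auto
  qed
qed simp

text \<open>Copies of the same point may be permuted without changing the diagram. This freedom is
  used later to choose extremal spreadings.\<close>

lemma levels_conj_swap:
  assumes V: "matching n V" "Suc p < n" "V p \<noteq> Suc p" and lev: "lev p = lev (Suc p)"
  shows "levels lev (conj_swap p V) = levels lev V"
proof -
  let ?t = "transpose p (Suc p)" and ?W = "conj_swap p V"
  have t: "lev (?t x) = lev x" for x using lev by (auto simp: transpose_def)
  have inj: "?t x = ?t y \<longleftrightarrow> x = y" for x y by (metis transpose_simps(3))
  have ord: "?t x < ?t (V x) \<longleftrightarrow> x < V x" for x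
  proof -
    have "V (Suc p) \<noteq> p" using V(3) matchingD(1)[OF V(1)] by metis
    then show ?thesis using V(3) by (auto simp: transpose_def)
  qed
  have "{x. x < ?W x} = ?t ` {x. x < V x}"
  proof (intro set_eqI iffI)
    fix x assume "x \<in> {x. x < ?W x}"
    then have "?t x \<in> {x. x < V x}" using ord[of "?t x"] by (simp add: conj_swap_def)
    then show "x \<in> ?t ` {x. x < V x}" by (intro image_eqI[of _ _ "?t x"]) simp_all
  next
    fix x assume "x \<in> ?t ` {x. x < V x}"
    then show "x \<in> {x. x < ?W x}" using ord by (auto simp: conj_swap_def)
  qed
  moreover have "inj_on ?t {x. x < V x}" by (rule inj_onI) (simp only: inj)
  ultimately have "mset_set {x. x < ?W x} = image_mset ?t (mset_set {x. x < V x})"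
    by (simp add: image_mset_mset_set)
  then show ?thesis unfolding levels_def
    by (simp add: multiset.map_comp comp_def conj_swap_def t)
qed

lemma levels_neq:
  assumes "matching n V" "\<forall>(m, r) \<in># levels lev V. r < m" "x < n"
  shows "lev (V x) \<noteq> lev x"
proof -
  have *: "lev y < lev (V y)" if "y < V y" for y
    using assms(2) that finite_lower[OF assms(1)] unfolding levels_def by auto
  have "V x \<noteq> x" using matchingD(2)[OF assms(1,3)] .
  then show ?thesis using *[of x] *[of "V x"] matchingD(1)[OF assms(1), of x] by (cases "x < V x") auto
qed

lemma inner_count_levels:
  assumes V: "matching n V"
    and i: "\<And>x. x < n \<Longrightarrow> i \<le> x \<longleftrightarrow> a \<le> lev x" and j: "\<And>x. x < n \<Longrightarrow> j \<le> x \<longleftrightarrow> b \<le> lev x"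
  shows "inner_count V i j = 2 * size (filter_mset (\<lambda>(m, r). a \<le> r \<and> m < b) (levels lev V))"
proof -
  define S where "S = {x. x < V x \<and> a \<le> lev x \<and> lev (V x) < b}"
  have fin: "finite S" unfolding S_def by (rule finite_subset[OF _ finite_lower[OF V]]) auto
  have n: "x < n" if "V x \<noteq> x" for x using that V unfolding matching_def by blast
  have Seq: "x \<in> S \<longleftrightarrow> x < V x \<and> i \<le> x \<and> V x < j" for x
  proof (cases "x < V x")
    case True
    then have "x < n" "V x < n" using n[of x] n[of "V x"] matchingD(1)[OF V, of x] by auto
    then have "i \<le> x \<longleftrightarrow> a \<le> lev x" "j \<le> V x \<longleftrightarrow> b \<le> lev (V x)" using i j by blast+
    then show ?thesis using True unfolding S_def by auto
  qed (simp add: S_def)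
  have "{x. V x \<noteq> x \<and> i \<le> x \<and> x < j \<and> i \<le> V x \<and> V x < j} = S \<union> V ` S"
  proof (intro set_eqI iffI)
    fix x assume x: "x \<in> {x. V x \<noteq> x \<and> i \<le> x \<and> x < j \<and> i \<le> V x \<and> V x < j}"
    show "x \<in> S \<union> V ` S"
    proof (cases "x < V x")
      case True
      then show ?thesis using x Seq by simp
    next
      case False
      then have "V x \<in> S" using x Seq matchingD(1)[OF V] by auto
      then show ?thesis using matchingD(1)[OF V] by (intro UnI2 image_eqI[of _ _ "V x"]) auto
    qed
  next
    fix x assume "x \<in> S \<union> V ` S"
    then obtain y where y: "y \<in> S" "x = y \<or> x = V y" by blast
    then show "x \<in> {x. V x \<noteq> x \<and> i \<le> x \<and> x < j \<and> i \<le> V x \<and> V x < j}"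
      using Seq[of y] matchingD(1)[OF V, of y] by auto
  qed
  moreover have "S \<inter> V ` S = {}" using matchingD(1)[OF V] unfolding S_def by fastforce
  moreover have "card (V ` S) = card S" using matchingD(5)[OF V] by (intro card_image inj_onI) auto
  ultimately have "inner_count V i j = 2 * card S"
    unfolding inner_count_def using fin by (simp add: card_Un_disjoint)
  moreover have "size (filter_mset (\<lambda>(m, r). a \<le> r \<and> m < b) (levels lev V)) = card S"
    unfolding levels_def using finite_lower[OF V]
    by (simp add: filter_mset_image_mset filter_mset_mset_set S_def conj_commute conj_left_commute)
  ultimately show ?thesis by simp
qed

text \<open>A discrete minimum principle. At the first place where a negative minimum is attained,
  the left neighbour is strictly larger and the right one not smaller, which contradicts concavity
  unless the place belongs to \<open>B\<close>, where \<open>g\<close> is non-negative.\<close>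

lemma concave_nonneg:
  fixes g :: "nat \<Rightarrow> int"
  assumes "B 0" "B n" and pos: "\<And>c. c \<le> n \<Longrightarrow> B c \<Longrightarrow> 0 \<le> g c"
    and conc: "\<And>p. Suc p < n \<Longrightarrow> \<not> B (Suc p) \<Longrightarrow> g p + g (Suc (Suc p)) \<le> 2 * g (Suc p)"
    and c: "c \<le> n"
  shows "0 \<le> g c"
proof (rule ccontr)
  assume neg: "\<not> 0 \<le> g c"
  define m where "m = Min (g ` {..n})"
  have m: "m \<le> g x" if "x \<le> n" for x unfolding m_def using that by (intro Min_le) auto
  have "m \<in> g ` {..n}" unfolding m_def by (intro Min_in) auto
  then have ex: "\<exists>x. x \<le> n \<and> g x = m" by auto
  define d where "d = (LEAST x. x \<le> n \<and> g x = m)"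
  have d: "d \<le> n" "g d = m" using LeastI_ex[OF ex] unfolding d_def by auto
  have least: "g x \<noteq> m" if "x < d" for x
    using not_less_Least[of x "\<lambda>x. x \<le> n \<and> g x = m"] that d(1) unfolding d_def by auto
  have "g d < 0" using d m[OF c] neg by simp
  then have nB: "\<not> B d" using pos[OF d(1)] by linarith
  then have "d \<noteq> 0" "d \<noteq> n" using assms(1,2) by metis+
  then obtain p where p: "d = Suc p" "Suc p < n" using d(1) by (cases d) auto
  then have "g p > m" using least[of p] m[of p] by simp
  moreover have "g (Suc (Suc p)) \<ge> m" using m p by simp
  ultimately show False using conc[OF p(2)] nB d p by simp
qed

lemma inner_count_min:
  assumes "matching n V"
  shows "inner_count V i j = inner_count V (min i n) (min j n)"
proof -
  have *: "x < n \<and> V x < n" if "V x \<noteq> x" for x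
    using that assms matchingD(1)[OF assms, of x] unfolding matching_def by metis
  have "V x \<noteq> x \<and> i \<le> x \<and> x < j \<and> i \<le> V x \<and> V x < j \<longleftrightarrow>
      V x \<noteq> x \<and> min i n \<le> x \<and> x < min j n \<and> min i n \<le> V x \<and> V x < min j n" for x
    using *[of x] by (cases "V x = x") auto
  then show ?thesis unfolding inner_count_def by simp
qed

text \<open>At cuts between different levels the inequality is the hypothesis on diagrams. At cuts
  inside one level, \<open>Y\<close> does not cross and \<open>Z\<close> does, so the difference of
  their counts is concave there, and the minimum principle fills in the missing values.\<close>

lemma inner_count_le_levels:
  assumes Y: "matching n Y" and Z: "matching n Z" and lev: "\<And>x y. x \<le> y \<Longrightarrow> y < n \<Longrightarrow> lev x \<le> lev y"
    and Yt: "\<And>p. Suc p < n \<Longrightarrow> lev p = lev (Suc p) \<Longrightarrow> Y p \<noteq> Suc p \<and> \<not> crossing Y p (Suc p)"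
    and Zt: "\<And>p. Suc p < n \<Longrightarrow> lev p = lev (Suc p) \<Longrightarrow> crossing Z p (Suc p)"
    and le: "\<And>a b. size (filter_mset (\<lambda>(m, r). a \<le> r \<and> m < b) (levels lev Z))
        \<le> size (filter_mset (\<lambda>(m, r). a \<le> r \<and> m < b) (levels lev Y))"
  shows "inner_count Z i j \<le> inner_count Y i j"
proof -
  \<comment> \<open>The cuts visible on levels: the two extreme ones and those where the level
    jumps.\<close>
  define B where "B c \<longleftrightarrow> c = 0 \<or> c = n \<or> lev (c - 1) < lev c" for c
  have cut: "\<exists>a. \<forall>x<n. c \<le> x \<longleftrightarrow> a \<le> lev x" if Bc: "B c" "c \<le> n" for c
  proof -
    consider "c = 0" | "c = n" | "0 < c" "c < n" "lev (c - 1) < lev c"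
      using Bc unfolding B_def by (cases "c = 0"; cases "c = n") auto
    then show ?thesis
    proof cases
      case 1
      then show ?thesis by (intro exI[of _ 0]) auto
    next
      case 2
      have "lev x \<le> lev (n - 1)" if "x < n" for x using lev[of x "n - 1"] that by simp
      then have "\<forall>x<n. c \<le> x \<longleftrightarrow> Suc (lev (n - 1)) \<le> lev x" using 2 by fastforce
      then show ?thesis by blast
    next
      case 3
      have "c \<le> x \<longleftrightarrow> lev c \<le> lev x" if "x < n" for x
      proof (cases "c \<le> x")
        case True
        then show ?thesis using lev that by simp
      next
        case False
        then have "lev x \<le> lev (c - 1)" using 3 by (intro lev) auto
        then show ?thesis using False 3 by simp
      qed
      then show ?thesis by blast
    qed
  qed
  define g where "g i j = int (inner_count Y i j) - int (inner_count Z i j)" for i j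
  have tie: "lev p = lev (Suc p)" if "Suc p < n" "\<not> B (Suc p)" for p
    using that lev[of p "Suc p"] unfolding B_def by simp
  have B: "B 0" "B n" by (simp_all add: B_def)
  have g1: "0 \<le> g i j" if Bi: "B i" "i \<le> n" "j \<le> n" for i j
  proof (rule concave_nonneg[of B n "g i"])
    fix c assume c: "c \<le> n" "B c"
    obtain a b where "\<And>x. x < n \<Longrightarrow> i \<le> x \<longleftrightarrow> a \<le> lev x" "\<And>x. x < n \<Longrightarrow> c \<le> x \<longleftrightarrow> b \<le> lev x"
      using cut[OF Bi(1,2)] cut[OF c(2,1)] by blast
    then show "0 \<le> g i c" unfolding g_def
      using inner_count_levels[OF Y, of i a lev c b] inner_count_levels[OF Z, of i a lev c b] le[of a b] by simp
  next
    fix p assume p: "Suc p < n" "\<not> B (Suc p)"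
    note t = tie[OF p]
    show "g i p + g i (Suc (Suc p)) \<le> 2 * g i (Suc p)"
      using inner_count_noncrossing_right[OF Y _ p(1), of i] Yt[OF p(1) t]
        inner_count_crossing_right[OF Z Zt[OF p(1) t], of i]
        inner_count_Suc_right[OF Z, of i p] inner_count_Suc_right[OF Z, of i "Suc p"]
      unfolding g_def by (auto split: if_splits)
  qed (use B that in auto)
  \<comment> \<open>The right end was released in \<open>g1\<close> while the left end stayed at a
    visible cut; now the left end is released with the right end arbitrary.\<close>
  have g2: "0 \<le> g i j" if "i \<le> n" "j \<le> n" for i j
  proof (rule concave_nonneg[of B n "\<lambda>i. g i j"])
    fix p assume p: "Suc p < n" "\<not> B (Suc p)"
    note t = tie[OF p]
    show "g p j + g (Suc (Suc p)) j \<le> 2 * g (Suc p) j"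
      using inner_count_noncrossing_left[OF Y _ p(1), of j] Yt[OF p(1) t]
        inner_count_crossing_left[OF Z Zt[OF p(1) t], of j]
        inner_count_Suc_left[OF Z, of p j] inner_count_Suc_left[OF Z, of "Suc p" j]
      unfolding g_def by (auto split: if_splits)
  qed (use B that g1 in auto)
  show ?thesis using g2[of "min i n" "min j n"] inner_count_min[OF Y, of i j] inner_count_min[OF Z, of i j]
    unfolding g_def by simp
qed

section \<open>Uncrossings as moves of arc diagrams\<close>

lemma uncrossing_cases:
  assumes V: "matching n V" and W: "uncrossing V W"
  obtains a b c d where "a < b" "b < c" "c < d" "V a = c" "V b = d" "V c = a" "V d = b"
    "W = V(a := b, b := a, c := d, d := c) \<or> W = V(a := d, d := a, b := c, c := b)"
    "d < n"
proof -
  obtain a b where ab: "crossing V a b" "W = uncross V a b" using W unfolding uncrossing_def by blast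
  obtain c d where cd: "c = V a" "d = V b" by auto
  have Vs: "V a = c" "V b = d" "V c = a" "V d = b" using cd matchingD(1)[OF V] by auto
  have ne: "a \<noteq> b" "a \<noteq> c" "b \<noteq> c" "b \<noteq> d" "a \<noteq> d" "c \<noteq> d"
    using ab(1) cd Vs unfolding crossing_def by metis+
  have cr: "((a < b) = (c < b)) \<noteq> ((a < d) = (c < d))" using ab(1) Vs unfolding crossing_def by auto
  have lt: "a < n" "b < n" "c < n" "d < n" using crossing_lt[OF V ab(1)] Vs by auto
  have W: "W = V(a := b, b := a, c := d, d := c)" using Vs ab by (simp add: uncross_def)
  have W2: "W = V(b := a, a := b, d := c, c := d)" "W = V(c := d, d := c, a := b, b := a)"
    "W = V(d := c, c := d, b := a, a := b)" "W = V(a := b, b := a, d := c, c := d)"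
    "W = V(b := a, a := b, c := d, d := c)" "W = V(c := d, d := c, b := a, a := b)"
    "W = V(d := c, c := d, a := b, b := a)"
    unfolding W using ne by (auto simp: fun_eq_iff)
  consider "a < b \<and> b < c \<and> c < d" | "a < d \<and> d < c \<and> c < b" | "c < b \<and> b < a \<and> a < d"
    | "c < d \<and> d < a \<and> a < b" | "b < a \<and> a < d \<and> d < c" | "b < c \<and> c < d \<and> d < a"
    | "d < a \<and> a < b \<and> b < c" | "d < c \<and> c < b \<and> b < a"
    using cr ne by (metis linorder_neqE_nat)
  then show thesis
  proof cases
    case 1 then show ?thesis using that[of a b c d] Vs W lt by blast
  next
    case 2 then show ?thesis using that[of a d c b] Vs W2 lt by blast
  next
    case 3 then show ?thesis using that[of c b a d] Vs W2 lt by blast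
  next
    case 4 then show ?thesis using that[of c d a b] Vs W2 lt by blast
  next
    case 5 then show ?thesis using that[of b a d c] Vs W2 lt by blast
  next
    case 6 then show ?thesis using that[of b c d a] Vs W2 lt by blast
  next
    case 7 then show ?thesis using that[of d a b c] Vs W2 lt by blast
  next
    case 8 then show ?thesis using that[of d c b a] Vs W2 lt by blast
  qed
qed

lemma levels_split:
  assumes V: "matching n V" and "V a = c" "V b = d" "V c = a" "V d = b" and lt: "a < c" "b < d"
    and ne: "a \<noteq> b" "a \<noteq> d" "b \<noteq> c" "c \<noteq> d" and Q: "Q = {a, b, c, d}"
  shows "levels lev V = {#(lev c, lev a), (lev d, lev b)#} +
    image_mset (\<lambda>x. (lev (V x), lev x)) (mset_set {x. x < V x \<and> x \<notin> Q})"
proof -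
  have "{x. x < V x} = insert a (insert b {x. x < V x \<and> x \<notin> Q})"
    using assms by auto
  moreover have "finite {x. x < V x \<and> x \<notin> Q}"
    by (rule finite_subset[OF _ finite_lower[OF V]]) auto
  ultimately show ?thesis unfolding levels_def using assms by simp
qed

text \<open>An arc whose upper end is at the top level \<open>M\<close> stands for a pole.\<close>
definition to_diagram :: "nat \<Rightarrow> (nat \<times> nat) multiset \<Rightarrow> diagram" where
  "to_diagram M X = (filter_mset (\<lambda>x. fst x \<noteq> M) X, image_mset snd (filter_mset (\<lambda>x. fst x = M) X))"

text \<open>Of the four levels only the largest, \<open>m\<close>, can be the top level
  \<open>M\<close>. The nested resolution is move A, or B if \<open>m = M\<close>; the side-by-side
  resolution is move C, or D if \<open>m = M\<close>.\<close>

lemma to_diagram_move: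
  assumes "m > n" "n > r" "r > s" "m \<le> M"
  shows "arc_move (to_diagram M ({#(m, r), (n, s)#} + R)) (to_diagram M ({#(m, s), (n, r)#} + R))"
    and "arc_move (to_diagram M ({#(m, r), (n, s)#} + R)) (to_diagram M ({#(m, n), (r, s)#} + R))"
proof -
  obtain A P where AP: "to_diagram M R = (A, P)" by fastforce
  have "n \<noteq> M" "r \<noteq> M" "s \<noteq> M" using assms by auto
  note t = this AP[unfolded to_diagram_def]
  show "arc_move (to_diagram M ({#(m, r), (n, s)#} + R)) (to_diagram M ({#(m, s), (n, r)#} + R))"
  proof (cases "m = M")
    case True
    then show ?thesis using moveB[OF assms(2,3), of A P] t by (simp add: to_diagram_def)
  next
    case False
    then show ?thesis using moveA[OF assms(1-3), of A P] t by (simp add: to_diagram_def add_mset_commute)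
  qed
  show "arc_move (to_diagram M ({#(m, r), (n, s)#} + R)) (to_diagram M ({#(m, n), (r, s)#} + R))"
  proof (cases "m = M")
    case True
    then show ?thesis using moveD[OF assms(2,3), of A P] t by (simp add: to_diagram_def)
  next
    case False
    then show ?thesis using moveC[OF assms(1-3), of A P] t by (simp add: to_diagram_def add_mset_commute)
  qed
qed

text \<open>Levels of the four ends may coincide. If no arc of \<open>W\<close> stays within one
  level, a coincidence makes the two multisets of levels equal, which is why the conclusion is
  reflexive; otherwise all four levels differ and a genuine move takes place. An arc of
  \<open>V\<close> within one level would force such an arc in \<open>W\<close>, because levels are
  monotone.\<close>

lemma uncrossing_to_diagram:
  assumes V: "matching n V" and W: "uncrossing V W"
    and lev: "\<And>x y. x \<le> y \<Longrightarrow> y < n \<Longrightarrow> lev x \<le> lev y" and M: "\<And>x. x < n \<Longrightarrow> lev x \<le> M"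
    and free: "\<And>x. x < n \<Longrightarrow> lev (W x) \<noteq> lev x"
  shows "arc_move\<^sup>=\<^sup>= (to_diagram M (levels lev V)) (to_diagram M (levels lev W))"
    and "\<And>x. x < n \<Longrightarrow> lev (V x) \<noteq> lev x"
proof -
  obtain a b c d where o: "a < b" "b < c" "c < d" and Vs: "V a = c" "V b = d" "V c = a" "V d = b"
    and W': "W = V(a := b, b := a, c := d, d := c) \<or> W = V(a := d, d := a, b := c, c := b)"
    and dn: "d < n"
    using uncrossing_cases[OF V W] by metis
  note mW = matching_uncrossing[OF V W]
  define Q where "Q = {a, b, c, d}"
  define R where "R = image_mset (\<lambda>x. (lev (V x), lev x)) (mset_set {x. x < V x \<and> x \<notin> Q})"
  have eq: "{x. x < W x \<and> x \<notin> Q} = {x. x < V x \<and> x \<notin> Q}" using W' unfolding Q_def by auto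
  have fin: "finite {x. x < V x \<and> x \<notin> Q}"
    by (rule finite_subset[OF _ finite_lower[OF V]]) auto
  have "W x = V x" if "x \<notin> Q" for x using W' that unfolding Q_def by auto
  then have R': "image_mset (\<lambda>x. (lev (W x), lev x)) (mset_set {x. x < W x \<and> x \<notin> Q}) = R"
    unfolding eq R_def using fin by (intro image_mset_cong) auto
  have lV: "levels lev V = {#(lev c, lev a), (lev d, lev b)#} + R"
    unfolding R_def by (rule levels_split[OF V]) (use o Vs Q_def in auto)
  have ll: "lev a \<le> lev b" "lev b \<le> lev c" "lev c \<le> lev d" "lev d \<le> M"
    using lev o dn M by auto
  show "arc_move\<^sup>=\<^sup>= (to_diagram M (levels lev V)) (to_diagram M (levels lev W))"
    using W'
  proof
    assume W1: "W = V(a := b, b := a, c := d, d := c)"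
    have "levels lev W = {#(lev b, lev a), (lev d, lev c)#} + R"
      unfolding R'[symmetric] by (rule levels_split[OF mW]) (use o W1 Q_def in auto)
    moreover have "lev a \<noteq> lev b" "lev d \<noteq> lev c" using free[of a] free[of c] o dn W1 by auto
    ultimately show ?thesis using to_diagram_move(2)[of "lev c" "lev d" "lev b" "lev a" M R] ll lV
      by (cases "lev b = lev c") (auto simp: add_mset_commute)
  next
    assume W1: "W = V(a := d, d := a, b := c, c := b)"
    have "levels lev W = {#(lev d, lev a), (lev c, lev b)#} + R"
      unfolding R'[symmetric] by (rule levels_split[OF mW]) (use o W1 Q_def in auto)
    moreover have "lev b \<noteq> lev c" using free[of b] o dn W1 by auto
    ultimately show ?thesis using to_diagram_move(1)[of "lev c" "lev d" "lev b" "lev a" M R] ll lV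
      by (cases "lev a = lev b"; cases "lev c = lev d") (auto simp: add_mset_commute)
  qed
  have "lev a \<noteq> lev c" "lev b \<noteq> lev d"
    using W' free[of a] free[of b] free[of c] ll o dn by auto
  then show "lev (V x) \<noteq> lev x" if "x < n" for x
    using free[OF that] W' Vs by (auto split: if_splits)
qed

text \<open>The induction goes backwards: the absence of arcs within one level is known at the end
  \<open>W\<close> and passes from the result of an uncrossing to its source.\<close>

lemma uncrossings_to_diagram:
  assumes "uncrossing\<^sup>*\<^sup>* V W" and V: "matching n V"
    and lev: "\<And>x y. x \<le> y \<Longrightarrow> y < n \<Longrightarrow> lev x \<le> lev y" and M: "\<And>x. x < n \<Longrightarrow> lev x \<le> M"
    and free: "\<And>x. x < n \<Longrightarrow> lev (W x) \<noteq> lev x"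
  shows "arc_move\<^sup>*\<^sup>* (to_diagram M (levels lev V)) (to_diagram M (levels lev W))
    \<and> (\<forall>x<n. lev (V x) \<noteq> lev x)"
  using assms(1,2)
proof (induction rule: converse_rtranclp_induct)
  case base
  then show ?case using free by simp
next
  case (step V U)
  have U: "matching n U" using matching_uncrossing step.prems step.hyps(1) by blast
  note IH = step.IH[OF U]
  have free': "\<And>x. x < n \<Longrightarrow> lev (U x) \<noteq> lev x" using IH by blast
  have "lev (V x) \<noteq> lev x" if "x < n" for x
    by (rule uncrossing_to_diagram(2)[OF step.prems step.hyps(1), where M = M]) (fact lev M free' that)+
  moreover have "arc_move\<^sup>=\<^sup>= (to_diagram M (levels lev V)) (to_diagram M (levels lev U))"
    by (rule uncrossing_to_diagram(1)[OF step.prems step.hyps(1)]) (fact lev M free')+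
  then have "arc_move\<^sup>*\<^sup>* (to_diagram M (levels lev V)) (to_diagram M (levels lev W))"
    by (rule sup2E) (use IH in \<open>auto intro: converse_rtranclp_into_rtranclp\<close>)
  ultimately show ?case by blast
qed

text \<open>Listing all upper ends and then all lower ends of the arcs makes the partner map the
  shift by \<open>k\<close>. A permutation \<open>p\<close> taking this list to the sorted list
  \<open>l\<close> conjugates the shift into the required involution.\<close>

lemma exists_matching:
  assumes X: "\<forall>(m, r) \<in># X. r < m" and l: "mset l = image_mset fst X + image_mset snd X" "sorted l"
  shows "\<exists>V. matching (length l) V \<and> levels ((!) l) V = X"
proof -
  obtain xs where xs: "mset xs = X" using ex_mset by blast
  define k where "k = length xs"
  define es where "es = map fst xs @ map snd xs"
  have "mset es = mset l" unfolding l es_def using xs by auto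
  then obtain p where p: "p permutes {..<length l}" "permute_list p l = es"
    using mset_eq_permutation by metis
  have n: "length l = k + k" using \<open>mset es = mset l\<close> mset_eq_length[of es l] by (simp add: es_def k_def)
  have lp: "l ! p i = es ! i" if "i < k + k" for i
    using p that n permute_list_nth[OF p(1)] by metis
  define s where "s i = (if i < k then i + k else if i < k + k then i - k else i)" for i
  define V where "V x = p (s (inv p x))" for x
  have ss: "s (s i) = i" "s i \<noteq> i \<longleftrightarrow> i < k + k" for i unfolding s_def by auto
  have ip: "inv p (p x) = x" "p (inv p x) = x" for x
    using permutes_inverses[OF p(1)] by auto
  have pn: "p x < k + k \<longleftrightarrow> x < k + k" for x using permutes_in_image[OF p(1), of x] n by simp
  have m: "matching (length l) V" unfolding matching_def n
  proof (intro conjI allI)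
    fix x
    show "V (V x) = x" by (simp add: V_def ip ss)
    have "V x \<noteq> x \<longleftrightarrow> s (inv p x) \<noteq> inv p x" unfolding V_def using ip by metis
    also have "\<dots> \<longleftrightarrow> x < k + k" using ss(2) pn[of "inv p x"] ip by simp
    finally show "V x \<noteq> x \<longleftrightarrow> x < k + k" .
  qed
  have Vp: "V (p (i + k)) = p i" "V (p i) = p (i + k)" if "i < k" for i
    using that by (auto simp: V_def ip s_def)
  have lev: "l ! p i = fst (xs ! i)" "l ! p (i + k) = snd (xs ! i)" if "i < k" for i
    using lp[of i] lp[of "i + k"] that by (auto simp: es_def nth_append k_def)
  have lt: "p (i + k) < p i" if "i < k" for i
  proof (rule ccontr)
    assume "\<not> p (i + k) < p i"
    then have "l ! p i \<le> l ! p (i + k)"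
      using l(2) pn[of "i + k"] that n by (intro sorted_nth_mono) auto
    moreover have "xs ! i \<in># X" using xs that unfolding k_def by (metis nth_mem_mset)
    then have "snd (xs ! i) < fst (xs ! i)" using X by auto
    ultimately show False using lev[OF that] by simp
  qed
  have "{x. x < V x} = (\<lambda>i. p (i + k)) ` {..<k}"
  proof (intro set_eqI iffI)
    fix x assume x: "x \<in> {x. x < V x}"
    then have "x < k + k" using m n unfolding matching_def by auto
    then have i: "inv p x < k + k" using pn ip by metis
    show "x \<in> (\<lambda>i. p (i + k)) ` {..<k}"
    proof (cases "inv p x < k")
      case True
      then have "V x < x" using lt[OF True] Vp(2)[OF True] ip by simp
      then show ?thesis using x by simp
    next
      case False
      then have "x = p (inv p x - k + k)" using ip by simp
      then show ?thesis using i False by (intro image_eqI[of _ _ "inv p x - k"]) auto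
    qed
  next
    fix x assume "x \<in> (\<lambda>i. p (i + k)) ` {..<k}"
    then show "x \<in> {x. x < V x}" using lt Vp by auto
  qed
  moreover have "inj_on (\<lambda>i. p (i + k)) {..<k}" using ip by (metis (mono_tags, lifting) add_right_cancel inj_onI)
  ultimately have "mset_set {x. x < V x} = image_mset (\<lambda>i. p (i + k)) (mset_set {..<k})"
    by (simp add: image_mset_mset_set)
  then have "levels ((!) l) V = image_mset (\<lambda>i. (l ! V (p (i + k)), l ! p (i + k))) (mset_set {..<k})"
    by (simp add: levels_def multiset.map_comp comp_def)
  also have "\<dots> = image_mset (\<lambda>i. xs ! i) (mset_set {..<k})"
    by (rule image_mset_cong) (auto simp: Vp lev)
  also have "\<dots> = mset (map (\<lambda>i. xs ! i) [0..<k])" by (simp add: atLeast0LessThan)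
  also have "\<dots> = X" using xs by (simp add: k_def map_nth)
  finally show ?thesis using m by blast
qed

lemma total_count_bound: "total_count n V \<le> Suc n * (Suc n * n)"
proof -
  have "inner_count V i j \<le> n" if "j \<le> n" for i j
  proof -
    have "inner_count V i j \<le> card {..<n}" unfolding inner_count_def
      using that by (intro card_mono) auto
    then show ?thesis by simp
  qed
  then have "(\<Sum>j\<le>n. inner_count V i j) \<le> Suc n * n" for i
    using sum_bounded_above[of "{..n}" "inner_count V i" n] by simp
  then show ?thesis unfolding total_count_def
    using sum_bounded_above[of "{..n}" "\<lambda>i. \<Sum>j\<le>n. inner_count V i j" "Suc n * n"] by simp
qed

text \<open>Among all spreadings of \<open>Y\<close> one with the greatest total count is chosen,
  among those of \<open>Z\<close> one with the least. Exchanging two neighbouring copies of a point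
  keeps the diagram and changes the total count strictly, so at such neighbours the first never
  crosses and the second always does.\<close>

lemma to_diagram_moves:
  assumes Y: "\<forall>(m, r) \<in># Y. r < m \<and> m \<le> M" and Z: "\<forall>(m, r) \<in># Z. r < m"
    and eq: "image_mset fst Y + image_mset snd Y = image_mset fst Z + image_mset snd Z"
    and le: "\<And>a b. size (filter_mset (\<lambda>(m, r). a \<le> r \<and> m < b) Z)
        \<le> size (filter_mset (\<lambda>(m, r). a \<le> r \<and> m < b) Y)"
  shows "arc_move\<^sup>*\<^sup>* (to_diagram M Z) (to_diagram M Y)"
proof -
  define l where "l = sorted_list_of_multiset (image_mset fst Y + image_mset snd Y)"
  define n where "n = length l"
  have l: "mset l = image_mset fst Y + image_mset snd Y" "sorted l" by (auto simp: l_def)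
  have Y': "\<forall>(m, r) \<in># Y. r < m" using Y by auto
  have ties: "V p \<noteq> Suc p" if V: "matching n V" "levels ((!) l) V = X" "\<forall>(m, r) \<in># X. r < m"
    and p: "Suc p < n" "l ! p = l ! Suc p" for V X p
    using levels_neq[of n V "(!) l" p] V p by auto
  let ?P = "\<lambda>X V. matching n V \<and> levels ((!) l) V = X"
  have exY: "\<exists>V. ?P Y V" using exists_matching[OF Y' l] by (simp add: n_def)
  have exZ: "\<exists>V. ?P Z V" using exists_matching[OF Z _ l(2)] l(1) eq by (simp add: n_def)
  obtain VY where VY: "?P Y VY" and maxY: "\<And>V. ?P Y V \<Longrightarrow> total_count n V \<le> total_count n VY"
    using exY ex_has_greatest_nat[of "?P Y" _ "total_count n" "Suc (Suc n * (Suc n * n))"]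
      total_count_bound by (metis le_imp_less_Suc)
  obtain VZ where VZ: "?P Z VZ" and minZ: "\<And>V. ?P Z V \<Longrightarrow> total_count n VZ \<le> total_count n V"
    using exZ ex_has_least_nat[of "?P Z" _ "total_count n"] by metis
  have lev: "l ! x \<le> l ! y" if "x \<le> y" "y < n" for x y
    using that l(2) by (auto simp: n_def intro: sorted_nth_mono)
  have sw: "?P X (conj_swap p V)" if "?P X V" "Suc p < n" "l ! p = l ! Suc p" "V p \<noteq> Suc p" for X V p
    using that matching_conj_swap[of n V p] levels_conj_swap[of n V p "(!) l"] by auto
  have Yt: "VY p \<noteq> Suc p \<and> \<not> crossing VY p (Suc p)" if p: "Suc p < n" "l ! p = l ! Suc p" for p
  proof -
    have nj: "VY p \<noteq> Suc p" using ties[of VY Y p] VY Y' p by blast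
    moreover have False if c: "crossing VY p (Suc p)"
    proof -
      let ?W = "conj_swap p VY"
      have W: "matching n ?W" "\<not> crossing ?W p (Suc p)" "?P Y ?W"
        using sw[OF VY p nj] conj_swap_crossing[of n VY p] VY p nj c by auto
      then have "?W p \<noteq> Suc p" using ties[of ?W Y p] Y' p by blast
      then have "total_count n VY < total_count n ?W"
        using total_count_conj_swap[OF W(1,2) p(1)] by simp
      then show False using maxY[OF W(3)] by simp
    qed
    ultimately show ?thesis by blast
  qed
  have Zt: "crossing VZ p (Suc p)" if p: "Suc p < n" "l ! p = l ! Suc p" for p
  proof (rule ccontr)
    assume c: "\<not> crossing VZ p (Suc p)"
    have nj: "VZ p \<noteq> Suc p" using ties[of VZ Z p] VZ Z p by blast
    show False
      using total_count_conj_swap[OF _ c p(1) nj] VZ minZ[OF sw[OF VZ p nj]] by auto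
  qed
  have "inner_count VZ i j \<le> inner_count VY i j" for i j
    by (rule inner_count_le_levels[of n VY VZ "(!) l"]) (use VY VZ lev Yt Zt le in auto)
  then have "uncrossing\<^sup>*\<^sup>* VZ VY"
    using uncrossings_if_inner_count_le[of n VY VZ] VY VZ by blast
  moreover have "l ! x \<le> M" if "x < n" for x
  proof -
    have "l ! x \<in># image_mset fst Y + image_mset snd Y" using that l(1) unfolding n_def by (metis nth_mem_mset)
    then show ?thesis using Y by fastforce
  qed
  ultimately have "arc_move\<^sup>*\<^sup>* (to_diagram M (levels ((!) l) VZ)) (to_diagram M (levels ((!) l) VY))"
    using uncrossings_to_diagram[of VZ VY n "(!) l" M] VY VZ lev levels_neq[of n VY "(!) l"] Y' by blast
  then show ?thesis using VY VZ by simp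
qed

text \<open>The value of the invariant \<open>dim (A \<inter> filt u v B)\<close> below on an object with the given diagram.\<close>
fun mark :: "nat \<Rightarrow> nat \<Rightarrow> diagram \<Rightarrow> nat" where
  "mark u v (A, P) = size (filter_mset (\<lambda>p. v < p) P) + size (filter_mset (\<lambda>(n, q). v < n) A)
     + size (filter_mset (\<lambda>(n, q). u + 2 \<le> n \<and> v < q) A)"

section \<open>From marks to interval counts\<close>

lemma size_filter_partition: "size (filter_mset Q X) + size (filter_mset (\<lambda>x. \<not> Q x) X) = size X"
  by (metis multiset_partition size_union)

lemma size_filter_split:
  "size (filter_mset Q X) = size (filter_mset (\<lambda>x. Q x \<and> R x) X) + size (filter_mset (\<lambda>x. Q x \<and> \<not> R x) X)"
  using size_filter_partition[of R "filter_mset Q X"] by (simp add: filter_filter_mset conj_commute)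

text \<open>For \<open>u < q < n\<close> the condition \<open>u + 2 \<le> n\<close> is automatic, so
  an arc contributes once for each of its ends above \<open>u\<close>.\<close>

lemma mark_diag:
  assumes "\<forall>(n, q) \<in># A. 1 \<le> q \<and> q < n"
  shows "mark u u (A, P) = size (filter_mset (\<lambda>p. u < p) (image_mset fst A + image_mset snd A + P))"
proof -
  have "filter_mset (\<lambda>(n, q). u + 2 \<le> n \<and> u < q) A = filter_mset (\<lambda>(n, q). u < q) A"
    by (rule filter_mset_cong) (use assms in auto)
  then show ?thesis by (simp add: filter_mset_image_mset case_prod_unfold)
qed

text \<open>Raising the first index from \<open>v\<close> to \<open>u\<close> loses exactly the arcs
  with lower end above \<open>v\<close> and upper end below \<open>u + 2\<close>. A smaller mark
  thus means more inner arcs, which reverses the inequality.\<close>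

lemma mark_inner:
  assumes "\<forall>(n, q) \<in># A. 1 \<le> q \<and> q < n" "v \<le> u"
  shows "mark u v (A, P) + size (filter_mset (\<lambda>(n, q). v < q \<and> n < u + 2) A) = mark v v (A, P)"
proof -
  have eq: "filter_mset (\<lambda>(n, q). v + 2 \<le> n \<and> v < q) A = filter_mset (\<lambda>(n, q). v < q) A"
    by (rule filter_mset_cong) (use assms in auto)
  have "size (filter_mset (\<lambda>(n, q). v < q) A) = size (filter_mset (\<lambda>(n, q). u + 2 \<le> n \<and> v < q) A)
     + size (filter_mset (\<lambda>(n, q). v < q \<and> n < u + 2) A)"
    using size_filter_split[of "\<lambda>(n, q). v < q" A "\<lambda>(n, q). u + 2 \<le> n"]
    by (simp add: case_prod_unfold conj_commute not_le)
  then show ?thesis using eq by simp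
qed

text \<open>The multiplicity of \<open>Suc u\<close> is the difference of two consecutive tail
  sizes.\<close>

lemma multiset_eq_if_tails:
  fixes X Y :: "nat multiset"
  assumes "\<And>u. size (filter_mset (\<lambda>p. u < p) X) = size (filter_mset (\<lambda>p. u < p) Y)"
    and "0 \<notin># X" "0 \<notin># Y"
  shows "X = Y"
proof (rule multiset_eqI)
  fix x
  have *: "count X (Suc u) + size (filter_mset (\<lambda>p. Suc u < p) X) = size (filter_mset (\<lambda>p. u < p) X)"
    for X :: "nat multiset" and u
  proof (induction X)
    case (add y X)
    then show ?case by (auto split: if_splits)
  qed simp
  show "count X x = count Y x"
  proof (cases x)
    case 0
    then show ?thesis using assms(2,3) by (simp add: not_in_iff)
  next
    case (Suc u)
    then show ?thesis using *[of X u] *[of Y u] assms(1)[of u] assms(1)[of "Suc u"] by simp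
  qed
qed

theorem diagram_moves:
  assumes AY: "\<forall>(n, q) \<in># AY. 1 \<le> q \<and> q < n" and PY: "\<forall>p \<in># PY. 1 \<le> p"
    and AZ: "\<forall>(n, q) \<in># AZ. 1 \<le> q \<and> q < n" and PZ: "\<forall>p \<in># PZ. 1 \<le> p"
    and size: "size AY + size PY = size AZ + size PZ"
    and eq: "\<And>u. mark u u (AY, PY) = mark u u (AZ, PZ)"
    and le: "\<And>u v. v < u \<Longrightarrow> mark u v (AY, PY) \<le> mark u v (AZ, PZ)"
  shows "arc_move\<^sup>*\<^sup>* (AZ, PZ) (AY, PY)"
proof -
  have pts: "image_mset fst AY + image_mset snd AY + PY = image_mset fst AZ + image_mset snd AZ + PZ"
  proof (rule multiset_eq_if_tails)
    show "size (filter_mset (\<lambda>p. u < p) (image_mset fst AY + image_mset snd AY + PY)) =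
        size (filter_mset (\<lambda>p. u < p) (image_mset fst AZ + image_mset snd AZ + PZ))" for u
      using eq[of u] unfolding mark_diag[OF AY] mark_diag[OF AZ] .
  qed (use AY PY AZ PZ in fastforce)+
  \<comment> \<open>The multiset of end points has size \<open>2 * size A + size P\<close>; together
    with \<open>size A + size P\<close> this fixes both numbers.\<close>
  have sz: "size AY = size AZ" "size PY = size PZ"
    using arg_cong[OF pts, of size] size by auto
  \<comment> \<open>Strictly above all upper ends and poles, so that each pole becomes a proper arc
    and can be recognised again by its upper end.\<close>
  define M where "M = Suc (Max (insert 0 (set_mset (image_mset fst AY + image_mset fst AZ + PY + PZ))))"
  have M: "n < M" if "(n, q) \<in># AY + AZ" for n q
    unfolding M_def using that by (intro le_imp_less_Suc Max_ge) (auto intro: rev_image_eqI)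
  let ?X = "\<lambda>A P. A + image_mset (Pair M) P"
  have PM: "p < M" if "p \<in># PY + PZ" for p
    unfolding M_def using that by (intro le_imp_less_Suc Max_ge) auto
  have inner: "size (filter_mset (\<lambda>(n, q). a \<le> q \<and> n < b) AZ) \<le> size (filter_mset (\<lambda>(n, q). a \<le> q \<and> n < b) AY)" for a b
  proof -
    \<comment> \<open>Arc ends are positive, so the lower bound may be raised to 1 and then written
      as \<open>v + 1\<close>.\<close>
    define c where "c = max a 1"
    have c: "filter_mset (\<lambda>(n, q). a \<le> q \<and> n < b) AZ = filter_mset (\<lambda>(n, q). c \<le> q \<and> n < b) AZ"
      "filter_mset (\<lambda>(n, q). a \<le> q \<and> n < b) AY = filter_mset (\<lambda>(n, q). c \<le> q \<and> n < b) AY"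
      by (rule filter_mset_cong; use AZ AY in \<open>auto simp: c_def\<close>)+
    show ?thesis
    proof (cases "c + 2 \<le> b")
      case True
      define u v where "u = b - 2" and "v = c - 1"
      have uv: "v < u" "b = u + 2" "c = Suc v" using True by (auto simp: u_def v_def c_def)
      show ?thesis unfolding c using mark_inner[OF AY, of v u PY] mark_inner[OF AZ, of v u PZ]
          le[OF uv(1)] eq[of v] uv by (simp add: Suc_le_eq)
    next
      case False
      then have "filter_mset (\<lambda>(n, q). c \<le> q \<and> n < b) AZ = {#}"
        using AZ by fastforce
      then show ?thesis unfolding c by (simp only: size_empty le0)
    qed
  qed
  \<comment> \<open>If the interval contains \<open>M\<close>, its arcs are those with lower end at
    least \<open>a\<close>. Their number is the number of end points from \<open>a\<close> on, minus
    the number of original arcs whose upper end is at least \<open>a\<close>; the latter is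
    \<open>size A\<close> minus the count of the initial interval below \<open>a\<close>.\<close>
  have X: "size (filter_mset (\<lambda>(n, q). a \<le> q \<and> n < b) (?X A P)) =
      (if b \<le> M then size (filter_mset (\<lambda>(n, q). a \<le> q \<and> n < b) A)
       else size (filter_mset (\<lambda>p. a \<le> p) (image_mset fst A + image_mset snd A + P))
          + size (filter_mset (\<lambda>(n, q). 0 \<le> q \<and> n < a) A) - size A)"
    if A: "\<forall>(n, q) \<in># A. 1 \<le> q \<and> q < n" "\<forall>(n, q) \<in># A. n < M" for a b A P
  proof (cases "b \<le> M")
    case True
    then show ?thesis by (simp add: filter_mset_image_mset)
  next
    case False
    have "filter_mset (\<lambda>(n, q). a \<le> q \<and> n < b) A = filter_mset (\<lambda>(n, q). a \<le> q) A"
      using A(2) False by (intro filter_mset_cong) auto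
    moreover have "size (filter_mset (\<lambda>(n, q). a \<le> n) A) + size (filter_mset (\<lambda>(n, q). n < a) A) = size A"
      using size_filter_partition[of "\<lambda>(n, q). a \<le> n" A] by (simp add: case_prod_unfold not_le)
    ultimately show ?thesis using False
      by (simp add: filter_mset_image_mset case_prod_unfold)
  qed
  have MYZ: "\<forall>(n, q) \<in># AY. n < M" "\<forall>(n, q) \<in># AZ. n < M" using M by auto
  have "arc_move\<^sup>*\<^sup>* (to_diagram M (?X AZ PZ)) (to_diagram M (?X AY PY))"
  proof (rule to_diagram_moves)
    show "\<forall>(m, r) \<in># ?X AY PY. r < m \<and> m \<le> M" "\<forall>(m, r) \<in># ?X AZ PZ. r < m"
      using AY AZ M PM by fastforce+
    show "image_mset fst (?X AY PY) + image_mset snd (?X AY PY) = image_mset fst (?X AZ PZ) + image_mset snd (?X AZ PZ)"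
      using pts sz by (simp add: multiset.map_comp comp_def image_mset_const_eq ac_simps)
    show "size (filter_mset (\<lambda>(m, r). a \<le> r \<and> m < b) (?X AZ PZ)) \<le> size (filter_mset (\<lambda>(m, r). a \<le> r \<and> m < b) (?X AY PY))" for a b
      unfolding X[OF AY MYZ(1)] X[OF AZ MYZ(2)] using inner[of a b] inner[of 0 a] pts sz by (auto intro: diff_le_mono)
  qed
  moreover have "to_diagram M (?X A P) = (A, P)" if "\<forall>(n, q) \<in># A. n < M" for A P
  proof -
    have "filter_mset (\<lambda>x. fst x \<noteq> M) A = A"
      using filter_mset_cong[of A A "\<lambda>x. fst x \<noteq> M" "\<lambda>_. True"] that by fastforce
    moreover have "filter_mset (\<lambda>x. fst x = M) A = {#}"
      using that by fastforce
    ultimately show ?thesis by (simp add: to_diagram_def filter_mset_image_mset multiset.map_comp comp_def)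
  qed
  ultimately show ?thesis using MYZ by simp
qed

section \<open>Decomposition into pickets and bipickets\<close>

lemma (in vector_space) exists_functional:
  assumes S: "subspace S" "w \<notin> S"
  obtains \<phi> where "Vector_Spaces.linear scale (*) \<phi>" "\<phi> w = 1" "\<And>x. x \<in> S \<Longrightarrow> \<phi> x = 0"
proof -
  interpret f: vector_space "(*) :: 'a \<Rightarrow> 'a \<Rightarrow> 'a" by unfold_locales (auto simp: algebra_simps)
  interpret p: vector_space_pair scale "(*) :: 'a \<Rightarrow> 'a \<Rightarrow> 'a" by unfold_locales
  obtain E where E: "E \<subseteq> S" "independent E" "S \<subseteq> span E" using basis_exists[of S] by metis
  have sp: "span E = S" using E span_subspace[OF E(1) _ S(1)] by blast
  have ind: "independent (insert w E)" using E(2) S(2) sp by (intro independent_insertI) auto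
  obtain \<phi> where \<phi>: "Vector_Spaces.linear scale (*) \<phi>" "\<forall>x\<in>insert w E. \<phi> x = (if x = w then 1 else 0)"
    using p.linear_independent_extend[OF ind, of "\<lambda>x. if x = w then 1 else 0"] by blast
  have "\<phi> x = 0" if "x \<in> S" for x
  proof (rule p.linear_eq_0_on_span[OF \<phi>(1), of E])
    show "x \<in> span E" using that sp by simp
    fix e assume "e \<in> E"
    then show "\<phi> e = 0" using \<phi>(2) E(1) S(2) by auto
  qed
  then show thesis using that \<phi> by auto
qed

text \<open>The kernel of \<open>g\<close> on \<open>A\<close> is added to \<open>S\<close>. Since
  \<open>g\<close> vanishes on the intersection of \<open>A\<close> and \<open>S\<close>, a vector
  \<open>a1\<close> of \<open>A\<close> with \<open>g a1 = 1\<close> stays outside this sum, and a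
  functional that is 0 on the sum and 1 at \<open>a1\<close> meets both requirements.\<close>

lemma (in vector_space) functional_ext:
  assumes S: "subspace S" and A: "subspace A" and g: "Vector_Spaces.linear scale (*) g"
    and 0: "\<And>a. a \<in> A \<Longrightarrow> a \<in> S \<Longrightarrow> g a = 0"
  obtains \<mu> where "Vector_Spaces.linear scale (*) \<mu>" "\<And>x. x \<in> S \<Longrightarrow> \<mu> x = 0" "\<And>a. a \<in> A \<Longrightarrow> \<mu> a = g a"
proof (cases "\<forall>a\<in>A. g a = 0")
  case True
  have "Vector_Spaces.linear scale (*) (\<lambda>_. 0)"
    using g unfolding Vector_Spaces.linear_iff by simp
  then show ?thesis using that True by auto
next
  case False
  interpret g: Vector_Spaces.linear scale "(*)" g by (fact g)
  obtain a where a: "a \<in> A" "g a \<noteq> 0" using False by blast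
  define a1 where "a1 = scale (inverse (g a)) a"
  have a1: "a1 \<in> A" "g a1 = 1" using a A by (auto simp: a1_def subspace_scale g.scale)
  define S' where "S' = {x + y |x y. x \<in> S \<and> y \<in> {a \<in> A. g a = 0}}"
  have K: "subspace {a \<in> A. g a = 0}"
    using A by (auto simp: subspace_def g.add g.scale g.zero)
  have S': "subspace S'" unfolding S'_def by (rule subspace_sums[OF S K])
  have "a1 \<notin> S'"
  proof
    assume "a1 \<in> S'"
    then obtain x y where xy: "a1 = x + y" "x \<in> S" "y \<in> A" "g y = 0" unfolding S'_def by blast
    then have "x = a1 - y" by simp
    then have "x \<in> A" using subspace_diff[OF A a1(1) xy(3)] by metis
    then have "g x = 0" using 0 xy by blast
    then show False using a1 xy by (simp add: g.add)
  qed
  then obtain \<mu> where \<mu>: "Vector_Spaces.linear scale (*) \<mu>" "\<mu> a1 = 1" "\<And>x. x \<in> S' \<Longrightarrow> \<mu> x = 0"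
    using exists_functional[OF S'] by metis
  interpret m: Vector_Spaces.linear scale "(*)" \<mu> by (fact \<mu>)
  have "\<mu> x = 0" if "x \<in> S" for x
  proof (rule \<mu>(3))
    have "x = x + 0 \<and> x \<in> S \<and> 0 \<in> {a \<in> A. g a = 0}" using that A by (simp add: subspace_0 g.zero)
    then show "x \<in> S'" unfolding S'_def by blast
  qed
  moreover have "\<mu> a = g a" if "a \<in> A" for a
  proof -
    have "a - scale (g a) a1 \<in> {a \<in> A. g a = 0}"
      using that a1 A by (simp add: subspace_diff subspace_scale g.diff g.scale)
    then have "a - scale (g a) a1 \<in> S'" unfolding S'_def using subspace_0[OF S] by force
    then have "\<mu> (a - scale (g a) a1) = 0" using \<mu>(3) by blast
    then show ?thesis using \<mu>(2) by (simp add: m.diff m.scale)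
  qed
  ultimately show ?thesis using that \<mu>(1) by blast
qed

text \<open>A k[T]-module is treated as a vector space with one endomorphism; submodules are the
  \<open>T\<close>-stable subspaces, so that bases and dimensions are those of linear
  algebra.\<close>

locale operator_space = vector_space scale
  for scale :: "'a::field \<Rightarrow> 'b::ab_group_add \<Rightarrow> 'b" (infixr "*s" 75) +
  fixes T :: "'b \<Rightarrow> 'b"
  assumes linear_T: "Vector_Spaces.linear scale scale T"
begin

lemma linear_pow: "Vector_Spaces.linear scale scale (T ^^ n)"
proof (induction n)
  case 0
  have "T ^^ 0 = (\<lambda>x. x)" by auto
  then show ?case using linear_ident by simp
next
  case (Suc n)
  then show ?case using Vector_Spaces.linear_compose[OF Suc linear_T] by (simp only: funpow.simps)
qed

lemma pow_simps [simp]: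
  "(T ^^ n) (x + y) = (T ^^ n) x + (T ^^ n) y" "(T ^^ n) (x - y) = (T ^^ n) x - (T ^^ n) y"
  "(T ^^ n) (a *s x) = a *s (T ^^ n) x" "(T ^^ n) 0 = 0" "(T ^^ n) (- x) = - (T ^^ n) x"
proof -
  interpret l: Vector_Spaces.linear scale scale "T ^^ n" by (rule linear_pow)
  show "(T ^^ n) (x + y) = (T ^^ n) x + (T ^^ n) y" "(T ^^ n) (x - y) = (T ^^ n) x - (T ^^ n) y"
    "(T ^^ n) (a *s x) = a *s (T ^^ n) x" "(T ^^ n) 0 = 0" "(T ^^ n) (- x) = - (T ^^ n) x"
    by (rule l.add l.diff l.scale l.zero l.neg)+
qed

lemma T_simps [simp]:
  "T (x + y) = T x + T y" "T (x - y) = T x - T y" "T (a *s x) = a *s T x" "T 0 = 0" "T (- x) = - T x"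
  using pow_simps[of 1] by simp_all

lemma pow_sum: "(T ^^ n) (\<Sum>i\<in>I. f i) = (\<Sum>i\<in>I. (T ^^ n) (f i))"
  by (induction I rule: infinite_finite_induct) auto

lemma T_sum: "T (\<Sum>i\<in>I. f i) = (\<Sum>i\<in>I. T (f i))"
  by (induction I rule: infinite_finite_induct) auto

lemma pow_pow: "(T ^^ m) ((T ^^ n) x) = (T ^^ (m + n)) x"
  by (simp add: funpow_add)

lemma pow_zero: "(T ^^ n) x = 0 \<Longrightarrow> n \<le> m \<Longrightarrow> (T ^^ m) x = 0"
  using pow_pow[of "m - n" n x] by simp

lemma T_pow: "T ((T ^^ n) x) = (T ^^ Suc n) x" by simp

lemma pow_in: "T ` B \<subseteq> B \<Longrightarrow> b \<in> B \<Longrightarrow> (T ^^ n) b \<in> B"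
  by (induction n) auto

section \<open>Cyclic submodules\<close>

definition cyc :: "nat \<Rightarrow> 'b \<Rightarrow> (nat \<Rightarrow> 'a) \<Rightarrow> 'b" where
  "cyc n x c = (\<Sum>j<n. c j *s (T ^^ j) x)"

lemma cyc_add: "cyc n x c + cyc n x d = cyc n x (\<lambda>j. c j + d j)"
  by (simp add: cyc_def scale_left_distrib sum.distrib)

lemma cyc_scale: "a *s cyc n x c = cyc n x (\<lambda>j. a * c j)"
  by (simp add: cyc_def scale_sum_right)

lemma cyc_zero: "(\<And>j. j < n \<Longrightarrow> c j = 0) \<Longrightarrow> cyc n x c = 0"
  by (simp add: cyc_def)

lemma cyc_minus: "- cyc n x c = cyc n x (\<lambda>j. - c j)"
  by (simp add: cyc_def sum_negf)

lemma cyc_single: "k < n \<Longrightarrow> cyc n x (\<lambda>j. if j = k then a else 0) = a *s (T ^^ k) x"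
  unfolding cyc_def by (subst sum.remove[of _ k]) auto

lemma cyc_in: "subspace B \<Longrightarrow> T ` B \<subseteq> B \<Longrightarrow> x \<in> B \<Longrightarrow> cyc n x c \<in> B"
  unfolding cyc_def by (intro subspace_sum subspace_scale pow_in)

lemma cyc_T:
  assumes "(T ^^ n) x = 0"
  shows "T (cyc n x c) = cyc n x (\<lambda>j. if j = 0 then 0 else c (j - 1))"
proof (cases n)
  case (Suc m)
  have "T (cyc n x c) = (\<Sum>j<n. c j *s (T ^^ Suc j) x)"
    by (simp add: cyc_def T_sum)
  also have "\<dots> = (\<Sum>j<m. c j *s (T ^^ Suc j) x)" using assms Suc by simp
  also have "\<dots> = cyc n x (\<lambda>j. if j = 0 then 0 else c (j - 1))"
    unfolding cyc_def Suc sum.lessThan_Suc_shift by simp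
  finally show ?thesis .
qed (simp add: cyc_def)

lemma cyc_pow:
  assumes "(T ^^ n) x = 0"
  shows "(T ^^ k) (cyc n x c) = cyc n x (\<lambda>j. if j < k then 0 else c (j - k))"
proof (induction k)
  case (Suc k)
  then have "(T ^^ Suc k) (cyc n x c) = cyc n x (\<lambda>j. if j = 0 then 0 else if j - 1 < k then 0 else c (j - 1 - k))"
    using cyc_T[OF assms] by simp
  also have "\<dots> = cyc n x (\<lambda>j. if j < Suc k then 0 else c (j - Suc k))"
    by (rule arg_cong[of _ _ "cyc n x"]) (auto simp: fun_eq_iff)
  finally show ?case .
qed simp

text \<open>Triangular elimination: on T^(n-1-i) x the functional \<phi> after T^i takes the value
  1, and \<phi> after a higher power of T takes the value 0. So the values for i = k-1, ..., 0 can
  be removed in turn. Only coefficients from \<open>n - k\<close> on are used, which later keeps the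
  projection of an element of \<open>A\<close> inside \<open>A\<close>.\<close>

lemma cyc_project:
  assumes \<phi>: "Vector_Spaces.linear scale (*) \<phi>" and x: "(T ^^ n) x = 0" "\<phi> ((T ^^ (n - 1)) x) = 1"
    and b: "\<And>i. k \<le> i \<Longrightarrow> \<phi> ((T ^^ i) b) = 0" "k \<le> n"
  shows "\<exists>c. (\<forall>j<n - k. c j = 0) \<and> (\<forall>i. \<phi> ((T ^^ i) (b - cyc n x c)) = 0)"
  using b
proof (induction k arbitrary: b)
  case 0
  then show ?case by (intro exI[of _ "\<lambda>_. 0"]) (simp add: cyc_zero)
next
  case (Suc k)
  interpret f: Vector_Spaces.linear scale "(*)" \<phi> by (fact \<phi>)
  define t where "t = \<phi> ((T ^^ k) b)"
  define e where "e = (\<lambda>j. if j = n - 1 - k then t else 0)"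
  have e: "cyc n x e = t *s (T ^^ (n - 1 - k)) x"
    unfolding e_def using Suc.prems(2) by (intro cyc_single) auto
  have "\<phi> ((T ^^ i) (b - cyc n x e)) = 0" if "k \<le> i" for i
  proof (cases "i = k")
    case True
    have "k + (n - 1 - k) = n - 1" using Suc.prems(2) by simp
    then have "(T ^^ k) ((T ^^ (n - 1 - k)) x) = (T ^^ (n - 1)) x" by (simp add: pow_pow)
    then show ?thesis using x(2) True by (simp add: e f.diff f.scale t_def)
  next
    case False
    then have "n \<le> i + (n - 1 - k)" "Suc k \<le> i" using that Suc.prems(2) by auto
    then show ?thesis using Suc.prems(1)[of i] pow_zero[OF x(1)]
      by (simp add: e pow_pow f.diff f.scale f.zero)
  qed
  then obtain c where c: "\<forall>j<n - k. c j = 0" "\<forall>i. \<phi> ((T ^^ i) (b - cyc n x e - cyc n x c)) = 0"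
    using Suc.IH[of "b - cyc n x e"] Suc.prems(2) by auto
  have "b - cyc n x e - cyc n x c = b - cyc n x (\<lambda>j. e j + c j)"
    unfolding cyc_add[symmetric] by simp
  then have "\<forall>i. \<phi> ((T ^^ i) (b - cyc n x (\<lambda>j. e j + c j))) = 0" using c(2) by metis
  moreover have "\<forall>j<n - Suc k. e j + c j = 0" using c(1) by (auto simp: e_def)
  ultimately show ?case by (intro exI[of _ "\<lambda>j. e j + c j"] conjI)
qed

text \<open>If the coefficients before \<open>j\<close> vanish, then T^(n-1-j) moves the
  \<open>j\<close>-th term to the top power T^(n-1) x and kills all later ones. This gives both the
  freeness of the generator and the trivial intersection with the complement.\<close>

lemma cyc_indep:
  assumes \<phi>: "Vector_Spaces.linear scale (*) \<phi>" and x: "(T ^^ n) x = 0" "\<phi> ((T ^^ (n - 1)) x) = 1"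
    and c: "\<And>i. \<phi> ((T ^^ i) (cyc n x c)) = 0" and j: "j < n"
  shows "c j = 0"
  using j
proof (induction j rule: less_induct)
  case (less j)
  interpret f: Vector_Spaces.linear scale "(*)" \<phi> by (fact \<phi>)
  have "(T ^^ (n - 1 - j)) (cyc n x c) = (\<Sum>k<n. c k *s (T ^^ (n - 1 - j + k)) x)"
    by (simp add: cyc_def pow_sum pow_pow)
  also have "\<dots> = (\<Sum>k<n. if k = j then c j *s (T ^^ (n - 1)) x else 0)"
  proof (rule sum.cong[OF refl])
    fix k assume k: "k \<in> {..<n}"
    consider "k < j" | "k = j" | "j < k" by linarith
    then show "c k *s (T ^^ (n - 1 - j + k)) x = (if k = j then c j *s (T ^^ (n - 1)) x else 0)"
    proof cases
      case 3
      then show ?thesis using less.prems by (simp add: pow_zero[OF x(1)])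
    qed (use less in auto)
  qed
  also have "\<dots> = c j *s (T ^^ (n - 1)) x" using less.prems by simp
  finally show ?case using c[of "n - 1 - j"] x(2) by (simp add: f.scale)
qed

text \<open>\<open>block s C A\<close>: inside the ambient space the pair \<open>A \<subseteq> C\<close> is a copy of the indecomposable \<open>s\<close>.\<close>
fun block :: "summand \<Rightarrow> 'b set \<Rightarrow> 'b set \<Rightarrow> bool" where
  "block (Picket l n) C A \<longleftrightarrow> 1 \<le> n \<and> l \<le> n \<and> l \<le> 2 \<and> (\<exists>x. (T ^^ n) x = 0
      \<and> (\<forall>c. cyc n x c = 0 \<longrightarrow> (\<forall>j<n. c j = 0))
      \<and> C = range (cyc n x) \<and> A = {cyc n x c |c. \<forall>j<n - l. c j = 0})"
| "block (Bipicket n q) C A \<longleftrightarrow> 1 \<le> q \<and> q + 2 \<le> n \<and> (\<exists>x y. (T ^^ n) x = 0 \<and> (T ^^ q) y = 0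
      \<and> (\<forall>c d. cyc n x c + cyc q y d = 0 \<longrightarrow> (\<forall>j<n. c j = 0) \<and> (\<forall>j<q. d j = 0))
      \<and> C = {cyc n x c + cyc q y d |c d. True}
      \<and> A = {s *s ((T ^^ (n - 2)) x + (T ^^ (q - 1)) y) + t *s (T ^^ (n - 1)) x |s t. True})"

section \<open>Splitting off one indecomposable summand\<close>

definition splits_off :: "summand \<Rightarrow> 'b set \<Rightarrow> 'b set \<Rightarrow> bool" where
  "splits_off s B A \<longleftrightarrow> (\<exists>C AC B'. block s C AC \<and> subspace B' \<and> T ` B' \<subseteq> B' \<and>
     B = {x + y |x y. x \<in> C \<and> y \<in> B'} \<and> C \<inter> B' = {0} \<and>
     A = {x + y |x y. x \<in> AC \<and> y \<in> A \<inter> B'})"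

text \<open>The complement is the largest \<open>T\<close>-stable subspace of \<open>B\<close> on
  which \<phi> vanishes. As \<phi> vanishes on T^i A for \<open>i \<ge> l\<close>, an element of
  \<open>A\<close> is projected using only coefficients from \<open>n - l\<close> on, that is, into
  the part of the cyclic module which belongs to the picket and lies in \<open>A\<close>.\<close>

lemma picket_splits_off:
  assumes B: "subspace B" "T ` B \<subseteq> B" and A: "subspace A" "A \<subseteq> B" "T ` A \<subseteq> A"
    and n: "1 \<le> n" "l \<le> n" "l \<le> 2" "\<And>b. b \<in> B \<Longrightarrow> (T ^^ n) b = 0"
    and x: "x \<in> B" "(T ^^ (n - l)) x \<in> A"
    and \<phi>: "Vector_Spaces.linear scale (*) \<phi>" "\<phi> ((T ^^ (n - 1)) x) = 1"
      "\<And>a i. a \<in> A \<Longrightarrow> l \<le> i \<Longrightarrow> \<phi> ((T ^^ i) a) = 0"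
  shows "splits_off (Picket l n) B A"
proof -
  interpret f: Vector_Spaces.linear scale "(*)" \<phi> by (fact \<phi>)
  have Tn: "(T ^^ n) x = 0" using n(4) x(1) by blast
  define B' where "B' = {b \<in> B. \<forall>i. \<phi> ((T ^^ i) b) = 0}"
  define AC where "AC = {cyc n x c |c. \<forall>j<n - l. c j = 0}"
  have sB': "subspace B'" unfolding B'_def using B(1)
    by (auto simp: subspace_def f.add f.scale f.zero)
  have tB': "T ` B' \<subseteq> B'"
  proof
    fix z assume "z \<in> T ` B'"
    then obtain b where b: "z = T b" "b \<in> B" "\<forall>i. \<phi> ((T ^^ i) b) = 0" unfolding B'_def by blast
    have "\<phi> ((T ^^ i) (T b)) = 0" for i using b(3)[rule_format, of "Suc i"] by (simp add: funpow_swap1)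
    then show "z \<in> B'" using b B(2) unfolding B'_def by auto
  qed
  have ind: "\<forall>j<n. c j = 0" if "\<And>i. \<phi> ((T ^^ i) (cyc n x c)) = 0" for c
    using cyc_indep[OF \<phi>(1) Tn \<phi>(2) that] by blast
  have "block (Picket l n) (range (cyc n x)) AC"
    using n Tn ind unfolding AC_def by (auto simp: f.zero)
  moreover have "B = {z + y |z y. z \<in> range (cyc n x) \<and> y \<in> B'}"
  proof (intro set_eqI iffI)
    fix b assume b: "b \<in> B"
    have "\<phi> ((T ^^ i) b) = 0" if "n \<le> i" for i using pow_zero[OF n(4)[OF b] that] by (simp add: f.zero)
    then obtain c where c: "\<forall>i. \<phi> ((T ^^ i) (b - cyc n x c)) = 0"
      using cyc_project[OF \<phi>(1) Tn \<phi>(2)] by blast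
    have "b - cyc n x c \<in> B'" unfolding B'_def using c b cyc_in[OF B x(1)] B(1) by (auto intro: subspace_diff)
    moreover have "b = cyc n x c + (b - cyc n x c)" by simp
    ultimately show "b \<in> {z + y |z y. z \<in> range (cyc n x) \<and> y \<in> B'}" by blast
  next
    fix b assume "b \<in> {z + y |z y. z \<in> range (cyc n x) \<and> y \<in> B'}"
    then show "b \<in> B" unfolding B'_def using cyc_in[OF B x(1)] B(1) by (auto intro: subspace_add)
  qed
  moreover have "range (cyc n x) \<inter> B' = {0}"
  proof (intro set_eqI iffI)
    fix b assume "b \<in> range (cyc n x) \<inter> B'"
    then obtain c where c: "b = cyc n x c" "\<And>i. \<phi> ((T ^^ i) (cyc n x c)) = 0" unfolding B'_def by auto
    show "b \<in> {0}" using ind[OF c(2)] c(1) by (simp add: cyc_zero)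
  next
    fix b assume "b \<in> {0::'b}"
    moreover have "0 = cyc n x (\<lambda>_. 0)" by (simp add: cyc_zero)
    ultimately show "b \<in> range (cyc n x) \<inter> B'" using subspace_0[OF sB'] by auto
  qed
  moreover have AC_A: "z \<in> A" if z: "z \<in> AC" for z
  proof -
    obtain c where c: "z = cyc n x c" "\<forall>j<n - l. c j = 0" using z unfolding AC_def by blast
    have "c j *s (T ^^ j) x \<in> A" if "j < n" for j
    proof (cases "j < n - l")
      case False
      then have "(T ^^ j) x = (T ^^ (j - (n - l))) ((T ^^ (n - l)) x)" by (simp add: pow_pow)
      then show ?thesis using pow_in[OF A(3) x(2)] A(1) by (simp add: subspace_scale)
    qed (use c A(1) subspace_0 in auto)
    then show ?thesis unfolding c(1) cyc_def using A(1) by (intro subspace_sum) auto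
  qed
  have "A = {z + y |z y. z \<in> AC \<and> y \<in> A \<inter> B'}"
  proof (intro set_eqI iffI)
    fix a assume a: "a \<in> A"
    obtain c where c: "\<forall>j<n - l. c j = 0" "\<forall>i. \<phi> ((T ^^ i) (a - cyc n x c)) = 0"
      using cyc_project[OF \<phi>(1) Tn \<phi>(2) \<phi>(3)[OF a] n(2)] by blast
    have z: "cyc n x c \<in> AC" using c(1) unfolding AC_def by blast
    then have "a - cyc n x c \<in> A" using a A(1) AC_A by (auto intro: subspace_diff)
    moreover from this have "a - cyc n x c \<in> B'" using c(2) A(2) unfolding B'_def by auto
    moreover have "a = cyc n x c + (a - cyc n x c)" by simp
    ultimately show "a \<in> {z + y |z y. z \<in> AC \<and> y \<in> A \<inter> B'}" using z by blast
  next
    fix a assume "a \<in> {z + y |z y. z \<in> AC \<and> y \<in> A \<inter> B'}"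
    then show "a \<in> A" using AC_A A(1) by (auto intro: subspace_add)
  qed
  ultimately show ?thesis unfolding splits_off_def using sB' tB' by blast
qed

text \<open>Two functionals cut out the complement: \<phi> detects the summand generated by
  \<open>x\<close>, and \<mu> the one generated by \<open>y\<close>. Because \<mu> equals \<phi>
  after \<open>T\<close> on \<open>A\<close>, the four conditions on an element of \<open>A\<close>
  and its image under \<open>T\<close> reduce to two, matching the two-dimensional submodule of the
  bipicket.\<close>

lemma bipicket_splits_off:
  assumes B: "subspace B" "T ` B \<subseteq> B" and A: "subspace A" "A \<subseteq> B" "\<And>a. a \<in> A \<Longrightarrow> T a \<in> A \<and> T (T a) = 0"
    and n: "1 \<le> q" "q + 2 \<le> n" "\<And>b. b \<in> B \<Longrightarrow> (T ^^ n) b = 0"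
    and x: "x \<in> B" and y: "y \<in> B" "(T ^^ q) y = 0" and a0: "(T ^^ (n - 2)) x + (T ^^ (q - 1)) y \<in> A"
    and \<phi>: "Vector_Spaces.linear scale (*) \<phi>" "\<phi> ((T ^^ (n - 1)) x) = 1"
    and \<mu>: "Vector_Spaces.linear scale (*) \<mu>" "\<And>b. b \<in> B \<Longrightarrow> \<mu> ((T ^^ q) b) = 0"
      "\<And>a. a \<in> A \<Longrightarrow> \<mu> a = \<phi> (T a)"
  shows "splits_off (Bipicket n q) B A"
proof -
  interpret f: Vector_Spaces.linear scale "(*)" \<phi> by (fact \<phi>)
  interpret m: Vector_Spaces.linear scale "(*)" \<mu> by (fact \<mu>)
  have Tn: "(T ^^ n) x = 0" using n(3) x by blast
  have n1: "Suc (n - 2) = n - 1" "Suc (n - 1) = n" "Suc (q - 1) = q" using n(1,2) by auto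
  have T1: "T ((T ^^ (n - 2)) z) = (T ^^ (n - 1)) z" "T ((T ^^ (n - 1)) z) = (T ^^ n) z"
    "T ((T ^^ (q - 1)) z) = (T ^^ q) z" for z
    unfolding T_pow n1 by (rule refl)+
  have mu0: "\<mu> ((T ^^ i) b) = 0" if "b \<in> B" "q \<le> i" for b i
  proof -
    have "(T ^^ i) b = (T ^^ q) ((T ^^ (i - q)) b)" using that(2) by (simp add: pow_pow)
    then show ?thesis using \<mu>(2) pow_in[OF B(2) that(1)] by simp
  qed
  have phi0: "\<phi> ((T ^^ i) b) = 0" if "b \<in> B" "n \<le> i" for b i
    using pow_zero[OF n(3)[OF that(1)] that(2)] by (simp add: f.zero)
  \<comment> \<open>Replace \<open>y\<close> by \<open>y'\<close> on which \<open>\<phi>\<close> vanishes; this changes the generator of \<open>A\<close> only by an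
    element of the socle of \<open>A\<close>.\<close>
  obtain e where e: "\<And>i. \<phi> ((T ^^ i) (y - cyc n x e)) = 0"
    using cyc_project[OF \<phi>(1) Tn \<phi>(2) phi0[OF y(1)]] by blast
  define y' where "y' = y - cyc n x e"
  have y'B: "y' \<in> B" unfolding y'_def using y(1) cyc_in[OF B x] B(1) by (auto intro: subspace_diff)
  have y'phi: "\<phi> ((T ^^ i) y') = 0" for i using e unfolding y'_def .
  have ind_x: "\<forall>j<n. c j = 0" if "\<And>i. \<phi> ((T ^^ i) (cyc n x c)) = 0" for c
    using cyc_indep[OF \<phi>(1) Tn \<phi>(2) that] by blast
  have "(T ^^ q) y' = - (T ^^ q) (cyc n x e)" using y(2) by (simp add: y'_def)
  also have "\<dots> = cyc n x (\<lambda>j. - (if j < q then 0 else e (j - q)))"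
    unfolding cyc_pow[OF Tn] cyc_minus ..
  finally have y'q: "(T ^^ q) y' = cyc n x (\<lambda>j. - (if j < q then 0 else e (j - q)))" .
  have "\<phi> ((T ^^ i) ((T ^^ q) y')) = 0" for i using y'phi[of "i + q"] by (simp add: pow_pow)
  \<comment> \<open>An element of the cyclic module of \<open>x\<close> on whose
    \<open>T\<close>-powers \<phi> vanishes is zero. So T^q kills \<open>y'\<close>, and the
    coefficients of \<open>e\<close> below \<open>n - q\<close> vanish; after applying T^(q-1) only
    the coefficient with index \<open>n - q\<close> survives.\<close>
  then have 0: "\<forall>j<n. - (if j < q then 0 else e (j - q)) = 0"
    unfolding y'q by (rule ind_x)
  then have Ty': "(T ^^ q) y' = 0" unfolding y'q by (simp add: cyc_zero)
  have "(T ^^ (q - 1)) (cyc n x e) = cyc n x (\<lambda>j. if j < q - 1 then 0 else e (j - (q - 1)))"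
    by (rule cyc_pow[OF Tn])
  also have "\<dots> = cyc n x (\<lambda>j. if j = n - 1 then e (n - q) else 0)"
    unfolding cyc_def
  proof (rule sum.cong[OF refl])
    fix j assume j: "j \<in> {..<n}"
    have "e (j - (q - 1)) = 0" if "\<not> j < q - 1" "j \<noteq> n - 1"
    proof -
      have "Suc j < n" "\<not> Suc j < q" "Suc j - q = j - (q - 1)" using that j n(1) by auto
      then show ?thesis using 0 by (metis neg_equal_0_iff_equal)
    qed
    moreover have "n - 1 - (q - 1) = n - q" using n by simp
    ultimately show "(if j < q - 1 then 0 else e (j - (q - 1))) *s (T ^^ j) x = (if j = n - 1 then e (n - q) else 0) *s (T ^^ j) x"
      using n by auto
  qed
  also have "\<dots> = e (n - q) *s (T ^^ (n - 1)) x" using n by (intro cyc_single) auto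
  finally have Te: "(T ^^ (q - 1)) (cyc n x e) = e (n - q) *s (T ^^ (n - 1)) x" .
  define a1 where "a1 = (T ^^ (n - 2)) x + (T ^^ (q - 1)) y'"
  have Ta1: "T a1 = (T ^^ (n - 1)) x" using Ty' unfolding a1_def T_simps T1 by simp
  have Ta0: "T ((T ^^ (n - 2)) x + (T ^^ (q - 1)) y) = (T ^^ (n - 1)) x" using y(2) unfolding T_simps T1 by simp
  have xA: "(T ^^ (n - 1)) x \<in> A" using A(3)[OF a0] Ta0 by simp
  have "a1 = ((T ^^ (n - 2)) x + (T ^^ (q - 1)) y) - e (n - q) *s (T ^^ (n - 1)) x"
    unfolding a1_def y'_def pow_simps Te by simp
  then have a1: "a1 \<in> A" using a0 xA A(1) by (simp add: subspace_diff subspace_scale)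
  \<comment> \<open>As \<open>q \<le> n - 2\<close>, this vector lies in T^q B. The value \<mu>(a1)
    = \<phi>(T a1) = 1 is therefore due to T^(q-1) y' alone, so \<mu> is for \<open>y'\<close> what
    \<phi> is for \<open>x\<close>.\<close>
  have "\<mu> ((T ^^ (n - 2)) x) = 0" using mu0[OF x] n by simp
  then have mu_y': "\<mu> ((T ^^ (q - 1)) y') = 1"
    using \<mu>(3)[OF a1] \<phi>(2) unfolding Ta1 unfolding a1_def by (simp add: m.add)
  have ind_y: "\<forall>j<q. d j = 0" if "\<And>i. \<mu> ((T ^^ i) (cyc q y' d)) = 0" for d
    using cyc_indep[OF \<mu>(1) Ty' mu_y' that] by blast
  have phi_cy: "\<phi> ((T ^^ i) (cyc q y' d)) = 0" for i d
    by (simp add: cyc_def pow_sum pow_pow f.sum f.scale y'phi)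
  define B' where "B' = {b \<in> B. (\<forall>i. \<phi> ((T ^^ i) b) = 0) \<and> (\<forall>i. \<mu> ((T ^^ i) b) = 0)}"
  define C where "C = {cyc n x c + cyc q y' d |c d. True}"
  define AC where "AC = {s *s a1 + t *s (T ^^ (n - 1)) x |s t. True}"
  have sB': "subspace B'" unfolding B'_def using B(1)
    by (auto simp: subspace_def f.add f.scale f.zero m.add m.scale m.zero)
  have tB': "T ` B' \<subseteq> B'"
  proof
    fix z assume "z \<in> T ` B'"
    then obtain b where b: "z = T b" "b \<in> B" "\<forall>i. \<phi> ((T ^^ i) b) = 0" "\<forall>i. \<mu> ((T ^^ i) b) = 0" unfolding B'_def by blast
    have "\<phi> ((T ^^ i) (T b)) = 0" "\<mu> ((T ^^ i) (T b)) = 0" for i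
      using b(3,4)[rule_format, of "Suc i"] by (simp_all add: funpow_swap1)
    then show "z \<in> B'" using b B(2) unfolding B'_def by auto
  qed
  have ind: "(\<forall>j<n. c j = 0) \<and> (\<forall>j<q. d j = 0)"
    if z: "\<And>i. \<phi> ((T ^^ i) (cyc n x c + cyc q y' d)) = 0" "\<And>i. \<mu> ((T ^^ i) (cyc n x c + cyc q y' d)) = 0" for c d
  proof
    show c: "\<forall>j<n. c j = 0" using z(1) phi_cy by (intro ind_x) (simp add: f.add)
    then have "cyc n x c = 0" by (simp add: cyc_zero)
    then show "\<forall>j<q. d j = 0" using z(2) by (intro ind_y) simp
  qed
  have "block (Bipicket n q) C AC"
  proof -
    have "\<forall>c d. cyc n x c + cyc q y' d = 0 \<longrightarrow> (\<forall>j<n. c j = 0) \<and> (\<forall>j<q. d j = 0)"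
      using ind by (metis f.zero m.zero pow_simps(4))
    then show ?thesis
      unfolding block.simps C_def AC_def a1_def using n(1,2) Tn Ty' by blast
  qed
  moreover have "B = {z + y |z y. z \<in> C \<and> y \<in> B'}"
  proof (intro set_eqI iffI)
    fix b assume b: "b \<in> B"
    obtain c where c: "\<And>i. \<phi> ((T ^^ i) (b - cyc n x c)) = 0"
      using cyc_project[OF \<phi>(1) Tn \<phi>(2) phi0[OF b]] by blast
    have b1: "b - cyc n x c \<in> B" using b cyc_in[OF B x] B(1) by (auto intro: subspace_diff)
    obtain d where d: "\<And>i. \<mu> ((T ^^ i) (b - cyc n x c - cyc q y' d)) = 0"
      using cyc_project[OF \<mu>(1) Ty' mu_y' mu0[OF b1]] by blast
    have "\<phi> ((T ^^ i) (b - cyc n x c - cyc q y' d)) = 0" for i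
      using c[of i] phi_cy[of i d] pow_simps(2)[of i "b - cyc n x c"] by (simp only: f.diff)  simp
    then have "b - cyc n x c - cyc q y' d \<in> B'" unfolding B'_def using d b1 cyc_in[OF B y'B] B(1)
      by (auto intro: subspace_diff)
    moreover have "b = (cyc n x c + cyc q y' d) + (b - cyc n x c - cyc q y' d)" by simp
    ultimately show "b \<in> {z + y |z y. z \<in> C \<and> y \<in> B'}" unfolding C_def by blast
  next
    fix b assume "b \<in> {z + y |z y. z \<in> C \<and> y \<in> B'}"
    then show "b \<in> B" unfolding B'_def C_def using cyc_in[OF B x] cyc_in[OF B y'B] B(1) by (auto intro!: subspace_add)
  qed
  moreover have "C \<inter> B' = {0}"
  proof (intro set_eqI iffI)
    fix b assume "b \<in> C \<inter> B'"
    then obtain c d where c: "b = cyc n x c + cyc q y' d" and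
      z: "\<And>i. \<phi> ((T ^^ i) (cyc n x c + cyc q y' d)) = 0" "\<And>i. \<mu> ((T ^^ i) (cyc n x c + cyc q y' d)) = 0"
      unfolding B'_def C_def by blast
    show "b \<in> {0}" using ind[OF z] c by (simp add: cyc_zero)
  next
    fix b assume "b \<in> {0::'b}"
    moreover have "0 = cyc n x (\<lambda>_. 0) + cyc q y' (\<lambda>_. 0)" by (simp add: cyc_zero)
    ultimately show "b \<in> C \<inter> B'" using subspace_0[OF sB'] unfolding C_def by blast
  qed
  moreover have AC_A: "z \<in> A" if "z \<in> AC" for z
    using that a1 xA A(1) unfolding AC_def by (auto intro!: subspace_add subspace_scale)
  have "A = {z + y |z y. z \<in> AC \<and> y \<in> A \<inter> B'}"
  proof (intro set_eqI iffI)
    fix a assume a: "a \<in> A"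
    \<comment> \<open>The scalars are forced by requiring \<phi> to vanish on \<open>T a'\<close>
      and on \<open>a'\<close>. The conditions for \<mu> follow, since \<mu> is \<phi> after
      \<open>T\<close> on \<open>A\<close> and T^2 kills \<open>A\<close>.\<close>
    define s where "s = \<phi> (T a)"
    define t where "t = \<phi> (a - s *s a1)"
    define z where "z = s *s a1 + t *s (T ^^ (n - 1)) x"
    define a' where "a' = a - z"
    have TT: "T ((T ^^ (n - 1)) x) = 0" using Tn unfolding T1 .
    have z: "z \<in> AC" unfolding AC_def z_def by blast
    have a'A: "a' \<in> A" unfolding a'_def using a AC_A[OF z] A(1) by (auto intro: subspace_diff)
    have p0: "\<phi> a' = 0" unfolding a'_def z_def t_def f.diff f.add f.scale \<phi>(2) by simp
    have p1: "\<phi> (T a') = 0" unfolding a'_def z_def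
        T_simps Ta1 TT s_def f.diff f.add f.scale \<phi>(2) by (simp add: f.zero)
    have pow2: "(T ^^ i) a' = 0" if "2 \<le> i" for i
      using pow_zero[of 2 a' i] A(3)[OF a'A] that by (simp add: numeral_2_eq_2)
    have "\<phi> ((T ^^ i) a') = 0" for i
    proof -
      consider "i = 0" | "i = 1" | "2 \<le> i" by linarith
      then show ?thesis by cases (use p0 p1 pow2 f.zero in auto)
    qed
    moreover have "\<mu> ((T ^^ i) a') = 0" for i
    proof -
      have m0: "\<mu> a' = 0" using \<mu>(3)[OF a'A] p1 by simp
      have m1: "\<mu> (T a') = 0" using \<mu>(3)[of "T a'"] A(3)[OF a'A] f.zero by simp
      consider "i = 0" | "i = 1" | "2 \<le> i" by linarith
      then show ?thesis by cases (use m0 m1 pow2 m.zero in auto)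
    qed
    ultimately have "a' \<in> A \<inter> B'" using a'A A(2) unfolding B'_def by auto
    moreover have "a = z + a'" by (simp add: a'_def)
    ultimately show "a \<in> {z + y |z y. z \<in> AC \<and> y \<in> A \<inter> B'}" using z by blast
  next
    fix a assume "a \<in> {z + y |z y. z \<in> AC \<and> y \<in> A \<inter> B'}"
    then show "a \<in> A" using AC_A A(1) by (auto intro: subspace_add)
  qed
  ultimately show ?thesis unfolding splits_off_def using sB' tB' by blast
qed

end

text \<open>The vectors used later are arbitrary functions on pairs of numbers, an
  infinite-dimensional space, so finiteness is recorded for each subspace.\<close>

definition findim :: "('a::field \<Rightarrow> 'b::ab_group_add \<Rightarrow> 'b) \<Rightarrow> 'b set \<Rightarrow> bool" where
  "findim scale S \<longleftrightarrow> (\<exists>F. finite F \<and> S \<subseteq> module.span scale F)"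

section \<open>Dimension formulas for finite-dimensional subspaces\<close>

context vector_space begin

lemma findim_subset: "findim scale S \<Longrightarrow> R \<subseteq> S \<Longrightarrow> findim scale R"
  unfolding findim_def by blast

lemma findim_independent: "findim scale S \<Longrightarrow> E \<subseteq> S \<Longrightarrow> independent E \<Longrightarrow> finite E"
  unfolding findim_def using independent_span_bound by (meson subset_trans)

lemma findim_basis:
  assumes "findim scale S"
  obtains E where "E \<subseteq> S" "independent E" "S \<subseteq> span E" "finite E" "card E = dim S"
  using basis_exists[of S] findim_independent[OF assms] by metis

lemma independent_union:
  assumes S: "subspace S1" "subspace S2" "S1 \<inter> S2 = {0}"
    and E: "E1 \<subseteq> S1" "E2 \<subseteq> S2" "independent E1" "independent E2" "finite E1" "finite E2"
  shows "independent (E1 \<union> E2)" "E1 \<inter> E2 = {}"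
proof -
  have "0 \<notin> E1" using E(3) dependent_zero by blast
  moreover have "E1 \<inter> E2 \<subseteq> {0}" using S(3) E(1,2) by auto
  ultimately show disj: "E1 \<inter> E2 = {}" by auto
  show "independent (E1 \<union> E2)"
  proof (rule independent_if_scalars_zero)
    fix f x assume 0: "(\<Sum>x\<in>E1 \<union> E2. scale (f x) x) = 0" and x: "x \<in> E1 \<union> E2"
    define s where "s = (\<Sum>x\<in>E1. scale (f x) x)"
    define t where "t = (\<Sum>x\<in>E2. scale (f x) x)"
    have "s + t = 0" using 0 disj E(5,6) unfolding s_def t_def by (simp add: sum.union_disjoint)
    then have st: "s = - t" by (simp add: eq_neg_iff_add_eq_0)
    have "s \<in> S1" "t \<in> S2" unfolding s_def t_def using S E by (auto intro!: subspace_sum subspace_scale)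
    then have "s \<in> S1 \<inter> S2" using S(2) st by (simp add: subspace_neg)
    then have "s = 0" "t = 0" using S(3) st by auto
    then show "f x = 0" using independentD[OF E(3,5) order_refl, of f x]
        independentD[OF E(4,6) order_refl, of f x] x unfolding s_def t_def by auto
  qed (use E in auto)
qed

lemma dim_direct_sum:
  assumes S: "subspace S1" "subspace S2" "S1 \<inter> S2 = {0}" and fin: "findim scale S1" "findim scale S2"
  shows "dim {x + y |x y. x \<in> S1 \<and> y \<in> S2} = dim S1 + dim S2"
proof -
  obtain E1 where E1: "E1 \<subseteq> S1" "independent E1" "S1 \<subseteq> span E1" "finite E1" "card E1 = dim S1"
    using findim_basis[OF fin(1)] .
  obtain E2 where E2: "E2 \<subseteq> S2" "independent E2" "S2 \<subseteq> span E2" "finite E2" "card E2 = dim S2"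
    using findim_basis[OF fin(2)] .
  have "span E1 = S1" "span E2 = S2" using E1 E2 S span_subspace by auto
  then have eq: "{x + y |x y. x \<in> S1 \<and> y \<in> S2} = span (E1 \<union> E2)" by (simp add: span_Un)
  note u = independent_union[OF S E1(1) E2(1) E1(2) E2(2) E1(4) E2(4)]
  show ?thesis unfolding eq using dim_span_eq_card_independent[OF u(1)] u(2) E1 E2
    by (simp add: card_Un_disjoint)
qed

lemma dim_strict_subspace:
  assumes S: "subspace S" "S \<subset> R" and fin: "findim scale R"
  shows "dim S < dim R"
proof -
  obtain E where E: "E \<subseteq> S" "independent E" "S \<subseteq> span E" "finite E" "card E = dim S"
    using findim_basis[OF findim_subset[OF fin]] S(2) by blast
  obtain E' where E': "E \<subseteq> E'" "E' \<subseteq> R" "independent E'" "R \<subseteq> span E'"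
    using maximal_independent_subset_extend[of E R] E S(2) by blast
  have "E \<noteq> E'"
  proof
    assume "E = E'"
    then have "R \<subseteq> S" using E' E(1) S(1) span_minimal by blast
    then show False using S(2) by blast
  qed
  moreover have "finite E'" using findim_independent[OF fin E'(2,3)] .
  ultimately have "card E < card E'" using E'(1) by (intro psubset_card_mono) auto
  then show ?thesis using basis_card_eq_dim[OF E'(2,4,3)] E(5) by simp
qed

lemma dim_single: "a \<noteq> 0 \<Longrightarrow> dim {scale t a |t. True} = 1"
proof -
  assume "a \<noteq> 0"
  then have "independent {a}" by simp
  then have "dim (span {a}) = 1" using dim_span_eq_card_independent by fastforce
  moreover have "span {a} = {scale t a |t. True}" by (auto simp: span_singleton)
  ultimately show ?thesis by simp
qed

lemma dim_zero: "dim {0} = 0"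
  using dim_eq_card[OF _ independent_empty, of "{0}"] by simp

end

lemma (in vector_space_pair) rank_nullity:
  assumes f: "Vector_Spaces.linear s1 s2 f" and S: "vs1.subspace S" "findim s1 S"
  shows "vs1.dim S = vs2.dim (f ` S) + vs1.dim {x \<in> S. f x = 0}"
proof -
  interpret f: Vector_Spaces.linear s1 s2 f by (fact f)
  define K where "K = {x \<in> S. f x = 0}"
  have K: "vs1.subspace K" "K \<subseteq> S" unfolding K_def using S(1)
    by (auto simp: vs1.subspace_def f.add f.scale f.zero)
  obtain E where E: "E \<subseteq> K" "vs1.independent E" "K \<subseteq> vs1.span E" "finite E" "card E = vs1.dim K"
    using vs1.findim_basis[OF vs1.findim_subset[OF S(2) K(2)]] .
  obtain E' where E': "E \<subseteq> E'" "E' \<subseteq> S" "vs1.independent E'" "S \<subseteq> vs1.span E'"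
    using vs1.maximal_independent_subset_extend[of E S] E K(2) by (metis subset_trans)
  have fin: "finite E'" using vs1.findim_independent[OF S(2) E'(2,3)] .
  define C where "C = E' - E"
  interpret p: vector_space_pair s1 s1 by unfold_locales
  \<comment> \<open>A projection fixing \<open>C\<close> and killing \<open>E\<close> separates the span of \<open>C\<close> from the kernel.\<close>
  obtain g where g: "Vector_Spaces.linear s1 s1 g" "\<forall>x\<in>E'. g x = (if x \<in> C then x else 0)"
    using p.linear_independent_extend[OF E'(3), of "\<lambda>x. if x \<in> C then x else 0"] by blast
  have gC: "g x = x" if "x \<in> vs1.span C" for x
    using p.linear_eq_on[OF g(1) vs1.linear_ident that] g(2) by (auto simp: C_def)
  have gE: "g x = 0" if "x \<in> vs1.span E" for x
  proof (rule p.linear_eq_0_on_span[OF g(1) _ that])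
    show "g e = 0" if "e \<in> E" for e using g(2) E'(1) that by (auto simp: C_def)
  qed
  have SE: "vs1.span E' = S" using vs1.span_subspace[OF E'(2,4) S(1)] .
  have ker0: "x = 0" if "x \<in> vs1.span C" "f x = 0" for x
  proof -
    have "x \<in> S" using that(1) SE vs1.span_mono[of C E'] by (auto simp: C_def)
    then have "x \<in> vs1.span E" using that(2) E(3) unfolding K_def by blast
    then show ?thesis using gC[OF that(1)] gE by simp
  qed
  have inj: "inj_on f (vs1.span C)"
  proof (rule inj_onI)
    fix x y assume xy: "x \<in> vs1.span C" "y \<in> vs1.span C" "f x = f y"
    then have "x - y = 0" by (intro ker0) (auto simp: vs1.span_diff f.diff)
    then show "x = y" by simp
  qed
  have indC: "vs1.independent C" using vs1.independent_mono[OF E'(3)] by (auto simp: C_def)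
  have ind: "vs2.independent (f ` C)" using f.independent_injective_image[OF indC inj] .
  have "f ` S = vs2.span (f ` E')" using f.span_image[of E'] SE by simp
  also have "\<dots> = vs2.span (f ` C)"
  proof -
    have "f ` E' \<subseteq> insert 0 (f ` C)" using E(1) unfolding C_def K_def by auto
    then have "vs2.span (f ` E') \<subseteq> vs2.span (f ` C)" using vs2.span_mono vs2.span_insert_0 by metis
    moreover have "vs2.span (f ` C) \<subseteq> vs2.span (f ` E')" by (intro vs2.span_mono) (auto simp: C_def)
    ultimately show ?thesis by blast
  qed
  finally have "vs2.dim (f ` S) = card (f ` C)" using vs2.dim_span_eq_card_independent[OF ind] by simp
  also have "\<dots> = card C" using inj vs1.span_superset by (intro card_image) (auto intro: inj_on_subset)
  finally have "vs2.dim (f ` S) = card E' - card E"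
    using E'(1) E(4) by (simp add: C_def card_Diff_subset)
  moreover have "card E \<le> card E'" using E'(1) fin by (rule card_mono[rotated])
  moreover have "vs1.dim S = card E'" using vs1.basis_card_eq_dim[OF E'(2,4,3)] by simp
  ultimately show ?thesis using E(5) by (simp add: K_def)
qed

section \<open>Existence of a decomposition\<close>

context operator_space begin

definition sub_pair :: "'b set \<Rightarrow> 'b set \<Rightarrow> bool" where
  "sub_pair B A \<longleftrightarrow> subspace B \<and> T ` B \<subseteq> B \<and> subspace A \<and> A \<subseteq> B \<and> (\<forall>a\<in>A. T a \<in> A \<and> T (T a) = 0)"

lemma subspace_pow_image: "subspace S \<Longrightarrow> subspace ((T ^^ n) ` S)"
proof -
  interpret l: Vector_Spaces.linear scale scale "T ^^ n" by (rule linear_pow)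
  show "subspace S \<Longrightarrow> subspace ((T ^^ n) ` S)" by (rule l.subspace_image)
qed

lemma subspace_T_image: "subspace S \<Longrightarrow> subspace (T ` S)"
  using subspace_pow_image[of S 1] by simp

text \<open>The position of T^(n-1) B, with \<open>n\<close> the nilpotency index, decides the type.
  An element outside \<open>A\<close> gives a picket with \<open>l = 0\<close>; one in
  \<open>A\<close> but not in T A gives \<open>l = 1\<close>. If T^(n-1) B lies in T A, the largest
  \<open>q\<close> is taken for which \<open>A\<close> contains some T^(n-2) x + T^(q-1) y with T^q
  y = 0 and T^(n-1) x non-zero; \<open>q = n - 1\<close> gives a picket with \<open>l = 2\<close>,
  and a smaller \<open>q\<close> a bipicket.\<close>

lemma exists_splits_off:
  assumes "sub_pair B A" and B0: "B \<noteq> {0}" and nil: "\<exists>n. \<forall>b\<in>B. (T ^^ n) b = 0"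
  shows "\<exists>s. splits_off s B A"
proof -
  have B: "subspace B" "T ` B \<subseteq> B" and A: "subspace A" "A \<subseteq> B" "\<And>a. a \<in> A \<Longrightarrow> T a \<in> A \<and> T (T a) = 0" "T ` A \<subseteq> A"
    using assms(1) unfolding sub_pair_def by auto
  define n where "n = (LEAST n. \<forall>b\<in>B. (T ^^ n) b = 0)"
  have n: "\<And>b. b \<in> B \<Longrightarrow> (T ^^ n) b = 0" using LeastI_ex[OF nil] unfolding n_def by blast
  obtain b where "b \<in> B" "b \<noteq> 0" using B0 subspace_0[OF B(1)] by blast
  then have n1: "1 \<le> n" using n[of b] by (cases n) auto
  have "\<not> (\<forall>b\<in>B. (T ^^ m) b = 0)" if "m < n" for m
    using not_less_Least[of m "\<lambda>n. \<forall>b\<in>B. (T ^^ n) b = 0"] that unfolding n_def by blast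
  then have "\<not> (\<forall>b\<in>B. (T ^^ (n - 1)) b = 0)" using n1 by simp
  then obtain x0 where x0: "x0 \<in> B" "(T ^^ (n - 1)) x0 \<noteq> 0" by blast
  have TA: "subspace (T ` A)"
    using subspace_T_image[OF A(1)] .
  consider (1) x where "x \<in> B" "(T ^^ (n - 1)) x \<notin> A"
    | (2) x where "x \<in> B" "(T ^^ (n - 1)) x \<in> A" "(T ^^ (n - 1)) x \<notin> T ` A"
    | (3) "\<And>x. x \<in> B \<Longrightarrow> (T ^^ (n - 1)) x \<in> T ` A"
    by blast
  then show ?thesis
  proof cases
    case 1
    obtain \<phi> where \<phi>: "Vector_Spaces.linear scale (*) \<phi>" "\<phi> ((T ^^ (n - 1)) x) = 1" "\<And>a. a \<in> A \<Longrightarrow> \<phi> a = 0"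
      using exists_functional[OF A(1) 1(2)] by metis
    have "splits_off (Picket 0 n) B A"
      by (rule picket_splits_off[OF B A(1,2,4) n1 _ _ n 1(1) _ \<phi>(1,2)])
        (use n[OF 1(1)] subspace_0[OF A(1)] \<phi>(3) pow_in[OF A(4)] in auto)
    then show ?thesis by blast
  next
    case 2
    obtain \<phi> where \<phi>: "Vector_Spaces.linear scale (*) \<phi>" "\<phi> ((T ^^ (n - 1)) x) = 1" "\<And>a. a \<in> T ` A \<Longrightarrow> \<phi> a = 0"
      using exists_functional[OF TA 2(3)] by metis
    have "\<phi> ((T ^^ i) a) = 0" if "a \<in> A" "1 \<le> i" for a i
    proof -
      have "(T ^^ i) a = T ((T ^^ (i - 1)) a)" using that(2) by (cases i) auto
      then show ?thesis using pow_in[OF A(4) that(1)] by (intro \<phi>(3)) auto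
    qed
    then have "splits_off (Picket 1 n) B A"
      by (intro picket_splits_off[OF B A(1,2,4) n1 n1 _ n 2(1) 2(2) \<phi>(1,2)]) auto
    then show ?thesis by blast
  next
    case 3
    define P where "P q \<longleftrightarrow> 1 \<le> q \<and> q \<le> n - 1 \<and> (\<exists>x\<in>B. \<exists>y\<in>B. (T ^^ (n - 2)) x + (T ^^ (q - 1)) y \<in> A \<and>
      (T ^^ (n - 1)) x \<noteq> 0 \<and> (T ^^ q) y = 0)" for q
    obtain a0 where a0: "a0 \<in> A" "T a0 = (T ^^ (n - 1)) x0" using 3[OF x0(1)] by auto
    have n2: "2 \<le> n"
    proof (rule ccontr)
      assume "\<not> 2 \<le> n"
      then have "n = 1" using n1 by simp
      then have "T a0 = 0" using n a0(1) A(2) by auto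
      then show False using a0 x0 by simp
    qed
    have n3: "Suc (n - 2) = n - 1" "Suc (n - 1) = n" using n2 by auto
    have T1: "T ((T ^^ (n - 2)) z) = (T ^^ (n - 1)) z" for z unfolding T_pow n3 ..
    have y0: "a0 - (T ^^ (n - 2)) x0 \<in> B" "T (a0 - (T ^^ (n - 2)) x0) = 0"
      using a0 A(2) B x0(1) pow_in[OF B(2)] unfolding T_simps T1 by (auto intro: subspace_diff)
    have "P 1" unfolding P_def using n2 a0(1) x0 y0
      by (intro conjI bexI[of _ x0] bexI[of _ "a0 - (T ^^ (n - 2)) x0"]) auto
    then have ex: "\<exists>q. P q" by blast
    have bd: "\<forall>q. P q \<longrightarrow> q \<le> n - 1" by (simp add: P_def)
    define q where "q = (GREATEST q. P q)"
    have q: "P q" and q_max: "\<And>q'. P q' \<Longrightarrow> q' \<le> q"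
      using GreatestI_ex_nat[OF ex] Greatest_le_nat[of P] bd unfolding q_def by blast+
    obtain x y where xy: "x \<in> B" "y \<in> B" "(T ^^ (n - 2)) x + (T ^^ (q - 1)) y \<in> A"
      "(T ^^ (n - 1)) x \<noteq> 0" "(T ^^ q) y = 0" and q1: "1 \<le> q" "q \<le> n - 1"
      using q unfolding P_def by blast
    have q3: "Suc (q - 1) = q" using q1 by simp
    have Ta: "T ((T ^^ (n - 2)) x + (T ^^ (q - 1)) y) = (T ^^ (n - 1)) x"
      unfolding T_simps T1 unfolding T_pow q3 xy(5) by simp
    show ?thesis
    proof (cases "q = n - 1")
      case True
      \<comment> \<open>Both exponents are now \<open>n - 2\<close>, so the sum of the two vectors
        generates a single cyclic summand.\<close>
      define x' where "x' = x + y"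
      have q': "q - 1 = n - 2" using True by simp
      have x': "x' \<in> B" "(T ^^ (n - 2)) x' \<in> A" "(T ^^ (n - 1)) x' \<noteq> 0"
        using xy B(1) True unfolding x'_def q' by (auto intro: subspace_add)
      obtain \<phi> where \<phi>: "Vector_Spaces.linear scale (*) \<phi>" "\<phi> ((T ^^ (n - 1)) x') = 1"
        using exists_functional[OF subspace_single_0] x'(3) by (metis singletonD)
      interpret f: Vector_Spaces.linear scale "(*)" \<phi> by (fact \<phi>)
      have "\<phi> ((T ^^ i) a) = 0" if "a \<in> A" "2 \<le> i" for a i
        using pow_zero[of 2 a i] A(3)[OF that(1)] that(2) by (simp add: numeral_2_eq_2 f.zero)
      then have "splits_off (Picket 2 n) B A"
        by (intro picket_splits_off[OF B A(1,2,4) n1 n2 _ n x'(1,2) \<phi>]) auto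
      then show ?thesis by blast
    next
      case False
      then have qn: "q + 2 \<le> n" using q1 by simp
      define S where "S = (T ^^ q) ` B"
      have S: "subspace S" unfolding S_def using subspace_pow_image[OF B(1)] .
      have TAS: "subspace (T ` (A \<inter> S))"
        using subspace_T_image[OF subspace_inter[OF A(1) S]] .
      \<comment> \<open>Here maximality of \<open>q\<close> enters: if T^(n-1) x came from an
        element T^q z of \<open>A\<close>, then replacing \<open>y\<close> by z - T^(n-2-q) x would
        satisfy the condition for \<open>q + 1\<close>.\<close>
      have "(T ^^ (n - 1)) x \<notin> T ` (A \<inter> S)"
      proof
        assume "(T ^^ (n - 1)) x \<in> T ` (A \<inter> S)"
        then obtain z where z: "z \<in> B" "(T ^^ q) z \<in> A" "(T ^^ (n - 1)) x = T ((T ^^ q) z)"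
          unfolding S_def by auto
        define y' where "y' = z - (T ^^ (n - 2 - q)) x"
        have "(T ^^ q) ((T ^^ (n - 2 - q)) x) = (T ^^ (n - 2)) x" using qn by (simp add: pow_pow)
        then have e: "(T ^^ (n - 2)) x + (T ^^ q) y' = (T ^^ q) z" unfolding y'_def pow_simps by simp
        have y'B: "y' \<in> B" unfolding y'_def using z(1) xy(1) pow_in[OF B(2)] B(1) by (auto intro: subspace_diff)
        have "(T ^^ Suc q) y' = T ((T ^^ q) z) - T ((T ^^ (n - 2)) x)"
          unfolding e[symmetric] T_simps by simp
        then have "(T ^^ Suc q) y' = 0" using z(3) unfolding T1 by simp
        then have "P (Suc q)" unfolding P_def using qn xy(1,4) y'B e z(2)
          by (intro conjI bexI[of _ x] bexI[of _ y']) auto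
        then show False using q_max by force
      qed
      then obtain \<phi> where \<phi>: "Vector_Spaces.linear scale (*) \<phi>" "\<phi> ((T ^^ (n - 1)) x) = 1"
        "\<And>a. a \<in> T ` (A \<inter> S) \<Longrightarrow> \<phi> a = 0"
        using exists_functional[OF TAS] by metis
      \<comment> \<open>Since \<phi> vanishes on the image under \<open>T\<close> of the elements of
        \<open>A\<close> in \<open>S\<close>, its composite with \<open>T\<close> vanishes on those
        elements; so it can be changed outside \<open>A\<close> to vanish on all of
        \<open>S\<close>.\<close>
      have "Vector_Spaces.linear scale (*) (\<phi> \<circ> T)"
        using Vector_Spaces.linear_compose[OF linear_T \<phi>(1)] .
      then obtain \<mu> where \<mu>: "Vector_Spaces.linear scale (*) \<mu>" "\<And>x. x \<in> S \<Longrightarrow> \<mu> x = 0" "\<And>a. a \<in> A \<Longrightarrow> \<mu> a = \<phi> (T a)"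
        using functional_ext[OF S A(1), of "\<phi> \<circ> T"] \<phi>(3) by auto
      have "\<mu> ((T ^^ q) b) = 0" if "b \<in> B" for b using \<mu>(2) that unfolding S_def by blast
      then have "splits_off (Bipicket n q) B A"
        by (intro bipicket_splits_off[OF B A(1-3) q1(1) qn n xy(1,2,5,3) \<phi>(1,2) \<mu>(1) _ \<mu>(3)]) auto
      then show ?thesis by blast
    qed
  qed
qed

end

context operator_space begin

lemma subspace_range_cyc: "subspace (range (cyc n x))"
proof (rule subspaceI)
  have "cyc n x (\<lambda>_. 0) = 0" by (simp add: cyc_zero)
  then show "0 \<in> range (cyc n x)" by (metis rangeI)
qed (auto simp: cyc_add cyc_scale)

lemma T_range_cyc: "(T ^^ n) x = 0 \<Longrightarrow> T ` range (cyc n x) \<subseteq> range (cyc n x)"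
  using cyc_T by auto

lemma block_sub_pair:
  assumes "block s C AC"
  shows "sub_pair C AC" "C \<noteq> {0}" "valid_summand s"
proof -
  have "sub_pair C AC \<and> C \<noteq> {0}"
  proof (cases s)
    case (Picket l n)
    then obtain x where x: "(T ^^ n) x = 0" "\<forall>c. cyc n x c = 0 \<longrightarrow> (\<forall>j<n. c j = 0)"
      "C = range (cyc n x)" "AC = {cyc n x c |c. \<forall>j<n - l. c j = 0}" and n: "1 \<le> n" "l \<le> n" "l \<le> 2"
      using assms by auto
    have "subspace AC"
    proof (rule subspaceI)
      have "cyc n x (\<lambda>_. 0) = 0" by (simp add: cyc_zero)
      then show "0 \<in> AC" unfolding x(4) by force
    next
      fix a b assume "a \<in> AC" "b \<in> AC"
      then obtain c d where "a = cyc n x c" "b = cyc n x d" "\<forall>j<n - l. c j = 0" "\<forall>j<n - l. d j = 0" unfolding x(4) by blast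
      then show "a + b \<in> AC" unfolding x(4) by (auto simp: cyc_add)
    next
      fix a t assume "a \<in> AC"
      then obtain c where "a = cyc n x c" "\<forall>j<n - l. c j = 0" unfolding x(4) by blast
      then show "t *s a \<in> AC" unfolding x(4) by (auto simp: cyc_scale)
    qed
    moreover have "T a \<in> AC \<and> T (T a) = 0" if a: "a \<in> AC" for a
    proof
      obtain c where c: "a = cyc n x c" "\<forall>j<n - l. c j = 0" using a unfolding x(4) by blast
      show "T a \<in> AC" unfolding x(4) c(1) cyc_T[OF x(1)] using c(2) by auto
      have "(T ^^ 2) a = 0" unfolding c(1) cyc_pow[OF x(1)] using c(2) n by (intro cyc_zero) auto
      then show "T (T a) = 0" by (simp add: numeral_2_eq_2)
    qed
    moreover have "AC \<subseteq> C" unfolding x(3,4) by auto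
    moreover have "C \<noteq> {0}"
    proof
      assume "C = {0}"
      then have "cyc n x (\<lambda>_. 1) = 0" using x(3) by blast
      then show False using x(2) n(1) by (metis less_le_trans one_neq_zero zero_less_one)
    qed
    ultimately show ?thesis unfolding sub_pair_def x(3)
      using subspace_range_cyc T_range_cyc[OF x(1)] by blast
  next
    case (Bipicket n q)
    then obtain x y where x: "(T ^^ n) x = 0" "(T ^^ q) y = 0"
      "\<forall>c d. cyc n x c + cyc q y d = 0 \<longrightarrow> (\<forall>j<n. c j = 0) \<and> (\<forall>j<q. d j = 0)"
      and C: "C = {cyc n x c + cyc q y d |c d. True}"
      and AC: "AC = {s *s ((T ^^ (n - 2)) x + (T ^^ (q - 1)) y) + t *s (T ^^ (n - 1)) x |s t. True}"
      and n: "1 \<le> q" "q + 2 \<le> n"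
      using assms by auto
    have n3: "Suc (n - 2) = n - 1" "Suc (n - 1) = n" "Suc (q - 1) = q" using n by auto
    have T1: "T ((T ^^ (n - 2)) z) = (T ^^ (n - 1)) z" "T ((T ^^ (n - 1)) z) = (T ^^ n) z"
      "T ((T ^^ (q - 1)) z) = (T ^^ q) z" for z unfolding T_pow n3 by (rule refl)+
    define a0 where "a0 = (T ^^ (n - 2)) x + (T ^^ (q - 1)) y"
    define a1 where "a1 = (T ^^ (n - 1)) x"
    have Ta: "T a0 = a1" "T a1 = 0" unfolding a0_def a1_def T_simps T1 x by simp_all
    have AC': "AC = {s *s a0 + t *s a1 |s t. True}" unfolding AC a0_def a1_def ..
    have C': "C = {a + b |a b. a \<in> range (cyc n x) \<and> b \<in> range (cyc q y)}" unfolding C by auto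
    have sC: "subspace C" unfolding C' by (intro subspace_sums subspace_range_cyc)
    have TC: "T ` C \<subseteq> C"
    proof
      fix z assume "z \<in> T ` C"
      then obtain c d where "z = T (cyc n x c) + T (cyc q y d)" unfolding C by auto
      then show "z \<in> C" unfolding C cyc_T[OF x(1)] cyc_T[OF x(2)] by auto
    qed
    have sA: "subspace AC"
    proof (rule subspaceI)
      have "0 = 0 *s a0 + 0 *s a1" by simp
      then show "0 \<in> AC" unfolding AC' by blast
    next
      fix a b assume "a \<in> AC" "b \<in> AC"
      then obtain s t s' t' where "a = s *s a0 + t *s a1" "b = s' *s a0 + t' *s a1" unfolding AC' by blast
      then have "a + b = (s + s') *s a0 + (t + t') *s a1" by (simp add: scale_left_distrib)
      then show "a + b \<in> AC" unfolding AC' by blast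
    next
      fix a r assume "a \<in> AC"
      then obtain s t where "a = s *s a0 + t *s a1" unfolding AC' by blast
      then have "r *s a = (r * s) *s a0 + (r * t) *s a1" by (simp add: scale_right_distrib)
      then show "r *s a \<in> AC" unfolding AC' by blast
    qed
    have TA: "T a \<in> AC \<and> T (T a) = 0" if a: "a \<in> AC" for a
    proof
      obtain s t where st: "a = s *s a0 + t *s a1" using a unfolding AC' by blast
      have "T a = 0 *s a0 + s *s a1" unfolding st T_simps Ta by simp
      then show "T a \<in> AC" unfolding AC' by blast
      show "T (T a) = 0" unfolding st T_simps Ta by (simp add: Ta)
    qed
    have xC: "x \<in> C" "y \<in> C"
    proof -
      have "x = cyc n x (\<lambda>j. if j = 0 then 1 else 0) + cyc q y (\<lambda>_. 0)"
        using n cyc_single[of 0 n x 1] by (simp add: cyc_zero)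
      then show "x \<in> C" unfolding C by blast
      have "y = cyc n x (\<lambda>_. 0) + cyc q y (\<lambda>j. if j = 0 then 1 else 0)"
        using n cyc_single[of 0 q y 1] by (simp add: cyc_zero)
      then show "y \<in> C" unfolding C by blast
    qed
    have "a0 \<in> C" "a1 \<in> C" unfolding a0_def a1_def using pow_in[OF TC] xC sC by (auto intro: subspace_add)
    then have "AC \<subseteq> C" unfolding AC' using sC by (auto intro!: subspace_add subspace_scale)
    moreover have "C \<noteq> {0}"
    proof
      assume "C = {0}"
      then have "cyc n x (\<lambda>_. 1) + cyc q y (\<lambda>_. 0) = 0" using C by blast
      then have "(1::'a) = 0" using x(3) n(2) by (metis add_2_eq_Suc' zero_less_Suc less_le_trans)
      then show False by simp
    qed
    ultimately show ?thesis unfolding sub_pair_def using sC TC sA TA by blast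
  qed
  then show "sub_pair C AC" "C \<noteq> {0}" by auto
  show "valid_summand s" using assms by (cases s) auto
qed

fun decomposition :: "summand list \<Rightarrow> 'b set \<Rightarrow> 'b set \<Rightarrow> bool" where
  "decomposition [] B A \<longleftrightarrow> B = {0} \<and> A = {0}"
| "decomposition (s # L) B A \<longleftrightarrow> (\<exists>C AC B' A'. block s C AC \<and> decomposition L B' A' \<and> sub_pair B' A' \<and>
     B = {x + y |x y. x \<in> C \<and> y \<in> B'} \<and> C \<inter> B' = {0} \<and> A = {x + y |x y. x \<in> AC \<and> y \<in> A'})"

theorem exists_decomposition:
  assumes "sub_pair B A" "findim scale B" "\<exists>n. \<forall>b\<in>B. (T ^^ n) b = 0"
  shows "\<exists>L. decomposition L B A \<and> (\<forall>s\<in>set L. valid_summand s)"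
  using assms
proof (induction "dim B" arbitrary: B A rule: less_induct)
  case less
  show ?case
  proof (cases "B = {0}")
    case True
    then have "A = {0}" using less.prems(1) subspace_0 unfolding sub_pair_def by blast
    then show ?thesis using True by (intro exI[of _ "[]"]) simp
  next
    case False
    obtain s where "splits_off s B A" using exists_splits_off[OF less.prems(1) False less.prems(3)] by blast
    then obtain C AC B' where s: "block s C AC" "subspace B'" "T ` B' \<subseteq> B'"
      "B = {x + y |x y. x \<in> C \<and> y \<in> B'}" "C \<inter> B' = {0}" "A = {x + y |x y. x \<in> AC \<and> y \<in> A \<inter> B'}"
      unfolding splits_off_def by blast
    note C = block_sub_pair[OF s(1)]
    have C0: "subspace C" using C(1) by (simp add: sub_pair_def)
    have B': "B' \<subseteq> B"
    proof
      fix b assume "b \<in> B'"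
      then have "b = 0 + b" "0 \<in> C" "b \<in> B'" using subspace_0[OF C0] by auto
      then show "b \<in> B" unfolding s(4) by blast
    qed
    have sp: "sub_pair B' (A \<inter> B')"
      using less.prems(1) s(2,3) unfolding sub_pair_def by (auto intro: subspace_inter)
    have "B' \<noteq> B"
    proof
      assume "B' = B"
      have "C \<subseteq> B"
      proof
        fix c assume "c \<in> C"
        then have "c = c + 0" "c \<in> C" "0 \<in> B'" using subspace_0[OF s(2)] by auto
        then show "c \<in> B" unfolding s(4) by blast
      qed
      then show False using s(5) \<open>B' = B\<close> C(2) by blast
    qed
    then have "dim B' < dim B" using dim_strict_subspace[OF s(2) _ less.prems(2)] B' by blast
    then obtain L where L: "decomposition L B' (A \<inter> B')" "\<forall>s\<in>set L. valid_summand s"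
      using less.hyps[OF _ sp findim_subset[OF less.prems(2) B']] less.prems(3) B' by blast
    have "decomposition (s # L) B A" unfolding decomposition.simps
      by (intro exI[of _ C] exI[of _ AC] exI[of _ B'] exI[of _ "A \<inter> B'"] conjI) (fact s(1) L(1) sp s(4-6))+
    then show ?thesis using L(2) C(3) by (intro exI[of _ "s # L"]) simp
  qed
qed

text \<open>The bipicket B_2^(u+2,v+1) has its submodule generated by (T^u, T^v). This subspace
  consists of the possible images of that generator under module maps from N_(u+2,v+1) to
  \<open>B\<close>.\<close>

definition filt :: "nat \<Rightarrow> nat \<Rightarrow> 'b set \<Rightarrow> 'b set" where
  "filt u v B = {(T ^^ u) b + (T ^^ v) c |b c. b \<in> B \<and> c \<in> B \<and> (T ^^ (u + 2)) b = 0 \<and> (T ^^ (v + 1)) c = 0}"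

lemma filtI: "b \<in> B \<Longrightarrow> c \<in> B \<Longrightarrow> (T ^^ (u + 2)) b = 0 \<Longrightarrow> (T ^^ (v + 1)) c = 0 \<Longrightarrow>
    (T ^^ u) b + (T ^^ v) c \<in> filt u v B"
  unfolding filt_def by blast

lemma filt_subspace:
  assumes "subspace B"
  shows "subspace (filt u v B)"
proof (rule subspaceI)
  show "0 \<in> filt u v B" using filtI[of 0 B 0 u v] subspace_0[OF assms] by simp
next
  fix x y assume "x \<in> filt u v B" "y \<in> filt u v B"
  then obtain b c b' c' where *: "x = (T ^^ u) b + (T ^^ v) c" "y = (T ^^ u) b' + (T ^^ v) c'"
    "b \<in> B" "c \<in> B" "b' \<in> B" "c' \<in> B" "(T ^^ (u + 2)) b = 0" "(T ^^ (v + 1)) c = 0"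
    "(T ^^ (u + 2)) b' = 0" "(T ^^ (v + 1)) c' = 0"
    unfolding filt_def by blast
  have "(T ^^ u) (b + b') + (T ^^ v) (c + c') \<in> filt u v B"
    by (rule filtI) (use * assms in \<open>auto simp only: pow_simps add_0 intro: subspace_add\<close>)
  then show "x + y \<in> filt u v B" using * by (simp add: ac_simps)
next
  fix x t assume "x \<in> filt u v B"
  then obtain b c where *: "x = (T ^^ u) b + (T ^^ v) c"
    "b \<in> B" "c \<in> B" "(T ^^ (u + 2)) b = 0" "(T ^^ (v + 1)) c = 0"
    unfolding filt_def by blast
  have "(T ^^ u) (t *s b) + (T ^^ v) (t *s c) \<in> filt u v B"
    by (rule filtI) (use * assms in \<open>auto simp only: pow_simps scale_zero_right intro: subspace_scale\<close>)
  then show "t *s x \<in> filt u v B" using * by (simp add: scale_right_distrib)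
qed

lemma filt_sub: "subspace B \<Longrightarrow> T ` B \<subseteq> B \<Longrightarrow> filt u v B \<subseteq> B"
  unfolding filt_def using pow_in by (auto intro!: subspace_add)

lemma filt_T: 
  assumes "subspace B" "T ` B \<subseteq> B" "x \<in> filt u v B"
  shows "T x \<in> filt u v B"
proof -
  obtain b c where *: "x = (T ^^ u) b + (T ^^ v) c"
    "b \<in> B" "c \<in> B" "(T ^^ (u + 2)) b = 0" "(T ^^ (v + 1)) c = 0"
    using assms(3) unfolding filt_def by blast
  have sw: "T ((T ^^ k) z) = (T ^^ k) (T z)" for k z by (simp add: funpow_swap1)
  have "(T ^^ u) (T b) + (T ^^ v) (T c) \<in> filt u v B"
    by (rule filtI) (use * assms in \<open>auto simp only: sw[symmetric] T_simps\<close>)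
  then show ?thesis using * by (simp only: T_simps sw)
qed

section \<open>Dimensions of the filtration on direct sums and blocks\<close>

lemma direct_unique:
  assumes "subspace C" "subspace B'" "C \<inter> B' = {0}" "x \<in> C" "y \<in> B'" "x' \<in> C" "y' \<in> B'" "x + y = x' + y'"
  shows "x = x'" "y = y'"
proof -
  have "x - x' = y' - y" using assms(8) by (simp add: algebra_simps)
  moreover have "x - x' \<in> C" "y' - y \<in> B'" using assms by (auto intro: subspace_diff)
  ultimately have "x - x' \<in> C \<inter> B'" by simp
  then show "x = x'" using assms(3) by simp
  then show "y = y'" using assms(8) by simp
qed

text \<open>Components in a direct sum are unique, so kernels and images of powers of
  \<open>T\<close>, and with them \<open>filt\<close>, split. The same uniqueness identifies the
  components of an element taken in \<open>A\<close> with those taken in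
  \<open>filt\<close>.\<close>

lemma dim_inter_filt:
  assumes C: "sub_pair C AC" and B': "sub_pair B' A'" and dir: "C \<inter> B' = {0}" and fin: "findim scale B"
    and B: "B = {x + y |x y. x \<in> C \<and> y \<in> B'}" and A: "A = {x + y |x y. x \<in> AC \<and> y \<in> A'}"
  shows "dim (A \<inter> filt u v B) = dim (AC \<inter> filt u v C) + dim (A' \<inter> filt u v B')"
proof -
  have C': "subspace C" "T ` C \<subseteq> C" "subspace AC" "AC \<subseteq> C"
    and B'': "subspace B'" "T ` B' \<subseteq> B'" "subspace A'" "A' \<subseteq> B'"
    using C B' unfolding sub_pair_def by auto
  have sub: "C \<subseteq> B" "B' \<subseteq> B"
  proof -
    have "x = x + 0 \<and> 0 \<in> B'" for x :: 'b using subspace_0[OF B''(1)] by simp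
    then show "C \<subseteq> B" unfolding B by blast
    have "x = 0 + x \<and> 0 \<in> C" for x :: 'b using subspace_0[OF C'(1)] by simp
    then show "B' \<subseteq> B" unfolding B by blast
  qed
  have split0: "(T ^^ k) x = 0 \<and> (T ^^ k) y = 0" if "(T ^^ k) (x + y) = 0" "x \<in> C" "y \<in> B'" for k x y
    using direct_unique[OF C'(1) B''(1) dir, of "(T ^^ k) x" "(T ^^ k) y" 0 0] that
      pow_in[OF C'(2)] pow_in[OF B''(2)] subspace_0[OF C'(1)] subspace_0[OF B''(1)] by simp
  have filt_dir: "filt u v B = {x + y |x y. x \<in> filt u v C \<and> y \<in> filt u v B'}"
  proof (intro set_eqI iffI)
    fix z assume "z \<in> filt u v B"
    then obtain b c where *: "z = (T ^^ u) b + (T ^^ v) c"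
      "b \<in> B" "c \<in> B" "(T ^^ (u + 2)) b = 0" "(T ^^ (v + 1)) c = 0"
      unfolding filt_def by blast
    obtain b1 b2 c1 c2 where bc: "b = b1 + b2" "c = c1 + c2" "b1 \<in> C" "b2 \<in> B'" "c1 \<in> C" "c2 \<in> B'"
      using *(2,3) unfolding B by blast
    have "(T ^^ u) b1 + (T ^^ v) c1 \<in> filt u v C" "(T ^^ u) b2 + (T ^^ v) c2 \<in> filt u v B'"
      using split0 * bc by (auto intro!: filtI simp del: funpow.simps)
    moreover have "z = ((T ^^ u) b1 + (T ^^ v) c1) + ((T ^^ u) b2 + (T ^^ v) c2)"
      using * bc by (simp add: ac_simps)
    ultimately show "z \<in> {x + y |x y. x \<in> filt u v C \<and> y \<in> filt u v B'}" by blast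
  next
    fix z assume "z \<in> {x + y |x y. x \<in> filt u v C \<and> y \<in> filt u v B'}"
    then obtain x y where xy: "z = x + y" "x \<in> filt u v C" "y \<in> filt u v B'" by blast
    have "filt u v C \<subseteq> filt u v B" "filt u v B' \<subseteq> filt u v B" unfolding filt_def using sub by blast+
    moreover have "subspace (filt u v B)"
      using subspace_sums[OF C'(1) B''(1)] by (auto simp: B intro!: filt_subspace)
    ultimately show "z \<in> filt u v B" unfolding xy(1) using xy by (auto intro: subspace_add)
  qed
  have "A \<inter> filt u v B = {x + y |x y. x \<in> AC \<inter> filt u v C \<and> y \<in> A' \<inter> filt u v B'}"
  proof (intro set_eqI iffI)
    fix z assume "z \<in> A \<inter> filt u v B"
    then obtain x y x' y' where xy: "z = x + y" "x \<in> filt u v C" "y \<in> filt u v B'"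
      "z = x' + y'" "x' \<in> AC" "y' \<in> A'" unfolding A filt_dir by blast
    have "x \<in> C" "y \<in> B'" "x' \<in> C" "y' \<in> B'"
      using xy C'(4) B''(4) filt_sub[OF C'(1,2)] filt_sub[OF B''(1,2)] by blast+
    moreover have "x + y = x' + y'" using xy(1,4) by simp
    ultimately have "x = x'" "y = y'" using direct_unique[OF C'(1) B''(1) dir] by blast+
    then show "z \<in> {x + y |x y. x \<in> AC \<inter> filt u v C \<and> y \<in> A' \<inter> filt u v B'}" using xy by blast
  next
    fix z assume "z \<in> {x + y |x y. x \<in> AC \<inter> filt u v C \<and> y \<in> A' \<inter> filt u v B'}"
    then show "z \<in> A \<inter> filt u v B" unfolding A filt_dir by blast
  qed
  moreover have "AC \<inter> filt u v C \<inter> (A' \<inter> filt u v B') = {0}"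
  proof
    have "AC \<inter> filt u v C \<inter> (A' \<inter> filt u v B') \<subseteq> C \<inter> B'" using C'(4) B''(4) by auto
    then show "AC \<inter> filt u v C \<inter> (A' \<inter> filt u v B') \<subseteq> {0}" unfolding dir .
    show "{0} \<subseteq> AC \<inter> filt u v C \<inter> (A' \<inter> filt u v B')"
      using C'(1,3) B''(1,3) by (simp add: subspace_0 filt_subspace)
  qed
  moreover have "findim scale (AC \<inter> filt u v C)" "findim scale (A' \<inter> filt u v B')"
    by (rule findim_subset[OF fin]; use sub C'(4) B''(4) in auto)+
  ultimately show ?thesis
    using dim_direct_sum[of "AC \<inter> filt u v C" "A' \<inter> filt u v B'"] C'(1,3) B''(1,3)
    by (simp add: subspace_inter filt_subspace)
qed

end

context operator_space begin

text \<open>If a \<open>T\<close>-stable subspace contains a combination with a non-zero coefficient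
  at \<open>a0\<close>, applying \<open>T\<close> shows that it contains \<open>a1\<close>, and then
  also \<open>a0\<close>. So the dimension is determined by which of the two basis vectors belong to
  it.\<close>

lemma dim_chain:
  assumes U: "subspace U" "\<And>x. x \<in> U \<Longrightarrow> T x \<in> U" and a: "T a0 = a1" "T a1 = 0" "a1 \<noteq> 0"
    and A: "A = {s *s a0 + t *s a1 |s t. True}"
  shows "dim (A \<inter> U) = (if a1 \<in> U then 1 else 0) + (if a0 \<in> U then 1 else 0)"
proof -
  have U10: "a1 \<in> U" if "a0 \<in> U" using U(2)[OF that] a(1) by simp
  have scale_in: "a \<in> U" if "s *s a \<in> U" "s \<noteq> 0" for s a
    using subspace_scale[OF U(1) that(1), of "inverse s"] that(2) by simp
  have coeff: "s = 0" if "a0 \<notin> U" "s *s a0 + t *s a1 \<in> U" for s t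
  proof (rule ccontr)
    assume s: "s \<noteq> 0"
    have "T (s *s a0 + t *s a1) \<in> U" using U(2) that(2) by blast
    then have "s *s a1 \<in> U" unfolding T_simps a(1) using a(2) by simp
    then have "a1 \<in> U" using scale_in s by blast
    then have "(s *s a0 + t *s a1) - t *s a1 \<in> U" using U(1) that(2) by (intro subspace_diff subspace_scale) auto
    then show False using scale_in[of s a0] s that(1) by simp
  qed
  show ?thesis
  proof (cases "a0 \<in> U")
    case True
    then have "A \<inter> U = A" using U(1) U10 unfolding A by (auto intro!: subspace_add subspace_scale)
    moreover have "A = span {a0, a1}" unfolding A span_insert span_singleton
      by (auto simp: algebra_simps)
    moreover have "independent {a0, a1}"
    proof (rule independent_insertI)
      show "a0 \<notin> span {a1}"
      proof
        assume "a0 \<in> span {a1}"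
        then obtain k where "a0 = k *s a1" unfolding span_singleton by blast
        then have "T a0 = 0" using a(2) by simp
        then show False using a by simp
      qed
    qed (use a in simp)
    moreover have "a0 \<noteq> a1" using a by auto
    ultimately show ?thesis using dim_span_eq_card_independent[of "{a0, a1}"] True U10 by simp
  next
    case a0: False
    show ?thesis
    proof (cases "a1 \<in> U")
      case True
      have "A \<inter> U = {t *s a1 |t. True}"
      proof (intro set_eqI iffI)
        fix x assume "x \<in> A \<inter> U"
        then obtain s t where "x = s *s a0 + t *s a1" "x \<in> U" unfolding A by blast
        then have "x = t *s a1" using coeff[OF a0] by force
        then show "x \<in> {t *s a1 |t. True}" by blast
      next
        fix x assume "x \<in> {t *s a1 |t. True}"
        then obtain t where "x = 0 *s a0 + t *s a1" "x \<in> U" using True U(1) by (auto intro: subspace_scale)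
        then show "x \<in> A \<inter> U" unfolding A by blast
      qed
      then show ?thesis using dim_single[OF a(3)] True a0 by simp
    next
      case False
      have "A \<inter> U = {0}"
      proof (intro set_eqI iffI)
        fix x assume "x \<in> A \<inter> U"
        then obtain s t where x: "x = s *s a0 + t *s a1" "x \<in> U" unfolding A by blast
        then have "x = t *s a1" using coeff[OF a0] by force
        then show "x \<in> {0}" using scale_in[of t a1] False x(2) by (cases "t = 0") auto
      next
        fix x assume "x \<in> {0::'b}"
        then have "x = 0 *s a0 + 0 *s a1" "x \<in> U" using U(1) by (auto simp: subspace_0)
        then show "x \<in> A \<inter> U" unfolding A by blast
      qed
      then show ?thesis using dim_zero False a0 by simp
    qed
  qed
qed

lemma filt_eq_zero:
  assumes "\<And>x. x \<in> C \<Longrightarrow> (T ^^ n) x = 0" "n \<le> v" "v \<le> u" "z \<in> filt u v C"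
  shows "z = 0"
proof -
  obtain b c where "z = (T ^^ u) b + (T ^^ v) c" "b \<in> C" "c \<in> C" using assms(4) unfolding filt_def by blast
  then show ?thesis using pow_zero[OF assms(1)] assms(2,3) by simp
qed

lemma filt_T_zero:
  assumes "\<And>x. x \<in> C \<Longrightarrow> (T ^^ n) x = 0" "n < u + 2" "z \<in> filt u v C"
  shows "T z = 0"
proof -
  obtain b c where z: "z = (T ^^ u) b + (T ^^ v) c" "b \<in> C" "(T ^^ (v + 1)) c = 0" using assms(3) unfolding filt_def by blast
  have "(T ^^ Suc u) b = 0" using pow_zero[OF assms(1)[OF z(2)], of "Suc u"] assms(2) by simp
  then show ?thesis using z by simp
qed

text \<open>The question reduces to when the basis vectors of \<open>AC\<close> lie in
  \<open>filt\<close>: T^(n-1) x does for \<open>v < n\<close>, and the second one, if present, for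
  \<open>u + 2 \<le> n\<close> and, in a bipicket, \<open>v < q\<close>. These conditions are the
  summands of \<open>mark\<close>.\<close>

lemma block_dim:
  assumes "block s C AC" "v \<le> u"
  shows "dim (AC \<inter> filt u v C) = mark u v (summand_arcs s, summand_poles s)"
proof -
  have C: "subspace C" "T ` C \<subseteq> C" using block_sub_pair(1)[OF assms(1)] by (auto simp: sub_pair_def)
  have U: "subspace (filt u v C)" "\<And>x. x \<in> filt u v C \<Longrightarrow> T x \<in> filt u v C"
    using filt_subspace[OF C(1)] filt_T[OF C] by auto
  show ?thesis
  proof (cases s)
    case (Picket l n)
    then obtain x where x: "(T ^^ n) x = 0" "\<forall>c. cyc n x c = 0 \<longrightarrow> (\<forall>j<n. c j = 0)"
      "C = range (cyc n x)" "AC = {cyc n x c |c. \<forall>j<n - l. c j = 0}" and n: "1 \<le> n" "l \<le> n" "l \<le> 2"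
      using assms by auto
    have xC: "x \<in> C"
    proof -
      have "x = cyc n x (\<lambda>j. if j = 0 then 1 else 0)" using n cyc_single[of 0 n x 1] by simp
      then show ?thesis unfolding x(3) by blast
    qed
    have Cn: "(T ^^ n) z = 0" if "z \<in> C" for z
      using that unfolding x(3) by (auto simp: cyc_pow[OF x(1)] intro!: cyc_zero)
    define a1 where "a1 = (T ^^ (n - 1)) x"
    have a1: "a1 \<noteq> 0"
    proof
      assume "a1 = 0"
      then have "cyc n x (\<lambda>j. if j = n - 1 then 1 else 0) = 0" using n cyc_single[of "n - 1" n x 1] by (simp add: a1_def)
      then show False using x(2) n(1) by (metis (mono_tags, lifting) diff_less less_le_trans one_neq_zero zero_less_one)
    qed
    have Ta1: "T a1 = 0" using x(1) n(1) T_pow[of "n - 1" x] unfolding a1_def by simp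
    have mem1: "a1 \<in> filt u v C \<longleftrightarrow> v < n"
    proof
      assume "a1 \<in> filt u v C"
      then show "v < n" using filt_eq_zero[OF Cn _ assms(2)] a1 by (metis not_le)
    next
      assume v: "v < n"
      have "(T ^^ u) 0 + (T ^^ v) ((T ^^ (n - 1 - v)) x) \<in> filt u v C"
        using xC pow_in[OF C(2)] subspace_0[OF C(1)] v x(1)
        by (intro filtI) (auto simp: pow_pow simp del: funpow.simps)
      then show "a1 \<in> filt u v C" using v by (simp add: pow_pow a1_def)
    qed
    consider "l = 0" | "l = 1" | "l = 2" using n by linarith
    then show ?thesis
    proof cases
      case 1
      have "AC = {0}" unfolding x(4) 1 using cyc_zero[of n _ x] by (auto intro: exI[of _ "\<lambda>_. 0"])
      then show ?thesis using Picket 1 dim_zero U(1) by (simp add: subspace_0)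
    next
      case 2
      have "AC = {t *s a1 |t. True}"
      proof (intro set_eqI iffI)
        fix z assume "z \<in> AC"
        then obtain c where c: "z = cyc n x c" "\<forall>j<n - 1. c j = 0" unfolding x(4) 2 by blast
        have "z = cyc n x (\<lambda>j. if j = n - 1 then c (n - 1) else 0)" unfolding c(1) cyc_def
          using c(2) by (intro sum.cong) auto
        then show "z \<in> {t *s a1 |t. True}" using n cyc_single[of "n - 1" n x] by (auto simp: a1_def)
      next
        fix z assume "z \<in> {t *s a1 |t. True}"
        then obtain t where "z = cyc n x (\<lambda>j. if j = n - 1 then t else 0)"
          using n cyc_single[of "n - 1" n x] by (auto simp: a1_def)
        then show "z \<in> AC" unfolding x(4) 2 by (auto intro!: exI[of _ "\<lambda>j. if j = n - 1 then t else 0"])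
      qed
      then have AC: "AC = {s *s 0 + t *s a1 |s t. True}" by simp
      have "AC \<inter> filt u v C = (if v < n then AC else {0})"
      proof (cases "v < n")
        case True
        then have "AC \<subseteq> filt u v C" using mem1 U(1) unfolding AC by (auto intro: subspace_scale)
        then show ?thesis using True by auto
      next
        case False
        have "0 \<in> AC" unfolding AC by (auto intro: exI[of _ 0])
        then show ?thesis using False filt_eq_zero[OF Cn _ assms(2)] subspace_0[OF U(1)] by auto
      qed
      then show ?thesis using Picket 2 dim_zero dim_single[OF a1] AC by auto
    next
      case 3
      then have n2: "2 \<le> n" using n by simp
      define a0 where "a0 = (T ^^ (n - 2)) x"
      have n3: "Suc (n - 2) = n - 1" using n2 by simp
      have Ta0: "T a0 = a1" unfolding a0_def a1_def T_pow n3 ..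
      have AC: "AC = {s *s a0 + t *s a1 |s t. True}"
      proof (intro set_eqI iffI)
        fix z assume "z \<in> AC"
        then obtain c where c: "z = cyc n x c" "\<forall>j<n - 2. c j = 0" unfolding x(4) 3 by blast
        have "z = cyc n x (\<lambda>j. (if j = n - 2 then c (n - 2) else 0) + (if j = n - 1 then c (n - 1) else 0))"
          unfolding c(1) cyc_def
        proof (intro sum.cong refl)
          fix j assume "j \<in> {..<n}"
          then have "j < n - 2 \<or> j = n - 2 \<or> j = n - 1" by auto
          then show "c j *s (T ^^ j) x = ((if j = n - 2 then c (n - 2) else 0) + (if j = n - 1 then c (n - 1) else 0)) *s (T ^^ j) x"
            using c(2) n2 by auto
        qed
        then show "z \<in> {s *s a0 + t *s a1 |s t. True}"
          using n2 cyc_single[of "n - 1" n x] cyc_single[of "n - 2" n x] by (auto simp: a0_def a1_def cyc_add[symmetric])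
      next
        fix z assume "z \<in> {s *s a0 + t *s a1 |s t. True}"
        then obtain s t where "z = cyc n x (\<lambda>j. if j = n - 2 then s else 0) + cyc n x (\<lambda>j. if j = n - 1 then t else 0)"
          using n2 cyc_single[of "n - 1" n x] cyc_single[of "n - 2" n x] by (auto simp: a0_def a1_def)
        moreover have "\<forall>j<n - 2. (if j = n - 2 then s else 0) + (if j = n - 1 then t else 0) = 0" by auto
        ultimately show "z \<in> AC" unfolding x(4) 3 cyc_add by blast
      qed
      have mem0: "a0 \<in> filt u v C \<longleftrightarrow> u + 2 \<le> n"
      proof
        assume "a0 \<in> filt u v C"
        then show "u + 2 \<le> n" using filt_T_zero[OF Cn] Ta0 a1 by (metis not_le)
      next
        assume v: "u + 2 \<le> n"
        have "u + 2 + (n - 2 - u) = n" using v by linarith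
        then have "(T ^^ (u + 2)) ((T ^^ (n - 2 - u)) x) = 0" using x(1) by (simp only: pow_pow)
        then have "(T ^^ u) ((T ^^ (n - 2 - u)) x) + (T ^^ v) 0 \<in> filt u v C"
          using xC pow_in[OF C(2)] subspace_0[OF C(1)] by (intro filtI) auto
        then show "a0 \<in> filt u v C" using v by (simp add: pow_pow a0_def)
      qed
      \<comment> \<open>The diagram records this picket as the arc \<open>(n, n - 1)\<close>, so
        \<open>mark\<close> also asks for \<open>v < n - 1\<close>.\<close>
      have "n - 1 > v" if "u + 2 \<le> n" using that assms(2) by simp
      then show ?thesis using dim_chain[OF U Ta0 Ta1 a1 AC] Picket 3 mem0 mem1 by auto
    qed
  next
    case (Bipicket n q)
    then obtain x y where x: "(T ^^ n) x = 0" "(T ^^ q) y = 0"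
      "\<forall>c d. cyc n x c + cyc q y d = 0 \<longrightarrow> (\<forall>j<n. c j = 0) \<and> (\<forall>j<q. d j = 0)"
      and CC: "C = {cyc n x c + cyc q y d |c d. True}"
      and AC: "AC = {s *s ((T ^^ (n - 2)) x + (T ^^ (q - 1)) y) + t *s (T ^^ (n - 1)) x |s t. True}"
      and n: "1 \<le> q" "q + 2 \<le> n"
      using assms by auto
    have n3: "Suc (n - 2) = n - 1" "Suc (n - 1) = n" "Suc (q - 1) = q" using n by auto
    have T1: "T ((T ^^ (n - 2)) z) = (T ^^ (n - 1)) z" "T ((T ^^ (n - 1)) z) = (T ^^ n) z"
      "T ((T ^^ (q - 1)) z) = (T ^^ q) z" for z unfolding T_pow n3 by (rule refl)+
    define a0 where "a0 = (T ^^ (n - 2)) x + (T ^^ (q - 1)) y"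
    define a1 where "a1 = (T ^^ (n - 1)) x"
    have Ta: "T a0 = a1" "T a1 = 0" unfolding a0_def a1_def T_simps T1 x by simp_all
    note AC' = AC[folded a0_def a1_def]
    have xC: "x \<in> C" "y \<in> C"
    proof -
      have "x = cyc n x (\<lambda>j. if j = 0 then 1 else 0) + cyc q y (\<lambda>_. 0)"
        using n cyc_single[of 0 n x 1] by (simp add: cyc_zero)
      then show "x \<in> C" unfolding CC by blast
      have "y = cyc n x (\<lambda>_. 0) + cyc q y (\<lambda>j. if j = 0 then 1 else 0)"
        using n cyc_single[of 0 q y 1] by (simp add: cyc_zero)
      then show "y \<in> C" unfolding CC by blast
    qed
    have Cn: "(T ^^ n) z = 0" if "z \<in> C" for z
      using that n unfolding CC by (auto simp: cyc_pow[OF x(1)] cyc_pow[OF x(2)] cyc_zero)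
    have a1: "a1 \<noteq> 0"
    proof
      assume "a1 = 0"
      then have "cyc n x (\<lambda>j. if j = n - 1 then 1 else 0) + cyc q y (\<lambda>_. 0) = 0"
        using n cyc_single[of "n - 1" n x 1] by (simp add: a1_def cyc_zero)
      then have "(if n - 1 = n - 1 then 1 else 0 :: 'a) = 0" using x(3) n3(2) by (metis (mono_tags, lifting) lessI)
      then show False by simp
    qed
    have mem1: "a1 \<in> filt u v C \<longleftrightarrow> v < n"
    proof
      assume "a1 \<in> filt u v C"
      then show "v < n" using filt_eq_zero[OF Cn _ assms(2)] a1 by (metis not_le)
    next
      assume v: "v < n"
      have "(T ^^ u) 0 + (T ^^ v) ((T ^^ (n - 1 - v)) x) \<in> filt u v C"
        using xC pow_in[OF C(2)] subspace_0[OF C(1)] v x(1)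
        by (intro filtI) (auto simp: pow_pow simp del: funpow.simps)
      then show "a1 \<in> filt u v C" using v by (simp add: pow_pow a1_def)
    qed
    have mem0: "a0 \<in> filt u v C \<longleftrightarrow> u + 2 \<le> n \<and> v < q"
    proof
      assume a0: "a0 \<in> filt u v C"
      then have un: "u + 2 \<le> n" using filt_T_zero[OF Cn] Ta a1 by (metis not_le)
      have "v < q"
      proof (rule ccontr)
        \<comment> \<open>Then both T^u and T^v kill \<open>y\<close>, so \<open>filt\<close> lies
          in the cyclic module of \<open>x\<close>, whereas \<open>a0\<close> has the non-zero
          component T^(q-1) y.\<close>
        assume v: "\<not> v < q"
        obtain b c where bc: "a0 = (T ^^ u) b + (T ^^ v) c" "b \<in> C" "c \<in> C" using a0 unfolding filt_def by blast
        have kc: "\<exists>d. (T ^^ k) z = cyc n x d" if "z \<in> C" "q \<le> k" for z k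
          using that unfolding CC by (auto simp: cyc_pow[OF x(1)] cyc_pow[OF x(2)] cyc_zero)
        have qv: "q \<le> u" "q \<le> v" using v assms(2) by auto
        obtain d1 d2 where "(T ^^ u) b = cyc n x d1" "(T ^^ v) c = cyc n x d2"
          using kc[OF bc(2) qv(1)] kc[OF bc(3) qv(2)] by blast
        then have "a0 = cyc n x (\<lambda>j. d1 j + d2 j)" using bc(1) by (simp only: cyc_add)
        then obtain d where d: "a0 = cyc n x d" by blast
        have "cyc n x (\<lambda>j. (if j = n - 2 then 1 else 0) - d j) + cyc q y (\<lambda>j. if j = q - 1 then 1 else 0)
          = (cyc n x (\<lambda>j. if j = n - 2 then 1 else 0) + cyc n x (\<lambda>j. - d j)) + cyc q y (\<lambda>j. if j = q - 1 then 1 else 0)"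
          unfolding cyc_add by simp
        also have "\<dots> = ((T ^^ (n - 2)) x - a0) + (T ^^ (q - 1)) y"
          using n cyc_single[of "n - 2" n x 1] cyc_single[of "q - 1" q y 1] by (simp add: d cyc_minus[symmetric])
        also have "\<dots> = 0" by (simp add: a0_def)
        finally have "(if q - 1 = q - 1 then 1 else 0 :: 'a) = 0"
          using x(3) n3(3) by (metis (mono_tags, lifting) lessI)
        then show False by simp
      qed
      then show "u + 2 \<le> n \<and> v < q" using un by simp
    next
      assume v: "u + 2 \<le> n \<and> v < q"
      have "u + 2 + (n - 2 - u) = n" "v + 1 + (q - 1 - v) = q" using v by linarith+
      then have "(T ^^ (u + 2)) ((T ^^ (n - 2 - u)) x) = 0" "(T ^^ (v + 1)) ((T ^^ (q - 1 - v)) y) = 0"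
        using x(1,2) by (simp_all only: pow_pow)
      then have "(T ^^ u) ((T ^^ (n - 2 - u)) x) + (T ^^ v) ((T ^^ (q - 1 - v)) y) \<in> filt u v C"
        using xC pow_in[OF C(2)] by (intro filtI) auto
      then show "a0 \<in> filt u v C" using v by (simp add: pow_pow a0_def)
    qed
    show ?thesis using dim_chain[OF U Ta a1 AC'] Bipicket mem0 mem1 by simp
  qed
qed

theorem decomposition_mark:
  assumes "decomposition L B A" "sub_pair B A" "findim scale B" "v \<le> u"
  shows "dim (A \<inter> filt u v B) = mark u v (diagram_of L)"
  using assms(1-3)
proof (induction L arbitrary: B A)
  case Nil
  then have "A \<inter> filt u v B = {0}" using filt_subspace subspace_0 by (auto simp: sub_pair_def)
  then show ?case by (simp add: dim_zero diagram_of_def)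
next
  case (Cons s L)
  then obtain C AC B' A' where s: "block s C AC" "decomposition L B' A'" "sub_pair B' A'"
     "B = {x + y |x y. x \<in> C \<and> y \<in> B'}" "C \<inter> B' = {0}" "A = {x + y |x y. x \<in> AC \<and> y \<in> A'}"
    by (auto simp only: decomposition.simps)
  note C = block_sub_pair(1)[OF s(1)]
  have "B' \<subseteq> B"
  proof
    fix b assume "b \<in> B'"
    then have "b = 0 + b" "0 \<in> C" "b \<in> B'" using C subspace_0 by (auto simp: sub_pair_def)
    then show "b \<in> B" unfolding s(4) by blast
  qed
  then have "dim (A' \<inter> filt u v B') = mark u v (diagram_of L)"
    using Cons.IH[OF s(2,3)] findim_subset Cons.prems(3) by blast
  then show ?case
    using dim_inter_filt[OF C s(3,5) Cons.prems(3) s(4,6), of u v] block_dim[OF s(1) assms(4)]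
    by (simp add: diagram_of_def)
qed

end

section \<open>Matrices and direct sums\<close>

lemma idx_iff: "(i, j) \<in> idx \<beta> \<longleftrightarrow> i < length \<beta> \<and> j < \<beta> ! i"
  by (simp add: idx_def)

lemma idx_Nil [simp]: "idx [] = {}"
  by (auto simp: idx_def)

lemma idx_append_iff: "(i, j) \<in> idx (\<beta>1 @ \<beta>2) \<longleftrightarrow>
    (if i < length \<beta>1 then (i, j) \<in> idx \<beta>1 else (i - length \<beta>1, j) \<in> idx \<beta>2)"
  by (auto simp: idx_iff nth_append)

lemma idx_single_iff: "(i, j) \<in> idx [n] \<longleftrightarrow> i = 0 \<and> j < n"
  by (auto simp: idx_iff)

lemma idx_pair_iff: "(i, j) \<in> idx [n, m] \<longleftrightarrow> i = 0 \<and> j < n \<or> i = 1 \<and> j < m"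
  by (auto simp: idx_iff less_Suc_eq)

lemma idx_Suc: "(i, Suc j) \<in> idx \<beta> \<Longrightarrow> (i, j) \<in> idx \<beta>"
  by (simp add: idx_iff)

lemma finite_idx: "finite (idx \<beta>)"
proof (rule finite_subset)
  show "idx \<beta> \<subseteq> (\<Union>i<length \<beta>. {i} \<times> {..<\<beta> ! i})" by (auto simp: idx_def)
qed auto

lemma sum_idx_append:
  "(\<Sum>q\<in>idx (\<beta>1 @ \<beta>2). g q) = (\<Sum>q\<in>idx \<beta>1. g q) + (\<Sum>q\<in>idx \<beta>2. g (length \<beta>1 + fst q, snd q))"
proof -
  let ?s = "\<lambda>q. (length \<beta>1 + fst q, snd q)"
  have "idx (\<beta>1 @ \<beta>2) = idx \<beta>1 \<union> ?s ` idx \<beta>2"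
  proof (intro set_eqI iffI)
    fix q assume q: "q \<in> idx (\<beta>1 @ \<beta>2)"
    obtain i j where ij: "q = (i, j)" by force
    show "q \<in> idx \<beta>1 \<union> ?s ` idx \<beta>2"
    proof (cases "i < length \<beta>1")
      case False
      then have "(i - length \<beta>1, j) \<in> idx \<beta>2" "q = ?s (i - length \<beta>1, j)"
        using q ij by (auto simp: idx_append_iff)
      then show ?thesis by blast
    qed (use q ij in \<open>auto simp: idx_append_iff\<close>)
  qed (auto simp: idx_append_iff idx_iff nth_append)
  moreover have "idx \<beta>1 \<inter> ?s ` idx \<beta>2 = {}" by (auto simp: idx_iff)
  moreover have "inj_on ?s (idx \<beta>2)" by (auto simp: inj_on_def)
  ultimately show ?thesis by (simp add: sum.union_disjoint finite_idx sum.reindex)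
qed

lemma sum_idx_single: "(\<Sum>q\<in>idx [n]. g q) = (\<Sum>j<n. g (0, j))"
proof -
  have "idx [n] = (\<lambda>j. (0, j)) ` {..<n}" by (auto simp: idx_single_iff)
  moreover have "inj_on (\<lambda>j. (0 :: nat, j)) {..<n}" by (auto simp: inj_on_def)
  ultimately show ?thesis by (simp add: sum.reindex)
qed

lemma sum_idx_pair: "(\<Sum>q\<in>idx [n, m]. g q) = (\<Sum>j<n. g (0, j)) + (\<Sum>j<m. g (1, j))"
  using sum_idx_append[of g "[n]" "[m]"] by (simp add: sum_idx_single)

lemma mmul_tmat_left:
  "mmul (idx \<beta>) (tmat \<beta>) M (i, j) r = (if 0 < j \<and> (i, j) \<in> idx \<beta> then M (i, j - 1) r else 0)"
proof -
  have "mmul (idx \<beta>) (tmat \<beta>) M (i, j) r = (\<Sum>q\<in>idx \<beta>. if q = (i, j - 1) then (if 0 < j \<and> (i, j) \<in> idx \<beta> then M (i, j - 1) r else 0) else 0)"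
    unfolding mmul_def by (rule sum.cong) (auto simp: tmat_def idx_iff)
  also have "\<dots> = (if 0 < j \<and> (i, j) \<in> idx \<beta> then M (i, j - 1) r else 0)"
    by (auto simp: finite_idx idx_iff)
  finally show ?thesis .
qed

lemma mmul_tmat_right:
  "mmul (idx \<alpha>) M (tmat \<alpha>) p (k, m) = (if (k, Suc m) \<in> idx \<alpha> then M p (k, Suc m) else 0)"
proof -
  have "mmul (idx \<alpha>) M (tmat \<alpha>) p (k, m) = (\<Sum>q\<in>idx \<alpha>. if q = (k, Suc m) then M p (k, Suc m) else 0)"
    unfolding mmul_def by (rule sum.cong) (auto simp: tmat_def idx_iff)
  then show ?thesis by (simp add: finite_idx)
qed

lemma is_hom_iff:
  "is_hom \<alpha> \<beta> M \<longleftrightarrow> (\<forall>p q. M p q \<noteq> 0 \<longrightarrow> p \<in> idx \<beta> \<and> q \<in> idx \<alpha>) \<and>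
    (\<forall>i j k m. (if 0 < j \<and> (i, j) \<in> idx \<beta> then M (i, j - 1) (k, m) else 0)
      = (if (k, Suc m) \<in> idx \<alpha> then M (i, j) (k, Suc m) else 0))"
proof -
  have "mmul (idx \<beta>) (tmat \<beta>) M = mmul (idx \<alpha>) M (tmat \<alpha>) \<longleftrightarrow>
    (\<forall>i j k m. mmul (idx \<beta>) (tmat \<beta>) M (i, j) (k, m) = mmul (idx \<alpha>) M (tmat \<alpha>) (i, j) (k, m))"
    by (auto simp: fun_eq_iff)
  then show ?thesis unfolding is_hom_def mmul_tmat_left mmul_tmat_right by simp
qed

lemma is_hom_dsum:
  assumes "is_hom \<alpha>1 \<beta>1 f1" "is_hom \<alpha>2 \<beta>2 f2" and F: "dsum (\<alpha>1, \<beta>1, f1) (\<alpha>2, \<beta>2, f2) = (\<alpha>, \<beta>, F)"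
  shows "is_hom \<alpha> \<beta> F"
proof -
  have eq: "\<alpha> = \<alpha>1 @ \<alpha>2" "\<beta> = \<beta>1 @ \<beta>2" and Fv: "F (i, j) (k, m) =
      (if i < length \<beta>1 \<and> k < length \<alpha>1 then f1 (i, j) (k, m)
       else if length \<beta>1 \<le> i \<and> length \<alpha>1 \<le> k then f2 (i - length \<beta>1, j) (k - length \<alpha>1, m) else 0)" for i j k m
    using F by auto
  have s: "f1 (i, j) (k, m) \<noteq> 0 \<Longrightarrow> (i, j) \<in> idx \<beta>1 \<and> (k, m) \<in> idx \<alpha>1"
    "f2 (i, j) (k, m) \<noteq> 0 \<Longrightarrow> (i, j) \<in> idx \<beta>2 \<and> (k, m) \<in> idx \<alpha>2" for i j k m
    using assms(1,2) unfolding is_hom_def by blast+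
  have c: "(if 0 < j \<and> (i, j) \<in> idx \<beta>1 then f1 (i, j - 1) (k, m) else 0) = (if (k, Suc m) \<in> idx \<alpha>1 then f1 (i, j) (k, Suc m) else 0)"
    "(if 0 < j \<and> (i, j) \<in> idx \<beta>2 then f2 (i, j - 1) (k, m) else 0) = (if (k, Suc m) \<in> idx \<alpha>2 then f2 (i, j) (k, Suc m) else 0)" for i j k m
    using assms(1,2) unfolding is_hom_iff by blast+
  have "(i, j) \<in> idx \<beta> \<and> (k, m) \<in> idx \<alpha>" if "F (i, j) (k, m) \<noteq> 0" for i j k m
    using that s[of i j k m] s[of "i - length \<beta>1" j "k - length \<alpha>1" m]
    unfolding eq idx_append_iff Fv by (auto split: if_splits)
  moreover have "(if 0 < j \<and> (i, j) \<in> idx \<beta> then F (i, j - 1) (k, m) else 0) =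
      (if (k, Suc m) \<in> idx \<alpha> then F (i, j) (k, Suc m) else 0)" for i j k m
    using c(1)[of j i k m] c(2)[of j "i - length \<beta>1" "k - length \<alpha>1" m]
    unfolding eq idx_append_iff Fv
    by (cases "i < length \<beta>1"; cases "k < length \<alpha>1") (auto split: if_splits)
  ultimately show ?thesis unfolding is_hom_iff by (auto simp: split_paired_all)
qed

lemma mapp_dsum:
  assumes "is_hom \<alpha>1 \<beta>1 f1" "is_hom \<alpha>2 \<beta>2 f2" and F: "dsum (\<alpha>1, \<beta>1, f1) (\<alpha>2, \<beta>2, f2) = (\<alpha>, \<beta>, F)"
  shows "mapp (idx \<alpha>) F a (i, j) = (if i < length \<beta>1 then mapp (idx \<alpha>1) f1 a (i, j)
     else mapp (idx \<alpha>2) f2 (\<lambda>q. a (length \<alpha>1 + fst q, snd q)) (i - length \<beta>1, j))"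
proof -
  have eq: "\<alpha> = \<alpha>1 @ \<alpha>2" and Fv: "F = (\<lambda>p q. 
      (if fst p < length \<beta>1 \<and> fst q < length \<alpha>1 then f1 p q
       else if length \<beta>1 \<le> fst p \<and> length \<alpha>1 \<le> fst q then f2 (fst p - length \<beta>1, snd p) (fst q - length \<alpha>1, snd q) else 0))"
    using F by auto
  have l: "fst q < length \<alpha>1" if "q \<in> idx \<alpha>1" for q using that by (cases q) (simp add: idx_iff)
  show ?thesis unfolding mapp_def eq sum_idx_append Fv
    by (auto simp: l idx_iff intro!: sum.neutral sum.cong)
qed

lemma inj_hom_dsum:
  assumes h: "is_hom \<alpha>1 \<beta>1 f1" "is_hom \<alpha>2 \<beta>2 f2" and F: "dsum (\<alpha>1, \<beta>1, f1) (\<alpha>2, \<beta>2, f2) = (\<alpha>, \<beta>, F)"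
    and i: "inj_hom \<alpha>1 f1" "inj_hom \<alpha>2 f2"
  shows "inj_hom \<alpha> F"
  unfolding inj_hom_def
proof (intro allI impI)
  fix v assume v: "supported v (idx \<alpha>)" "mapp (idx \<alpha>) F v = (\<lambda>_. 0)"
  have eq: "\<alpha> = \<alpha>1 @ \<alpha>2" using F by simp
  note m = mapp_dsum[OF h F, of v]
  define v1 where "v1 q = (if fst q < length \<alpha>1 then v q else 0)" for q
  define v2 where "v2 q = v (length \<alpha>1 + fst q, snd q)" for q
  have va: "(i, j) \<in> idx (\<alpha>1 @ \<alpha>2)" if "v (i, j) \<noteq> 0" for i j
    using v(1) that unfolding supported_def eq by blast
  have s: "supported v1 (idx \<alpha>1)" "supported v2 (idx \<alpha>2)"
    unfolding supported_def v1_def v2_def using va by (force simp: idx_append_iff split: if_splits)+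
  have l: "fst q < length \<alpha>1" if "q \<in> idx \<alpha>1" for q using that by (cases q) (simp add: idx_iff)
  have "mapp (idx \<alpha>1) f1 v1 p = 0" for p
  proof -
    obtain i j where p: "p = (i, j)" by force
    have "mapp (idx \<alpha>1) f1 v1 p = mapp (idx \<alpha>1) f1 v p" unfolding mapp_def v1_def using l by (intro sum.cong) auto
    also have "\<dots> = 0"
    proof (cases "i < length \<beta>1")
      case True
      then show ?thesis using m[of i j] v(2) p by simp
    next
      case False
      then have "f1 p q = 0" for q using h(1) p unfolding is_hom_def by (metis idx_iff)
      then show ?thesis by (simp add: mapp_def)
    qed
    finally show ?thesis .
  qed
  then have v1: "v1 = (\<lambda>_. 0)" using i(1) s(1) unfolding inj_hom_def by blast
  have "mapp (idx \<alpha>2) f2 v2 p = 0" for p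
    using m[of "length \<beta>1 + fst p" "snd p"] v(2) by (simp add: v2_def[abs_def])
  then have v2: "v2 = (\<lambda>_. 0)" using i(2) s(2) unfolding inj_hom_def by blast
  show "v = (\<lambda>_. 0)"
  proof
    fix q
    show "v q = 0"
    proof (cases "fst q < length \<alpha>1")
      case True
      then show ?thesis using fun_cong[OF v1, of q] by (simp add: v1_def)
    next
      case False
      then show ?thesis using fun_cong[OF v2, of "(fst q - length \<alpha>1, snd q)"] by (simp add: v2_def)
    qed
  qed
qed

section \<open>The matrices of pickets and bipickets\<close>

lemma idx_part1: "(i, j) \<in> idx (part1 n) \<longleftrightarrow> i = 0 \<and> j < n"
  by (auto simp: part1_def idx_single_iff)

lemma sum_idx_part1: "(\<Sum>q\<in>idx (part1 n). g q) = (\<Sum>j<n. g (0, j))"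
  by (simp add: part1_def sum_idx_single)

lemma mapp_picket:
  assumes "picket l n = (\<alpha>, \<beta>, f)" "l \<le> n"
  shows "\<alpha> = part1 l" "\<beta> = part1 n" "mapp (idx \<alpha>) f a (i, k) = (if i = 0 \<and> n - l \<le> k \<and> k < n then a (0, k - (n - l)) else 0)"
proof -
  show eq: "\<alpha> = part1 l" "\<beta> = part1 n" using assms unfolding picket_def by auto
  have f: "f = (\<lambda>p q. if q \<in> idx (part1 l) \<and> p \<in> idx (part1 n) \<and> p = (0, n - l + snd q) then 1 else 0)"
    using assms(1) unfolding picket_def prod.inject by (elim conjE) (rule sym)
  have "mapp (idx \<alpha>) f a (i, k) = (\<Sum>j<l. if j = k - (n - l) then (if i = 0 \<and> n - l \<le> k \<and> k < n then a (0, j) else 0) else 0)"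
    unfolding mapp_def eq sum_idx_part1 f using assms(2)
    by (intro sum.cong) (auto simp: idx_part1)
  also have "\<dots> = (if i = 0 \<and> n - l \<le> k \<and> k < n then a (0, k - (n - l)) else 0)"
    using assms(2) by (auto simp: sum.delta)
  finally show "mapp (idx \<alpha>) f a (i, k) = (if i = 0 \<and> n - l \<le> k \<and> k < n then a (0, k - (n - l)) else 0)" .
qed

lemma picket_hom:
  assumes "picket l n = (\<alpha>, \<beta>, f)" "l \<le> n"
  shows "is_hom \<alpha> \<beta> f" "inj_hom \<alpha> f"
proof -
  note m = mapp_picket[OF assms]
  have f: "f = (\<lambda>p q. if q \<in> idx (part1 l) \<and> p \<in> idx (part1 n) \<and> p = (0, n - l + snd q) then 1 else 0)"
    using assms(1) unfolding picket_def prod.inject by (elim conjE) (rule sym)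
  show "is_hom \<alpha> \<beta> f" unfolding is_hom_iff m(1,2) f using assms(2) by (auto simp: idx_part1)
  show "inj_hom \<alpha> f" unfolding inj_hom_def
  proof (intro allI impI)
    fix v assume v: "supported v (idx \<alpha>)" "mapp (idx \<alpha>) f v = (\<lambda>_. 0)"
    show "v = (\<lambda>_. 0)"
    proof
      fix q :: "nat \<times> nat"
      obtain i j where q: "q = (i, j)" by force
      show "v q = 0"
      proof (cases "q \<in> idx \<alpha>")
        case True
        then have "i = 0" "j < l" unfolding q m(1) idx_part1 by auto
        then have "mapp (idx \<alpha>) f v (0, n - l + j) = v q" unfolding m(3) q using assms(2) by auto
        then show ?thesis using v(2) by simp
      next
        case False
        then show ?thesis using v(1) unfolding supported_def by blast
      qed
    qed
  qed
qed

lemma mapp_bipicket: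
  assumes "bipicket n r = (\<alpha>, \<beta>, f)" "1 \<le> r" "r + 2 \<le> n"
  shows "\<alpha> = [2]" "\<beta> = [n, r]"
    "mapp (idx \<alpha>) f a (i, k) = (if i = 0 \<and> k = n - 2 \<or> i = 1 \<and> k = r - 1 then a (0, 0)
       else if i = 0 \<and> k = n - 1 then a (0, 1) else 0)"
proof -
  show eq: "\<alpha> = [2]" "\<beta> = [n, r]" using assms unfolding bipicket_def by auto
  have f: "f = (\<lambda>p q. if q \<in> idx [2] \<and> p \<in> idx [n, r] \<and> (p = (0, n - 2 + snd q) \<or> p = (1, r - 1 + snd q)) then 1 else 0)"
    using assms(1) unfolding bipicket_def prod.inject by (elim conjE) (rule sym)
  have two: "(\<Sum>j<2. g j) = g 0 + g (1::nat)" for g :: "nat \<Rightarrow> 'a" by (simp add: numeral_2_eq_2)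
  show "mapp (idx \<alpha>) f a (i, k) = (if i = 0 \<and> k = n - 2 \<or> i = 1 \<and> k = r - 1 then a (0, 0)
       else if i = 0 \<and> k = n - 1 then a (0, 1) else 0)"
    unfolding mapp_def eq sum_idx_single two f using assms(2,3)
    by (auto simp: idx_single_iff idx_pair_iff)
qed

lemma if_if_cong: "(A \<and> B \<longleftrightarrow> C \<and> D) \<Longrightarrow>
    (if A then if B then x else y else y) = (if C then if D then x else y else y)"
  by auto

lemma bipicket_hom:
  assumes "bipicket n r = (\<alpha>, \<beta>, f)" "1 \<le> r" "r + 2 \<le> n"
  shows "is_hom \<alpha> \<beta> f" "inj_hom \<alpha> f"
proof -
  note m = mapp_bipicket[OF assms]
  have f: "f = (\<lambda>p q. if q \<in> idx [2] \<and> p \<in> idx [n, r] \<and> (p = (0, n - 2 + snd q) \<or> p = (1, r - 1 + snd q)) then 1 else 0)"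
    using assms(1) unfolding bipicket_def prod.inject by (elim conjE) (rule sym)
  \<comment> \<open>The support of the matrix: one diagonal in the first block and a single entry in
    the second, since T^(r-1) is already the last non-zero power there. Commutation with
    \<open>T\<close> becomes an equivalence between shifted supports.\<close>
  define P where "P i j k m \<longleftrightarrow> k = 0 \<and> m < 2 \<and> (i = 0 \<and> j < n \<and> j = n - 2 + m \<or> i = 1 \<and> j < r \<and> j = r - 1 + m)"
    for i j k m :: nat
  have fP: "f (i, j) (k, m) = (if P i j k m then 1 else 0)" for i j k m
    unfolding f P_def by (auto simp: idx_single_iff idx_pair_iff)
  have shift: "(0 < j \<and> (i = 0 \<and> j < n \<or> i = 1 \<and> j < r)) \<and> P i (j - 1) k m \<longleftrightarrow> (k = 0 \<and> Suc m < 2) \<and> P i j k (Suc m)" for i j k m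
  proof -
    have "(0 < j \<and> (i = 0 \<and> j < n \<or> i = 1 \<and> j < r)) \<and> P i (j - 1) k m \<longleftrightarrow> i = 0 \<and> j = n - 1 \<and> k = 0 \<and> m = 0"
      unfolding P_def using assms(2,3) by (cases "i = 0"; cases "k = 0") auto
    also have "\<dots> \<longleftrightarrow> (k = 0 \<and> Suc m < 2) \<and> P i j k (Suc m)"
      unfolding P_def using assms(2,3) by (cases "i = 0"; cases "k = 0") auto
    finally show ?thesis .
  qed
  show "is_hom \<alpha> \<beta> f" unfolding is_hom_iff m(1,2)
  proof (intro conjI allI impI)
    fix i j k m
    show "(if 0 < j \<and> (i, j) \<in> idx [n, r] then f (i, j - 1) (k, m) else 0) = (if (k, Suc m) \<in> idx [2] then f (i, j) (k, Suc m) else 0)"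
      unfolding fP idx_single_iff idx_pair_iff using shift[of j i k m] by (rule if_if_cong)
  qed (auto simp: f split: if_splits)
  show "inj_hom \<alpha> f" unfolding inj_hom_def
  proof (intro allI impI)
    fix v assume v: "supported v (idx \<alpha>)" "mapp (idx \<alpha>) f v = (\<lambda>_. 0)"
    show "v = (\<lambda>_. 0)"
    proof
      fix q :: "nat \<times> nat"
      obtain i j where q: "q = (i, j)" by force
      show "v q = 0"
      proof (cases "q \<in> idx \<alpha>")
        case True
        then have "i = 0" "j = 0 \<or> j = 1" unfolding q m(1) idx_single_iff by auto
        moreover have "v (0, 0) = 0" using m(3)[of v 0 "n - 2"] v(2) by simp
        moreover have "mapp (idx \<alpha>) f v (0, n - 1) = v (0, 1)" unfolding m(3) using assms(2,3) by auto
        then have "v (0, 1) = 0" using v(2) by simp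
        ultimately show ?thesis using q by auto
      next
        case False
        then show ?thesis using v(1) unfolding supported_def by blast
      qed
    qed
  qed
qed

section \<open>From decompositions to matrix objects\<close>

context operator_space begin

definition comb :: "(nat \<times> nat) set \<Rightarrow> (nat \<times> nat \<Rightarrow> 'b) \<Rightarrow> (nat \<times> nat \<Rightarrow> 'a) \<Rightarrow> 'b" where
  "comb I v c = (\<Sum>q\<in>I. c q *s v q)"

text \<open>\<open>realizes B A Y\<close>: there is an isomorphism of the module of \<open>Y\<close> onto \<open>B\<close> carrying the
  submodule of \<open>Y\<close> onto \<open>A\<close>; the family \<open>v\<close> is the image of the standard basis.\<close>
fun realizes :: "'b set \<Rightarrow> 'b set \<Rightarrow> 'a obj \<Rightarrow> bool" where
  "realizes B A (\<alpha>, \<beta>, f) \<longleftrightarrow> is_hom \<alpha> \<beta> f \<and> inj_hom \<alpha> f \<and>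
    (\<exists>v. (\<forall>i j. (i, j) \<in> idx \<beta> \<longrightarrow> T (v (i, j)) = (if (i, Suc j) \<in> idx \<beta> then v (i, Suc j) else 0))
      \<and> (\<forall>c. comb (idx \<beta>) v c = 0 \<longrightarrow> (\<forall>q\<in>idx \<beta>. c q = 0))
      \<and> B = range (comb (idx \<beta>) v) \<and> A = range (\<lambda>a. comb (idx \<beta>) v (mapp (idx \<alpha>) f a)))"

lemma comb_cong: "(\<And>q. q \<in> I \<Longrightarrow> c q = d q) \<Longrightarrow> (\<And>q. q \<in> I \<Longrightarrow> v q = w q) \<Longrightarrow> comb I v c = comb I w d"
  unfolding comb_def by (rule sum.cong) auto

lemma comb_minus: "- comb I v c = comb I v (\<lambda>q. - c q)"
  by (simp add: comb_def sum_negf)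

lemma comb_append:
  "comb (idx (\<beta>1 @ \<beta>2)) v c = comb (idx \<beta>1) v c
     + comb (idx \<beta>2) (\<lambda>q. v (length \<beta>1 + fst q, snd q)) (\<lambda>q. c (length \<beta>1 + fst q, snd q))"
  unfolding comb_def by (rule sum_idx_append)

lemma idx_fst_less: "q \<in> idx \<beta> \<Longrightarrow> fst q < length \<beta>"
  by (cases q) (simp add: idx_iff)

lemma realizes_dsum:
  assumes Y1: "realizes C AC Y1" and Y2: "realizes B' A' Y2" and dir: "C \<inter> B' = {0}"
    and B: "B = {x + y |x y. x \<in> C \<and> y \<in> B'}" and A: "A = {x + y |x y. x \<in> AC \<and> y \<in> A'}"
  shows "realizes B A (dsum Y1 Y2)"
proof -
  obtain \<alpha>1 \<beta>1 f1 \<alpha>2 \<beta>2 f2 where Y: "Y1 = (\<alpha>1, \<beta>1, f1)" "Y2 = (\<alpha>2, \<beta>2, f2)" by (metis prod_cases3)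
  obtain \<alpha> \<beta> F where F: "dsum (\<alpha>1, \<beta>1, f1) (\<alpha>2, \<beta>2, f2) = (\<alpha>, \<beta>, F)" by (metis prod_cases3)
  then have eq: "\<alpha> = \<alpha>1 @ \<alpha>2" "\<beta> = \<beta>1 @ \<beta>2" by auto
  have h: "is_hom \<alpha>1 \<beta>1 f1" "inj_hom \<alpha>1 f1" "is_hom \<alpha>2 \<beta>2 f2" "inj_hom \<alpha>2 f2"
    using Y1 Y2 unfolding Y by auto
  obtain v1 where v1: "\<And>i j. (i, j) \<in> idx \<beta>1 \<Longrightarrow> T (v1 (i, j)) = (if (i, Suc j) \<in> idx \<beta>1 then v1 (i, Suc j) else 0)"
    "\<And>c q. comb (idx \<beta>1) v1 c = 0 \<Longrightarrow> q \<in> idx \<beta>1 \<Longrightarrow> c q = 0"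
    "C = range (comb (idx \<beta>1) v1)" "AC = range (\<lambda>a. comb (idx \<beta>1) v1 (mapp (idx \<alpha>1) f1 a))"
    using Y1 unfolding Y realizes.simps by metis
  obtain v2 where v2: "\<And>i j. (i, j) \<in> idx \<beta>2 \<Longrightarrow> T (v2 (i, j)) = (if (i, Suc j) \<in> idx \<beta>2 then v2 (i, Suc j) else 0)"
    "\<And>c q. comb (idx \<beta>2) v2 c = 0 \<Longrightarrow> q \<in> idx \<beta>2 \<Longrightarrow> c q = 0"
    "B' = range (comb (idx \<beta>2) v2)" "A' = range (\<lambda>a. comb (idx \<beta>2) v2 (mapp (idx \<alpha>2) f2 a))"
    using Y2 unfolding Y realizes.simps by metis
  let ?l = "length \<beta>1" and ?k = "length \<alpha>1"
  define v where "v q = (if fst q < ?l then v1 q else v2 (fst q - ?l, snd q))" for q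
  \<comment> \<open>\<open>r\<close> extracts the coordinates of the second summand and
    \<open>glue\<close> joins two coordinate families, so that coordinates in the two summands can
    be prescribed independently.\<close>
  define r where "r k c q = c (k + fst q, snd q)" for k and c :: "nat \<times> nat \<Rightarrow> 'a" and q :: "nat \<times> nat"
  define glue where "glue k c d q = (if fst q < k then c q else d (fst q - k, snd q))"
    for k and c d :: "nat \<times> nat \<Rightarrow> 'a" and q :: "nat \<times> nat"
  have comb_v: "comb (idx \<beta>) v c = comb (idx \<beta>1) v1 c + comb (idx \<beta>2) v2 (r ?l c)" for c
    unfolding eq comb_append r_def[abs_def]
    by (rule arg_cong2[of _ _ _ _ "(+)"]; rule comb_cong) (auto simp: v_def idx_fst_less)
  have comb_glue: "comb (idx \<beta>) v (glue ?l c d) = comb (idx \<beta>1) v1 c + comb (idx \<beta>2) v2 d" for c d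
    unfolding comb_v
    by (rule arg_cong2[of _ _ _ _ "(+)"]; rule comb_cong) (auto simp: glue_def r_def idx_fst_less)
  note m = mapp_dsum[OF h(1,3) F, folded r_def[abs_def]]
  have comb_m: "comb (idx \<beta>) v (mapp (idx \<alpha>) F a)
      = comb (idx \<beta>1) v1 (mapp (idx \<alpha>1) f1 a) + comb (idx \<beta>2) v2 (mapp (idx \<alpha>2) f2 (r ?k a))" for a
    unfolding comb_v
  proof (rule arg_cong2[of _ _ _ _ "(+)"]; rule comb_cong)
    fix q assume "q \<in> idx \<beta>1"
    then show "mapp (idx \<alpha>) F a q = mapp (idx \<alpha>1) f1 a q"
      using m[of a "fst q" "snd q"] idx_fst_less[of q] by simp
  next
    fix q assume "q \<in> idx \<beta>2"
    then show "r ?l (mapp (idx \<alpha>) F a) q = mapp (idx \<alpha>2) f2 (r ?k a) q"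
      using m[of a "?l + fst q" "snd q"] by (simp add: r_def[abs_def])
  qed auto
  have "T (v (i, j)) = (if (i, Suc j) \<in> idx \<beta> then v (i, Suc j) else 0)" if "(i, j) \<in> idx \<beta>" for i j
    using that v1(1)[of i j] v2(1)[of "i - ?l" j] unfolding eq idx_append_iff v_def by (auto split: if_splits)
  moreover have "c q = 0" if c: "comb (idx \<beta>) v c = 0" and q: "q \<in> idx \<beta>" for c q
  proof -
    have "comb (idx \<beta>1) v1 c = - comb (idx \<beta>2) v2 (r ?l c)"
      using c unfolding comb_v by (simp add: eq_neg_iff_add_eq_0)
    then have "comb (idx \<beta>1) v1 c \<in> B'" unfolding comb_minus v2(3) by simp
    moreover have "comb (idx \<beta>1) v1 c \<in> C" unfolding v1(3) by simp
    ultimately have "comb (idx \<beta>1) v1 c \<in> C \<inter> B'" by simp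
    then have 0: "comb (idx \<beta>1) v1 c = 0" "comb (idx \<beta>2) v2 (r ?l c) = 0"
      using dir c unfolding comb_v by auto
    show ?thesis
    proof (cases "fst q < ?l")
      case True
      then have "q \<in> idx \<beta>1" using q unfolding eq by (cases q) (auto simp: idx_append_iff)
      then show ?thesis by (rule v1(2)[OF 0(1)])
    next
      case False
      then have "(fst q - ?l, snd q) \<in> idx \<beta>2" using q unfolding eq by (cases q) (auto simp: idx_append_iff)
      then have "r ?l c (fst q - ?l, snd q) = 0" by (rule v2(2)[OF 0(2)])
      then show ?thesis using False by (simp add: r_def)
    qed
  qed
  moreover have "B = range (comb (idx \<beta>) v)"
  proof (intro set_eqI iffI)
    fix x assume "x \<in> B"
    then obtain c d where "x = comb (idx \<beta>1) v1 c + comb (idx \<beta>2) v2 d" unfolding B v1(3) v2(3) by blast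
    then show "x \<in> range (comb (idx \<beta>) v)" unfolding comb_glue[symmetric] by blast
  qed (auto simp: comb_v B v1(3) v2(3))
  moreover have "A = range (\<lambda>a. comb (idx \<beta>) v (mapp (idx \<alpha>) F a))"
  proof (intro set_eqI iffI)
    fix x assume "x \<in> A"
    then obtain a b where x: "x = comb (idx \<beta>1) v1 (mapp (idx \<alpha>1) f1 a) + comb (idx \<beta>2) v2 (mapp (idx \<alpha>2) f2 b)"
      unfolding A v1(4) v2(4) by blast
    have "mapp (idx \<alpha>1) f1 (glue ?k a b) = mapp (idx \<alpha>1) f1 a"
      unfolding mapp_def by (intro ext sum.cong) (auto simp: glue_def idx_fst_less)
    moreover have "r ?k (glue ?k a b) = b" by (auto simp: r_def glue_def)
    ultimately have "x = comb (idx \<beta>) v (mapp (idx \<alpha>) F (glue ?k a b))" unfolding comb_m x by simp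
    then show "x \<in> range (\<lambda>a. comb (idx \<beta>) v (mapp (idx \<alpha>) F a))" by blast
  qed (auto simp: comb_m A v1(4) v2(4))
  moreover have "is_hom \<alpha> \<beta> F" "inj_hom \<alpha> F"
    using is_hom_dsum[OF h(1,3) F] inj_hom_dsum[OF h(1,3) F h(2,4)] by auto
  ultimately show ?thesis unfolding Y F realizes.simps by blast
qed

lemma realizes_block:
  assumes "block s C AC"
  shows "realizes C AC (summand_obj s)"
proof (cases s)
  case (Picket l n)
  then obtain x where x: "(T ^^ n) x = 0" "\<forall>c. cyc n x c = 0 \<longrightarrow> (\<forall>j<n. c j = 0)"
    "C = range (cyc n x)" "AC = {cyc n x c |c. \<forall>j<n - l. c j = 0}" and n: "1 \<le> n" "l \<le> n" "l \<le> 2"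
    using assms by auto
  obtain \<alpha> \<beta> f where Y: "picket l n = (\<alpha>, \<beta>, f :: 'a mat)" by (metis prod_cases3)
  note m = mapp_picket[OF Y n(2)]
  define v where "v q = (T ^^ snd q) x" for q :: "nat \<times> nat"
  have comb: "comb (idx \<beta>) v c = cyc n x (\<lambda>j. c (0, j))" for c
    unfolding comb_def m(2) sum_idx_part1 cyc_def v_def by simp
  have "T (v (i, j)) = (if (i, Suc j) \<in> idx \<beta> then v (i, Suc j) else 0)" if "(i, j) \<in> idx \<beta>" for i j
  proof (cases "Suc j < n")
    case False
    then have "Suc j = n" using that unfolding m(2) idx_part1 by simp
    then show ?thesis using x(1) that unfolding v_def m(2) idx_part1 snd_conv T_pow by simp
  qed (use that in \<open>auto simp: m(2) idx_part1 v_def\<close>)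
  moreover have "c q = 0" if "comb (idx \<beta>) v c = 0" "q \<in> idx \<beta>" for c q
  proof -
    have "\<forall>j<n. c (0, j) = 0" using that(1) x(2) unfolding comb by blast
    then show ?thesis using that(2) unfolding m(2) by (cases q) (auto simp: idx_part1)
  qed
  moreover have "C = range (comb (idx \<beta>) v)"
  proof (intro set_eqI iffI)
    fix z assume "z \<in> C"
    then obtain c where "z = comb (idx \<beta>) v (\<lambda>q. c (snd q))" unfolding comb x(3) by auto
    then show "z \<in> range (comb (idx \<beta>) v)" by blast
  qed (auto simp: comb x(3))
  moreover have "AC = range (\<lambda>a. comb (idx \<beta>) v (mapp (idx \<alpha>) f a))"
  proof (intro set_eqI iffI)
    fix z assume "z \<in> AC"
    then obtain c where c: "z = cyc n x c" "\<forall>j<n - l. c j = 0" unfolding x(4) by blast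
    have "z = comb (idx \<beta>) v (mapp (idx \<alpha>) f (\<lambda>q. c (snd q + (n - l))))"
      unfolding comb c(1) cyc_def m(3) using c(2) by (intro sum.cong) auto
    then show "z \<in> range (\<lambda>a. comb (idx \<beta>) v (mapp (idx \<alpha>) f a))" by blast
  next
    fix z assume "z \<in> range (\<lambda>a. comb (idx \<beta>) v (mapp (idx \<alpha>) f a))"
    then obtain a where "z = cyc n x (\<lambda>j. mapp (idx \<alpha>) f a (0, j))" unfolding comb by blast
    moreover have "\<forall>j<n - l. mapp (idx \<alpha>) f a (0, j) = 0" unfolding m(3) by simp
    ultimately show "z \<in> AC" unfolding x(4) by (intro CollectI exI[of _ "\<lambda>j. mapp (idx \<alpha>) f a (0, j)"] conjI)
  qed
  ultimately show ?thesis using picket_hom[OF Y n(2)] unfolding Picket summand_obj.simps Y realizes.simps by blast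
next
  case (Bipicket n q)
  then obtain x y where x: "(T ^^ n) x = 0" "(T ^^ q) y = 0"
    "\<forall>c d. cyc n x c + cyc q y d = 0 \<longrightarrow> (\<forall>j<n. c j = 0) \<and> (\<forall>j<q. d j = 0)"
    and CC: "C = {cyc n x c + cyc q y d |c d. True}"
    and AC: "AC = {s *s ((T ^^ (n - 2)) x + (T ^^ (q - 1)) y) + t *s (T ^^ (n - 1)) x |s t. True}"
    and n: "1 \<le> q" "q + 2 \<le> n"
    using assms by auto
  obtain \<alpha> \<beta> f where Y: "bipicket n q = (\<alpha>, \<beta>, f :: 'a mat)" by (metis prod_cases3)
  note m = mapp_bipicket[OF Y n]
  define v where "v p = (if fst p = 0 then (T ^^ snd p) x else (T ^^ snd p) y)" for p :: "nat \<times> nat"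
  have comb: "comb (idx \<beta>) v c = cyc n x (\<lambda>j. c (0, j)) + cyc q y (\<lambda>j. c (1, j))" for c
    unfolding comb_def m(2) sum_idx_pair cyc_def v_def by simp
  have "T (v (i, j)) = (if (i, Suc j) \<in> idx \<beta> then v (i, Suc j) else 0)" if "(i, j) \<in> idx \<beta>" for i j
  proof -
    have "T (v (i, j)) = v (i, Suc j)" unfolding v_def by simp
    moreover have "v (i, Suc j) = 0" if "(i, Suc j) \<notin> idx \<beta>"
    proof -
      have "(i = 0 \<and> Suc j = n) \<or> (i = 1 \<and> Suc j = q)"
        using that \<open>(i, j) \<in> idx \<beta>\<close> unfolding m(2) idx_pair_iff by auto
      then show ?thesis using x(1,2) unfolding v_def by (auto simp del: funpow.simps)
    qed
    ultimately show ?thesis by simp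
  qed
  moreover have "c p = 0" if "comb (idx \<beta>) v c = 0" "p \<in> idx \<beta>" for c p
  proof -
    have "(\<forall>j<n. c (0, j) = 0) \<and> (\<forall>j<q. c (1, j) = 0)" using that(1) x(3) unfolding comb by blast
    then show ?thesis using that(2) unfolding m(2) by (cases p) (auto simp: idx_pair_iff)
  qed
  moreover have "C = range (comb (idx \<beta>) v)"
  proof (intro set_eqI iffI)
    fix z assume "z \<in> C"
    then obtain c d where "z = cyc n x c + cyc q y d" unfolding CC by blast
    then have "z = comb (idx \<beta>) v (\<lambda>p. if fst p = 0 then c (snd p) else d (snd p))" unfolding comb by simp
    then show "z \<in> range (comb (idx \<beta>) v)" by blast
  qed (auto simp: comb CC)
  moreover have mm: "comb (idx \<beta>) v (mapp (idx \<alpha>) f a) =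
      a (0, 0) *s ((T ^^ (n - 2)) x + (T ^^ (q - 1)) y) + a (0, 1) *s (T ^^ (n - 1)) x" for a
  proof -
    have n12: "n - 1 \<noteq> n - 2" using n by simp
    have "cyc n x (\<lambda>j. mapp (idx \<alpha>) f a (0, j)) =
        cyc n x (\<lambda>j. (if j = n - 2 then a (0, 0) else 0) + (if j = n - 1 then a (0, 1) else 0))"
      unfolding m(3) using n12 by (intro arg_cong[of _ _ "cyc n x"] ext) auto
    also have "\<dots> = a (0, 0) *s (T ^^ (n - 2)) x + a (0, 1) *s (T ^^ (n - 1)) x"
      unfolding cyc_add[symmetric] using n by (simp add: cyc_single)
    finally have 1: "cyc n x (\<lambda>j. mapp (idx \<alpha>) f a (0, j)) = a (0, 0) *s (T ^^ (n - 2)) x + a (0, 1) *s (T ^^ (n - 1)) x" .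
    have "cyc q y (\<lambda>j. mapp (idx \<alpha>) f a (1, j)) = cyc q y (\<lambda>j. if j = q - 1 then a (0, 0) else 0)"
      unfolding m(3) by (intro arg_cong[of _ _ "cyc q y"] ext) auto
    also have "\<dots> = a (0, 0) *s (T ^^ (q - 1)) y" using n by (simp add: cyc_single)
    finally show ?thesis unfolding comb 1 by (simp add: scale_right_distrib)
  qed
  moreover have "AC = range (\<lambda>a. comb (idx \<beta>) v (mapp (idx \<alpha>) f a))"
  proof (intro set_eqI iffI)
    fix z assume "z \<in> AC"
    then obtain s t where "z = s *s ((T ^^ (n - 2)) x + (T ^^ (q - 1)) y) + t *s (T ^^ (n - 1)) x" unfolding AC by blast
    then have "z = comb (idx \<beta>) v (mapp (idx \<alpha>) f (\<lambda>p. if snd p = 0 then s else t))" unfolding mm by simp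
    then show "z \<in> range (\<lambda>a. comb (idx \<beta>) v (mapp (idx \<alpha>) f a))" by blast
  next
    fix z assume "z \<in> range (\<lambda>a. comb (idx \<beta>) v (mapp (idx \<alpha>) f a))"
    then show "z \<in> AC" unfolding mm AC by blast
  qed
  ultimately show ?thesis using bipicket_hom[OF Y n] unfolding Bipicket summand_obj.simps Y realizes.simps by blast
qed

theorem realizes_decomposition: "decomposition L B A \<Longrightarrow> realizes B A (sum_obj L)"
proof (induction L arbitrary: B A)
  case Nil
  then have "B = {0}" "A = {0}" by auto
  moreover have "is_hom [] [] (\<lambda>_ _. 0 :: 'a)" "inj_hom [] (\<lambda>_ _. 0 :: 'a)"
    by (auto simp: is_hom_def mmul_def[abs_def] inj_hom_def supported_def)
  ultimately show ?case by (simp add: sum_obj_def comb_def image_constant_conv)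
next
  case (Cons s L)
  then obtain C AC B' A' where s: "block s C AC" "decomposition L B' A'"
     "B = {x + y |x y. x \<in> C \<and> y \<in> B'}" "C \<inter> B' = {0}" "A = {x + y |x y. x \<in> AC \<and> y \<in> A'}"
    by (auto simp only: decomposition.simps)
  have "sum_obj (s # L) = dsum (summand_obj s) (sum_obj L :: 'a obj)" by (simp add: sum_obj_def)
  then show ?case using realizes_dsum[OF realizes_block[OF s(1)] Cons.IH[OF s(2)] s(4,3,5)] by simp
qed

end

section \<open>Coordinate vectors as a module, and isomorphisms of objects\<close>

definition fscale :: "'k::field \<Rightarrow> (nat \<times> nat \<Rightarrow> 'k) \<Rightarrow> nat \<times> nat \<Rightarrow> 'k" where
  "fscale c v = (\<lambda>p. c * v p)"

abbreviation shift :: "nat list \<Rightarrow> (nat \<times> nat \<Rightarrow> 'k::field) \<Rightarrow> nat \<times> nat \<Rightarrow> 'k" where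
  "shift \<beta> \<equiv> mapp (idx \<beta>) (tmat \<beta>)"

definition nspace :: "nat list \<Rightarrow> (nat \<times> nat \<Rightarrow> 'k::field) set" where
  "nspace \<beta> = {v. supported v (idx \<beta>)}"

interpretation fs: vector_space "fscale :: 'k::field \<Rightarrow> _"
  by unfold_locales (auto simp: fscale_def fun_eq_iff algebra_simps)

lemma linear_mapp: "Vector_Spaces.linear fscale fscale (mapp I (M :: 'k::field mat))"
proof -
  interpret p: vector_space_pair "fscale :: 'k \<Rightarrow> _" "fscale :: 'k \<Rightarrow> _" by unfold_locales
  show ?thesis
    unfolding Vector_Spaces.linear_iff
    by (auto simp: mapp_def fscale_def fun_eq_iff algebra_simps sum.distrib sum_distrib_left fs.vector_space_axioms)
qed

text \<open>Stated for every index set and matrix, so the constants of the locale take both as first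
  arguments; \<open>idx \<beta>\<close> and \<open>tmat \<beta>\<close> give multiplication by
  \<open>T\<close> on N_\<beta>.\<close>

interpretation os: operator_space "fscale :: 'k::field \<Rightarrow> _" "mapp I (M :: 'k mat)" for I M
  by (intro operator_space.intro operator_space_axioms.intro linear_mapp fs.vector_space_axioms)

lemma mmul_assoc:
  assumes "finite I" "finite J"
  shows "mmul I A (mmul J B C) = mmul J (mmul I A B) C"
proof (intro ext)
  fix p r
  have "(\<Sum>i\<in>I. \<Sum>j\<in>J. A p i * (B i j * C j r)) = (\<Sum>j\<in>J. \<Sum>i\<in>I. A p i * (B i j * C j r))"
    by (rule sum.swap)
  then show "mmul I A (mmul J B C) p r = mmul J (mmul I A B) C p r"
    unfolding mmul_def by (simp add: sum_distrib_left sum_distrib_right mult.assoc)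
qed

lemma mapp_mmul:
  assumes "finite I" "finite J"
  shows "mapp I A (mapp J B v) = mapp J (mmul I A B) v"
proof
  fix p
  show "mapp I A (mapp J B v) p = mapp J (mmul I A B) v p"
    using fun_cong[OF fun_cong[OF mmul_assoc[OF assms, of A B "\<lambda>q _. v q"]], of p]
    by (simp add: mmul_def mapp_def)
qed

lemma mapp_cong: "(\<And>q. q \<in> I \<Longrightarrow> v q = w q) \<Longrightarrow> mapp I M v = mapp I M w"
  unfolding mapp_def fun_eq_iff by (auto intro: sum.cong)

lemma mmul_column: "(\<lambda>p. mmul I A B p r) = mapp I A (\<lambda>q. B q r)"
  by (simp add: mmul_def mapp_def fun_eq_iff)

lemma shift_apply: "shift \<beta> v (i, j) = (if 0 < j \<and> (i, j) \<in> idx \<beta> then v (i, j - 1) else 0)"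
  using mmul_tmat_left[of \<beta> "\<lambda>p _. v p" i j] by (simp add: mmul_def mapp_def)

lemma shift_in: "shift \<beta> v \<in> nspace \<beta>"
  unfolding nspace_def supported_def by (auto simp: shift_apply split: if_splits)

lemma shift_pow: "supported v (idx \<beta>) \<Longrightarrow> (shift \<beta> ^^ n) v (i, j) = (if n \<le> j \<and> (i, j) \<in> idx \<beta> then v (i, j - n) else 0)"
proof (induction n arbitrary: j)
  case 0
  then show ?case unfolding supported_def by auto
next
  case (Suc n)
  have "(i, j - 1) \<in> idx \<beta>" if "(i, j) \<in> idx \<beta>" "0 < j" using that by (auto simp: idx_iff)
  then show ?case using Suc.IH[OF Suc.prems, of "j - 1"] by (auto simp: shift_apply)
qed

lemma shift_nilpotent:
  assumes "\<And>b. b \<in> set \<beta> \<Longrightarrow> b \<le> n" "v \<in> nspace \<beta>"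
  shows "(shift \<beta> ^^ n) v = 0"
proof
  fix p :: "nat \<times> nat"
  obtain i j where p: "p = (i, j)" by force
  have "\<not> n \<le> j" if "(i, j) \<in> idx \<beta>" using that assms(1)[of "\<beta> ! i"] by (auto simp: idx_iff)
  then show "(shift \<beta> ^^ n) v p = 0 p" using assms(2) p by (auto simp: shift_pow nspace_def)
qed

lemma subspace_nspace: "fs.subspace (nspace \<beta>)"
  by (rule fs.subspaceI) (auto simp: nspace_def supported_def fscale_def, force)

definition unit_vec :: "nat \<times> nat \<Rightarrow> nat \<times> nat \<Rightarrow> 'k::field" where
  "unit_vec p q = (if q = p then 1 else 0)"

lemma sum_apply: "(\<Sum>i\<in>I. f i) p = (\<Sum>i\<in>I. f i p)"
  by (induction I rule: infinite_finite_induct) auto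

lemma findim_nspace: "findim fscale (nspace \<beta> :: (nat \<times> nat \<Rightarrow> 'k::field) set)"
  unfolding findim_def
proof (intro exI conjI subsetI)
  show "finite (unit_vec ` idx \<beta> :: (nat \<times> nat \<Rightarrow> 'k) set)" by (simp add: finite_idx)
  fix v :: "nat \<times> nat \<Rightarrow> 'k" assume v: "v \<in> nspace \<beta>"
  then have v0: "v q = 0" if "q \<notin> idx \<beta>" for q using that unfolding nspace_def supported_def by blast
  have "v = (\<Sum>p\<in>idx \<beta>. fscale (v p) (unit_vec p))"
  proof
    fix q
    have "(\<Sum>p\<in>idx \<beta>. fscale (v p) (unit_vec p)) q = (\<Sum>p\<in>idx \<beta>. if q = p then v p else 0)"
      unfolding sum_apply by (rule sum.cong) (auto simp: fscale_def unit_vec_def)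
    also have "\<dots> = v q" by (auto simp: finite_idx v0)
    finally show "v q = (\<Sum>p\<in>idx \<beta>. fscale (v p) (unit_vec p)) q" by simp
  qed
  also have "\<dots> \<in> fs.span (unit_vec ` idx \<beta>)"
    by (intro fs.span_sum fs.span_scale fs.span_base) auto
  finally show "v \<in> fs.span (unit_vec ` idx \<beta>)" .
qed

lemma hom_shift:
  assumes "is_hom \<alpha> \<beta> f"
  shows "shift \<beta> (mapp (idx \<alpha>) f v) = mapp (idx \<alpha>) f (shift \<alpha> v)"
  using assms unfolding is_hom_def by (simp add: mapp_mmul finite_idx)

lemma hom_in:
  assumes "is_hom \<alpha> \<beta> f"
  shows "mapp (idx \<alpha>) f v \<in> nspace \<beta>"
  unfolding nspace_def supported_def
proof (intro CollectI allI impI)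
  fix p assume "mapp (idx \<alpha>) f v p \<noteq> 0"
  then obtain q where "f p q * v q \<noteq> 0"
    unfolding mapp_def by (rule sum.not_neutral_contains_not_neutral)
  then have "f p q \<noteq> 0" by auto
  then show "p \<in> idx \<beta>" using assms unfolding is_hom_def by blast
qed

text \<open>\<open>mapp\<close> reads its argument only on the index set, so arbitrary functions
  yield no further values. This is why the submodule can be written as a plain range.\<close>

lemma hom_range: "range (mapp (idx \<alpha>) f) = mapp (idx \<alpha>) f ` nspace \<alpha>"
proof (intro set_eqI iffI)
  fix x assume "x \<in> range (mapp (idx \<alpha>) f)"
  then obtain v where "x = mapp (idx \<alpha>) f v" by blast
  also have "\<dots> = mapp (idx \<alpha>) f (\<lambda>q. if q \<in> idx \<alpha> then v q else 0)" by (rule mapp_cong) simp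
  finally show "x \<in> mapp (idx \<alpha>) f ` nspace \<alpha>" by (auto simp: nspace_def supported_def)
qed auto

text \<open>Along each chain of basis vectors, \<open>T\<close> must carry a column to the next one
  and the last column to 0.\<close>

lemma is_hom_columns:
  "is_hom \<alpha> \<beta> M \<longleftrightarrow> (\<forall>p q. M p q \<noteq> 0 \<longrightarrow> p \<in> idx \<beta> \<and> q \<in> idx \<alpha>) \<and>
    (\<forall>k m. (k, m) \<in> idx \<alpha> \<longrightarrow> shift \<beta> (\<lambda>p. M p (k, m)) = (if (k, Suc m) \<in> idx \<alpha> then (\<lambda>p. M p (k, Suc m)) else 0))"
  (is "_ \<longleftrightarrow> ?S \<and> ?C")
proof -
  have "mmul (idx \<beta>) (tmat \<beta>) M = mmul (idx \<alpha>) M (tmat \<alpha>) \<longleftrightarrow>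
     (\<forall>k m. shift \<beta> (\<lambda>p. M p (k, m)) = (if (k, Suc m) \<in> idx \<alpha> then (\<lambda>p. M p (k, Suc m)) else 0))"
    unfolding mmul_column[symmetric] by (auto simp: fun_eq_iff mmul_tmat_right)
  moreover have "shift \<beta> (\<lambda>p. M p (k, m)) = (if (k, Suc m) \<in> idx \<alpha> then (\<lambda>p. M p (k, Suc m)) else 0)"
    if ?S "(k, m) \<notin> idx \<alpha>" for k m
  proof -
    have "(\<lambda>p. M p (k, m)) = 0" using that by (auto simp: fun_eq_iff)
    moreover have "shift \<beta> 0 = 0" using os.T_simps(4)[of "idx \<beta>" "tmat \<beta>"] .
    ultimately show ?thesis using that(2) idx_Suc by auto
  qed
  ultimately show ?thesis unfolding is_hom_def by blast
qed

text \<open>Lets matrix identities be verified after composition with an injective map, so that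
  entries of inverse matrices need not be computed.\<close>

lemma inj_hom_cancel:
  assumes inj: "inj_hom \<alpha> f" and s: "\<And>p q. M p q \<noteq> 0 \<Longrightarrow> p \<in> idx \<alpha>" "\<And>p q. N p q \<noteq> 0 \<Longrightarrow> p \<in> idx \<alpha>"
    and eq: "mmul (idx \<alpha>) f M = mmul (idx \<alpha>) f N"
  shows "M = N"
proof (intro ext)
  fix p q
  let ?w = "\<lambda>p. M p q - N p q"
  have "supported ?w (idx \<alpha>)" unfolding supported_def
  proof (intro allI impI)
    fix p assume "M p q - N p q \<noteq> 0"
    then have "M p q \<noteq> 0 \<or> N p q \<noteq> 0" by auto
    then show "p \<in> idx \<alpha>" using s by blast
  qed
  moreover have "mapp (idx \<alpha>) f ?w = (\<lambda>_. 0)"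
    using fun_cong[OF fun_cong[OF eq]] by (simp add: mapp_def mmul_def fun_eq_iff algebra_simps sum_subtractf)
  ultimately have "?w = (\<lambda>_. 0)" using inj unfolding inj_hom_def by blast
  then show "M p q = N p q" by (metis eq_iff_diff_eq_0)
qed

lemma mmul_idmat_left: "(\<And>p q. M p q \<noteq> 0 \<Longrightarrow> p \<in> idx \<alpha>) \<Longrightarrow> mmul (idx \<alpha>) (idmat \<alpha>) M = M"
proof (intro ext)
  fix p r assume s: "\<And>p q. M p q \<noteq> 0 \<Longrightarrow> p \<in> idx \<alpha>"
  have "mmul (idx \<alpha>) (idmat \<alpha>) M p r = (\<Sum>q\<in>idx \<alpha>. if p = q then M q r else 0)"
    unfolding mmul_def by (rule sum.cong) (auto simp: idmat_def)
  also have "\<dots> = M p r" using s[of p r] by (auto simp: finite_idx)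
  finally show "mmul (idx \<alpha>) (idmat \<alpha>) M p r = M p r" .
qed

lemma mmul_idmat_right: "(\<And>p q. M p q \<noteq> 0 \<Longrightarrow> q \<in> idx \<alpha>) \<Longrightarrow> mmul (idx \<alpha>) M (idmat \<alpha>) = M"
proof (intro ext)
  fix p r assume s: "\<And>p q. M p q \<noteq> 0 \<Longrightarrow> q \<in> idx \<alpha>"
  have "mmul (idx \<alpha>) M (idmat \<alpha>) p r = (\<Sum>q\<in>idx \<alpha>. if q = r then M p q else 0)"
    unfolding mmul_def by (rule sum.cong) (auto simp: idmat_def)
  also have "\<dots> = M p r" using s[of p r] by (auto simp: finite_idx)
  finally show "mmul (idx \<alpha>) M (idmat \<alpha>) p r = M p r" .
qed

lemma mmul_supported:
  assumes "\<And>p q. A p q \<noteq> 0 \<Longrightarrow> p \<in> I" "mmul K A B p q \<noteq> 0"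
  shows "p \<in> I"
proof -
  obtain k where "A p k * B k q \<noteq> 0"
    using assms(2) unfolding mmul_def by (rule sum.not_neutral_contains_not_neutral)
  then have "A p k \<noteq> 0" by auto
  then show ?thesis using assms(1) by blast
qed

text \<open>The realizing family forms the columns of \<open>h2\<close>, and preimages of unit
  vectors form its inverse \<open>g2\<close>. Since \<open>f\<close> and \<open>h2\<close> after
  \<open>f'\<close> have the same range, preimages of columns also yield \<open>g1\<close> and
  \<open>h1\<close>. All remaining identities follow by cancelling \<open>h2\<close>,
  \<open>f\<close> or \<open>f'\<close>.\<close>

lemma realizes_iso:
  fixes f f' :: "'k::field mat"
  assumes f: "is_hom \<alpha> \<beta> f" "inj_hom \<alpha> f"
    and r: "os.realizes (idx \<beta>) (tmat \<beta>) (nspace \<beta>) (range (mapp (idx \<alpha>) f)) (\<alpha>', \<beta>', f')"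
  shows "obj_iso (\<alpha>, \<beta>, f) (\<alpha>', \<beta>', f')"
proof -
  let ?I = "idx \<alpha>" and ?J = "idx \<beta>" and ?I' = "idx \<alpha>'" and ?J' = "idx \<beta>'"
  note fin = finite_idx
  have f': "is_hom \<alpha>' \<beta>' f'" "inj_hom \<alpha>' f'" using r by (auto simp only: os.realizes.simps)
  obtain v where v: "\<And>i j. (i, j) \<in> ?J' \<Longrightarrow> shift \<beta> (v (i, j)) = (if (i, Suc j) \<in> ?J' then v (i, Suc j) else 0)"
    "\<And>c q. os.comb ?J' v c = 0 \<Longrightarrow> q \<in> ?J' \<Longrightarrow> c q = 0"
    "nspace \<beta> = range (os.comb ?J' v)" "range (mapp ?I f) = range (\<lambda>a. os.comb ?J' v (mapp ?I' f' a))"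
    using r unfolding os.realizes.simps by metis
  define h2 where "h2 p q = (if q \<in> ?J' then v q p else 0)" for p q
  have comb: "mapp ?J' h2 c = os.comb ?J' v c" for c
    unfolding os.comb_def by (rule ext) (auto simp: mapp_def sum_apply h2_def fscale_def mult.commute intro!: sum.cong)
  have vin: "v q \<in> nspace \<beta>" if "q \<in> ?J'" for q
  proof -
    have "os.comb ?J' v (unit_vec q) = v q"
      unfolding comb[symmetric] using that
      by (auto simp: mapp_def h2_def unit_vec_def fun_eq_iff fin if_distrib cong: if_cong)
    then show ?thesis unfolding v(3) by (metis rangeI)
  qed
  have h2s: "p \<in> ?J \<and> q \<in> ?J'" if "h2 p q \<noteq> 0" for p q
  proof -
    have "q \<in> ?J'" "v q p \<noteq> 0" using that by (auto simp: h2_def split: if_splits)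
    then show ?thesis using vin[of q] unfolding nspace_def supported_def by blast
  qed
  have h2: "is_hom \<beta>' \<beta> h2" unfolding is_hom_columns
  proof (intro conjI allI impI)
    fix k m assume km: "(k, m) \<in> ?J'"
    then have "(\<lambda>p. h2 p (k, m)) = v (k, m)" by (auto simp: h2_def)
    then show "shift \<beta> (\<lambda>p. h2 p (k, m)) = (if (k, Suc m) \<in> ?J' then \<lambda>p. h2 p (k, Suc m) else 0)"
      using v(1)[OF km] by (auto simp: h2_def)
  qed (use h2s in auto)
  have ih2: "inj_hom \<beta>' h2" unfolding inj_hom_def
  proof (intro allI impI ext)
    fix c q assume c: "supported c ?J'" "mapp ?J' h2 c = (\<lambda>_. 0)"
    then have "os.comb ?J' v c = 0" unfolding comb by (simp add: fun_eq_iff)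
    then show "c q = 0" using v(2) c(1) unfolding supported_def by blast
  qed
  have "\<exists>c. mapp ?J' h2 c = unit_vec p" if "p \<in> ?J" for p
  proof -
    have "(unit_vec p :: _ \<Rightarrow> 'k) \<in> nspace \<beta>" using that by (auto simp: nspace_def supported_def unit_vec_def)
    then obtain c where "unit_vec p = os.comb ?J' v c" unfolding v(3) by blast
    then show ?thesis unfolding comb by metis
  qed
  then obtain c where c: "\<And>p. p \<in> ?J \<Longrightarrow> mapp ?J' h2 (c p) = unit_vec p" by metis
  define g2 where "g2 q p = (if p \<in> ?J \<and> q \<in> ?J' then c p q else 0)" for q p
  have g2s: "p \<in> ?J \<and> q \<in> ?J'" if "g2 q p \<noteq> 0" for p q using that unfolding g2_def by (auto split: if_splits)
  have hg2: "mmul ?J' h2 g2 = idmat \<beta>"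
  proof (intro ext)
    fix p r
    show "mmul ?J' h2 g2 p r = idmat \<beta> p r"
    proof (cases "r \<in> ?J")
      case True
      have "(\<lambda>p. mmul ?J' h2 g2 p r) = mapp ?J' h2 (c r)"
        unfolding mmul_column by (rule mapp_cong) (simp add: g2_def True)
      from fun_cong[OF this, of p] show ?thesis using c[OF True] True by (auto simp: unit_vec_def idmat_def)
    next
      case False
      then have "mmul ?J' h2 g2 p r = 0" by (simp add: mmul_def g2_def)
      then show ?thesis using False by (auto simp: idmat_def)
    qed
  qed
  have idmat_s: "idmat \<gamma> p q \<noteq> 0 \<Longrightarrow> p \<in> idx \<gamma> \<and> q \<in> idx \<gamma>" for \<gamma> p q by (auto simp: idmat_def split: if_splits)
  have tmat_s: "tmat \<gamma> p q \<noteq> 0 \<Longrightarrow> p \<in> idx \<gamma> \<and> q \<in> idx \<gamma>" for \<gamma> p q by (auto simp: tmat_def split: if_splits)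
  have gh2: "mmul ?J g2 h2 = idmat \<beta>'"
  proof (rule inj_hom_cancel[OF ih2])
    have "mmul ?J' h2 (mmul ?J g2 h2) = mmul ?J (mmul ?J' h2 g2) h2" by (simp add: mmul_assoc fin)
    also have "\<dots> = h2" unfolding hg2 by (rule mmul_idmat_left) (use h2s in blast)
    also have "\<dots> = mmul ?J' h2 (idmat \<beta>')" by (rule mmul_idmat_right[symmetric]) (use h2s in blast)
    finally show "mmul ?J' h2 (mmul ?J g2 h2) = mmul ?J' h2 (idmat \<beta>')" .
  next
    show "p \<in> ?J'" if "mmul ?J g2 h2 p q \<noteq> 0" for p q
      by (rule mmul_supported[OF _ that]) (use g2s in blast)
  qed (use idmat_s in blast)
  have fs: "p \<in> ?J \<and> q \<in> ?I" if "f p q \<noteq> 0" for p q using f(1) that unfolding is_hom_def by blast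
  have f's: "p \<in> ?J' \<and> q \<in> ?I'" if "f' p q \<noteq> 0" for p q using f'(1) that unfolding is_hom_def by blast
  have Tf: "mmul ?J (tmat \<beta>) f = mmul ?I f (tmat \<alpha>)" "mmul ?J' (tmat \<beta>') f' = mmul ?I' f' (tmat \<alpha>')"
    "mmul ?J (tmat \<beta>) h2 = mmul ?J' h2 (tmat \<beta>')"
    using f(1) f'(1) h2 unfolding is_hom_def by blast+
  have Tg2: "mmul ?J' (tmat \<beta>') g2 = mmul ?J g2 (tmat \<beta>)"
  proof (rule inj_hom_cancel[OF ih2])
    have "mmul ?J' h2 (mmul ?J' (tmat \<beta>') g2) = mmul ?J' (mmul ?J (tmat \<beta>) h2) g2"
      unfolding Tf by (simp add: mmul_assoc fin)
    also have "\<dots> = mmul ?J (tmat \<beta>) (idmat \<beta>)" by (simp add: mmul_assoc[symmetric] fin hg2)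
    also have "\<dots> = tmat \<beta>" by (rule mmul_idmat_right) (use tmat_s in blast)
    also have "\<dots> = mmul ?J (idmat \<beta>) (tmat \<beta>)" by (rule mmul_idmat_left[symmetric]) (use tmat_s in blast)
    also have "\<dots> = mmul ?J' h2 (mmul ?J g2 (tmat \<beta>))" unfolding hg2[symmetric] by (simp add: mmul_assoc fin)
    finally show "mmul ?J' h2 (mmul ?J' (tmat \<beta>') g2) = mmul ?J' h2 (mmul ?J g2 (tmat \<beta>))" .
  next
    show "p \<in> ?J'" if "mmul ?J' (tmat \<beta>') g2 p q \<noteq> 0" for p q
      by (rule mmul_supported[OF _ that]) (use tmat_s in blast)
    show "p \<in> ?J'" if "mmul ?J g2 (tmat \<beta>) p q \<noteq> 0" for p q
      by (rule mmul_supported[OF _ that]) (use g2s in blast)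
  qed
  have g2: "is_hom \<beta> \<beta>' g2" unfolding is_hom_def using Tg2 g2s by auto
  have "\<exists>a. mapp ?J' h2 (mapp ?I' f' a) = (\<lambda>p. f p q)" if "q \<in> ?I" for q
  proof -
    have "mapp ?I f (unit_vec q) = (\<lambda>p. f p q)"
      using that by (auto simp: mapp_def unit_vec_def fun_eq_iff fin if_distrib cong: if_cong)
    then have "(\<lambda>p. f p q) \<in> range (mapp ?I f)" by (metis rangeI)
    then obtain a where "(\<lambda>p. f p q) = os.comb ?J' v (mapp ?I' f' a)" unfolding v(4) by blast
    then show ?thesis unfolding comb by metis
  qed
  then obtain a where a: "\<And>q. q \<in> ?I \<Longrightarrow> mapp ?J' h2 (mapp ?I' f' (a q)) = (\<lambda>p. f p q)" by metis
  define g1 where "g1 r q = (if q \<in> ?I \<and> r \<in> ?I' then a q r else 0)" for r q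
  have g1s: "p \<in> ?I' \<and> q \<in> ?I" if "g1 p q \<noteq> 0" for p q using that unfolding g1_def by (auto split: if_splits)
  have hfg: "mmul ?J' h2 (mmul ?I' f' g1) = f"
  proof (intro ext)
    fix p q
    show "mmul ?J' h2 (mmul ?I' f' g1) p q = f p q"
    proof (cases "q \<in> ?I")
      case True
      have "(\<lambda>p. mmul ?J' h2 (mmul ?I' f' g1) p q) = mapp ?J' h2 (mapp ?I' f' (\<lambda>r. g1 r q))"
        by (simp add: mmul_column)
      also have "mapp ?I' f' (\<lambda>r. g1 r q) = mapp ?I' f' (a q)" by (rule mapp_cong) (simp add: g1_def True)
      finally have "(\<lambda>p. mmul ?J' h2 (mmul ?I' f' g1) p q) = (\<lambda>p. f p q)" using a[OF True] by simp
      from fun_cong[OF this, of p] show ?thesis .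
    next
      case False
      then have "f p q = 0" using fs by blast
      moreover have "mmul ?J' h2 (mmul ?I' f' g1) p q = 0" using False by (simp add: mmul_def g1_def)
      ultimately show ?thesis by simp
    qed
  qed
  have sq1: "mmul ?I' f' g1 = mmul ?J g2 f"
  proof (rule inj_hom_cancel[OF ih2])
    have "mmul ?J' h2 (mmul ?J g2 f) = mmul ?J (idmat \<beta>) f" unfolding hg2[symmetric] by (simp add: mmul_assoc fin)
    also have "\<dots> = f" by (rule mmul_idmat_left) (use fs in blast)
    finally show "mmul ?J' h2 (mmul ?I' f' g1) = mmul ?J' h2 (mmul ?J g2 f)" unfolding hfg by simp
  next
    show "p \<in> ?J'" if "mmul ?I' f' g1 p q \<noteq> 0" for p q
      by (rule mmul_supported[OF _ that]) (use f's in blast)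
    show "p \<in> ?J'" if "mmul ?J g2 f p q \<noteq> 0" for p q
      by (rule mmul_supported[OF _ that]) (use g2s in blast)
  qed
  have "\<exists>a. mapp ?I f a = mapp ?J' h2 (\<lambda>p. f' p r)" if "r \<in> ?I'" for r
  proof -
    have "mapp ?I' f' (unit_vec r) = (\<lambda>p. f' p r)"
      using that by (auto simp: mapp_def unit_vec_def fun_eq_iff fin if_distrib cong: if_cong)
    then have "mapp ?J' h2 (\<lambda>p. f' p r) \<in> range (mapp ?I f)" unfolding v(4) comb by (metis rangeI)
    then obtain a where "mapp ?J' h2 (\<lambda>p. f' p r) = mapp ?I f a" by blast
    then show ?thesis by metis
  qed
  then obtain b where b: "\<And>r. r \<in> ?I' \<Longrightarrow> mapp ?I f (b r) = mapp ?J' h2 (\<lambda>p. f' p r)" by metis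
  define h1 where "h1 q r = (if q \<in> ?I \<and> r \<in> ?I' then b r q else 0)" for q r
  have h1s: "p \<in> ?I \<and> q \<in> ?I'" if "h1 p q \<noteq> 0" for p q using that unfolding h1_def by (auto split: if_splits)
  have sq2: "mmul ?I f h1 = mmul ?J' h2 f'"
  proof (intro ext)
    fix p r
    show "mmul ?I f h1 p r = mmul ?J' h2 f' p r"
    proof (cases "r \<in> ?I'")
      case True
      have "(\<lambda>p. mmul ?I f h1 p r) = mapp ?I f (b r)"
        unfolding mmul_column by (rule mapp_cong) (simp add: h1_def True)
      then have "(\<lambda>p. mmul ?I f h1 p r) = (\<lambda>p. mmul ?J' h2 f' p r)" using b[OF True] unfolding mmul_column by simp
      from fun_cong[OF this, of p] show ?thesis .
    next
      case False
      have "f' q r = 0" for q using f's[of q r] False by blast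
      then show ?thesis using False by (simp add: mmul_def h1_def)
    qed
  qed
  have hg1: "mmul ?I' h1 g1 = idmat \<alpha>"
  proof (rule inj_hom_cancel[OF f(2)])
    have "mmul ?I f (mmul ?I' h1 g1) = mmul ?I' (mmul ?I f h1) g1" by (simp add: mmul_assoc fin)
    also have "\<dots> = f" unfolding sq2 by (simp add: mmul_assoc[symmetric] fin hfg)
    also have "\<dots> = mmul ?I f (idmat \<alpha>)" by (rule mmul_idmat_right[symmetric]) (use fs in blast)
    finally show "mmul ?I f (mmul ?I' h1 g1) = mmul ?I f (idmat \<alpha>)" .
  next
    show "p \<in> ?I" if "mmul ?I' h1 g1 p q \<noteq> 0" for p q
      by (rule mmul_supported[OF _ that]) (use h1s in blast)
  qed (use idmat_s in blast)
  have gh1: "mmul ?I g1 h1 = idmat \<alpha>'"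
  proof (rule inj_hom_cancel[OF f'(2)])
    have "mmul ?I' f' (mmul ?I g1 h1) = mmul ?I (mmul ?I' f' g1) h1" by (simp add: mmul_assoc fin)
    also have "\<dots> = mmul ?J g2 (mmul ?I f h1)" unfolding sq1 by (simp add: mmul_assoc[symmetric] fin)
    also have "\<dots> = mmul ?J' (mmul ?J g2 h2) f'" unfolding sq2 by (simp add: mmul_assoc fin)
    also have "\<dots> = f'" unfolding gh2 by (rule mmul_idmat_left) (use f's in blast)
    also have "\<dots> = mmul ?I' f' (idmat \<alpha>')" by (rule mmul_idmat_right[symmetric]) (use f's in blast)
    finally show "mmul ?I' f' (mmul ?I g1 h1) = mmul ?I' f' (idmat \<alpha>')" .
  next
    show "p \<in> ?I'" if "mmul ?I g1 h1 p q \<noteq> 0" for p q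
      by (rule mmul_supported[OF _ that]) (use g1s in blast)
  qed (use idmat_s in blast)
  have "mmul ?I' (tmat \<alpha>') g1 = mmul ?I g1 (tmat \<alpha>)"
  proof (rule inj_hom_cancel[OF f'(2)])
    have "mmul ?I' f' (mmul ?I' (tmat \<alpha>') g1) = mmul ?J' (tmat \<beta>') (mmul ?I' f' g1)"
      unfolding mmul_assoc[OF fin fin] Tf ..
    also have "\<dots> = mmul ?J (mmul ?J' (tmat \<beta>') g2) f" unfolding sq1 by (simp add: mmul_assoc fin)
    also have "\<dots> = mmul ?J g2 (mmul ?I f (tmat \<alpha>))" unfolding Tg2 Tf(1)[symmetric] by (simp add: mmul_assoc fin)
    also have "\<dots> = mmul ?I' f' (mmul ?I g1 (tmat \<alpha>))" unfolding mmul_assoc[OF fin fin] sq1 ..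
    finally show "mmul ?I' f' (mmul ?I' (tmat \<alpha>') g1) = mmul ?I' f' (mmul ?I g1 (tmat \<alpha>))" .
  next
    show "p \<in> ?I'" if "mmul ?I' (tmat \<alpha>') g1 p q \<noteq> 0" for p q
      by (rule mmul_supported[OF _ that]) (use tmat_s in blast)
    show "p \<in> ?I'" if "mmul ?I g1 (tmat \<alpha>) p q \<noteq> 0" for p q
      by (rule mmul_supported[OF _ that]) (use g1s in blast)
  qed
  then have g1: "is_hom \<alpha> \<alpha>' g1" unfolding is_hom_def using g1s by auto
  have "mmul ?I (tmat \<alpha>) h1 = mmul ?I' h1 (tmat \<alpha>')"
  proof (rule inj_hom_cancel[OF f(2)])
    have "mmul ?I f (mmul ?I (tmat \<alpha>) h1) = mmul ?J (tmat \<beta>) (mmul ?I f h1)"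
      unfolding mmul_assoc[OF fin fin] Tf ..
    also have "\<dots> = mmul ?J' (mmul ?J (tmat \<beta>) h2) f'" unfolding sq2 by (simp add: mmul_assoc fin)
    also have "\<dots> = mmul ?J' h2 (mmul ?I' f' (tmat \<alpha>'))" unfolding Tf(3) Tf(2)[symmetric] by (simp add: mmul_assoc fin)
    also have "\<dots> = mmul ?I f (mmul ?I' h1 (tmat \<alpha>'))" unfolding mmul_assoc[OF fin fin] sq2 ..
    finally show "mmul ?I f (mmul ?I (tmat \<alpha>) h1) = mmul ?I f (mmul ?I' h1 (tmat \<alpha>'))" .
  next
    show "p \<in> ?I" if "mmul ?I (tmat \<alpha>) h1 p q \<noteq> 0" for p q
      by (rule mmul_supported[OF _ that]) (use tmat_s in blast)
    show "p \<in> ?I" if "mmul ?I' h1 (tmat \<alpha>') p q \<noteq> 0" for p q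
      by (rule mmul_supported[OF _ that]) (use h1s in blast)
  qed
  then have h1: "is_hom \<alpha>' \<alpha> h1" unfolding is_hom_def using h1s by auto
  show ?thesis unfolding obj_iso.simps is_morph.simps
    using g1 g2 h1 h2 sq1 sq2 hg1 gh1 hg2 gh2 by blast
qed

section \<open>Dimensions of homomorphism spaces\<close>

interpretation hs: vector_space "hom_scale :: 'k::field \<Rightarrow> _"
  by unfold_locales (auto simp: hom_scale_def prod_eq_iff fun_eq_iff algebra_simps)

interpretation fsp: vector_space_pair "fscale :: 'k::field \<Rightarrow> _" "fscale :: 'k::field \<Rightarrow> _"
  by unfold_locales

interpretation hfp: vector_space_pair "hom_scale :: 'k::field \<Rightarrow> _" "fscale :: 'k::field \<Rightarrow> _"
  by unfold_locales

lemma mmul_linear: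
  "mmul I (\<lambda>p q. A p q + B p q) C = (\<lambda>p q. mmul I A C p q + mmul I B C p q)"
  "mmul I D (\<lambda>p q. A p q + B p q) = (\<lambda>p q. mmul I D A p q + mmul I D B p q)"
  "mmul I (\<lambda>p q. c * A p q) C = (\<lambda>p q. c * mmul I A C p q)"
  "mmul I D (\<lambda>p q. c * A p q) = (\<lambda>p q. c * mmul I D A p q)"
  "mmul I (\<lambda>_ _. 0) C = (\<lambda>_ _. 0)" "mmul I D (\<lambda>_ _. 0) = (\<lambda>_ _. 0)"
  unfolding mmul_def
  by (intro ext; simp add: distrib_left distrib_right sum.distrib sum_distrib_left mult.assoc mult.left_commute)+

lemma is_hom_linear:
  "is_hom \<alpha> \<beta> A \<Longrightarrow> is_hom \<alpha> \<beta> B \<Longrightarrow> is_hom \<alpha> \<beta> (\<lambda>p q. A p q + B p q)"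
  "is_hom \<alpha> \<beta> A \<Longrightarrow> is_hom \<alpha> \<beta> (\<lambda>p q. c * A p q)" "is_hom \<alpha> \<beta> (\<lambda>_ _. 0)"
proof -
  assume A: "is_hom \<alpha> \<beta> A"
  show "is_hom \<alpha> \<beta> (\<lambda>p q. c * A p q)" using A unfolding is_hom_def mmul_linear by auto
  assume B: "is_hom \<alpha> \<beta> B"
  have "p \<in> idx \<beta> \<and> q \<in> idx \<alpha>" if "A p q + B p q \<noteq> 0" for p q
  proof -
    have "A p q \<noteq> 0 \<or> B p q \<noteq> 0" using that by auto
    then show ?thesis using A B unfolding is_hom_def by blast
  qed
  then show "is_hom \<alpha> \<beta> (\<lambda>p q. A p q + B p q)" using A B unfolding is_hom_def mmul_linear by auto
qed (auto simp: is_hom_def mmul_linear)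

lemma subspace_Hom: "hs.subspace (Hom X Y)"
proof -
  obtain \<alpha> \<beta> f \<alpha>' \<beta>' f' where XY: "X = (\<alpha>, \<beta>, f)" "Y = (\<alpha>', \<beta>', f')" by (metis prod_cases3)
  show ?thesis
  proof (rule hs.subspaceI)
    show "0 \<in> Hom X Y" unfolding Hom_def XY
      by (simp add: zero_prod_def zero_fun_def is_hom_linear mmul_linear)
  next
    fix g h assume "g \<in> Hom X Y" "h \<in> Hom X Y"
    then show "g + h \<in> Hom X Y" unfolding Hom_def XY
      by (cases g; cases h) (simp add: plus_fun_def is_hom_linear mmul_linear)
  next
    fix c g assume "g \<in> Hom X Y"
    then show "hom_scale c g \<in> Hom X Y" unfolding Hom_def XY
      by (cases g) (simp add: hom_scale_def is_hom_linear mmul_linear)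
  qed
qed

definition mat_unit :: "nat \<times> nat \<Rightarrow> nat \<times> nat \<Rightarrow> 'k::field mat" where
  "mat_unit p q p' q' = (if p' = p \<and> q' = q then 1 else 0)"

lemma sum_mat_unit:
  assumes "\<And>p q. M p q \<noteq> 0 \<Longrightarrow> p \<in> I \<and> q \<in> J" "finite I" "finite J"
  shows "(\<Sum>r\<in>I \<times> J. M (fst r) (snd r) * mat_unit (fst r) (snd r) p q) = M p q"
proof -
  have "(\<Sum>r\<in>I \<times> J. M (fst r) (snd r) * mat_unit (fst r) (snd r) p q) = (\<Sum>r\<in>I \<times> J. if r = (p, q) then M p q else 0)"
    by (rule sum.cong) (auto simp: mat_unit_def)
  also have "\<dots> = M p q" using assms(1)[of p q] assms(2,3) by auto
  finally show ?thesis .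
qed

lemma findim_Hom: "findim hom_scale (Hom X (Y :: 'k::field obj))"
proof -
  obtain \<alpha> \<beta> f \<alpha>' \<beta>' f' where XY: "X = (\<alpha>, \<beta>, f)" "Y = (\<alpha>', \<beta>', f')" by (metis prod_cases3)
  let ?I = "idx \<alpha>' \<times> idx \<alpha>" and ?J = "idx \<beta>' \<times> idx \<beta>"
  define E1 :: "(nat \<times> nat) \<times> (nat \<times> nat) \<Rightarrow> 'k mat \<times> 'k mat" where "E1 r = (mat_unit (fst r) (snd r), \<lambda>_ _. 0)" for r
  define E2 :: "(nat \<times> nat) \<times> (nat \<times> nat) \<Rightarrow> 'k mat \<times> 'k mat" where "E2 r = (\<lambda>_ _. 0, mat_unit (fst r) (snd r))" for r
  have "g \<in> hs.span (E1 ` ?I \<union> E2 ` ?J)" if g: "g \<in> Hom X Y" for g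
  proof -
    obtain M N where MN: "g = (M, N)" by force
    have sup: "M p q \<noteq> 0 \<Longrightarrow> p \<in> idx \<alpha>' \<and> q \<in> idx \<alpha>" "N p q \<noteq> 0 \<Longrightarrow> p \<in> idx \<beta>' \<and> q \<in> idx \<beta>" for p q
      using g unfolding Hom_def XY MN mem_Collect_eq is_morph.simps is_hom_def by blast+
    have "g = (\<Sum>r\<in>?I. hom_scale (M (fst r) (snd r)) (E1 r)) + (\<Sum>r\<in>?J. hom_scale (N (fst r) (snd r)) (E2 r))" (is "_ = ?s + ?t")
    proof (rule prod_eqI)
      have app: "(\<Sum>r\<in>R. h r) p q = (\<Sum>r\<in>R. h r p q)" for R :: "((nat \<times> nat) \<times> (nat \<times> nat)) set" and h :: "_ \<Rightarrow> 'k mat" and p q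
        by (induction R rule: infinite_finite_induct) auto
      have "fst (?s + ?t) p q = (\<Sum>r\<in>?I. M (fst r) (snd r) * mat_unit (fst r) (snd r) p q)" for p q
        by (simp add: fst_sum app hom_scale_def E1_def E2_def)
      moreover have "(\<Sum>r\<in>?I. M (fst r) (snd r) * mat_unit (fst r) (snd r) p q) = M p q" for p q by (rule sum_mat_unit) (use sup finite_idx in auto)
      ultimately have "fst (?s + ?t) = M" by (intro ext) simp
      then show "fst g = fst (?s + ?t)" by (simp add: MN)
      have "snd (?s + ?t) p q = (\<Sum>r\<in>?J. N (fst r) (snd r) * mat_unit (fst r) (snd r) p q)" for p q
        by (simp add: snd_sum app hom_scale_def E1_def E2_def)
      moreover have "(\<Sum>r\<in>?J. N (fst r) (snd r) * mat_unit (fst r) (snd r) p q) = N p q" for p q by (rule sum_mat_unit) (use sup finite_idx in auto)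
      ultimately have "snd (?s + ?t) = N" by (intro ext) simp
      then show "snd g = snd (?s + ?t)" by (simp add: MN)
    qed
    also have "\<dots> \<in> hs.span (E1 ` ?I \<union> E2 ` ?J)"
      by (intro hs.span_add hs.span_sum hs.span_scale hs.span_base) auto
    finally show ?thesis .
  qed
  moreover have "finite (E1 ` ?I \<union> E2 ` ?J)" by (simp add: finite_idx)
  ultimately show ?thesis unfolding findim_def by blast
qed

text \<open>A module map is determined by the first columns of its blocks, and the first column of
  block \<open>k\<close> is killed by T to the power \<alpha>_k. The converse construction is
  \<open>is_hom_of_columns\<close>.\<close>

lemma hom_column_pow:
  assumes "is_hom \<alpha> \<beta> M"
  shows "(shift \<beta> ^^ j) (\<lambda>p. M p (k, 0)) = (if (k, j) \<in> idx \<alpha> then (\<lambda>p. M p (k, j)) else 0)"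
proof (induction j)
  case 0
  have "M p (k, 0) = 0" if "(k, 0) \<notin> idx \<alpha>" for p using assms that unfolding is_hom_def by blast
  then show ?case by (auto simp: fun_eq_iff)
next
  case (Suc j)
  have z: "shift \<beta> 0 = (0 :: nat \<times> nat \<Rightarrow> 'a)" by (rule os.T_simps(4))
  show ?case
  proof (cases "(k, j) \<in> idx \<alpha>")
    case True
    then show ?thesis using Suc.IH assms unfolding is_hom_columns by simp
  next
    case False
    then have "(k, Suc j) \<notin> idx \<alpha>" using idx_Suc by blast
    then show ?thesis using z unfolding funpow.simps comp_apply Suc.IH if_not_P[OF False] by (simp only: if_False)
  qed
qed

lemma is_hom_of_columns:
  assumes "\<And>k m. (k, m) \<in> idx \<alpha> \<Longrightarrow> w (k, m) \<in> nspace \<beta>"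
    and "\<And>k m. (k, m) \<in> idx \<alpha> \<Longrightarrow> shift \<beta> (w (k, m)) = (if (k, Suc m) \<in> idx \<alpha> then w (k, Suc m) else 0)"
  shows "is_hom \<alpha> \<beta> (\<lambda>p q. if q \<in> idx \<alpha> then w q p else 0)"
  unfolding is_hom_columns
proof (intro conjI allI impI)
  fix p q assume a: "(if q \<in> idx \<alpha> then w q p else 0) \<noteq> 0"
  show "q \<in> idx \<alpha>" using a by (auto split: if_splits)
  then have "w q \<in> nspace \<beta>" "w q p \<noteq> 0" using assms(1)[of "fst q" "snd q"] a by auto
  then show "p \<in> idx \<beta>" unfolding nspace_def supported_def by blast
next
  fix k m assume km: "(k, m) \<in> idx \<alpha>"
  then show "shift \<beta> (\<lambda>p. if (k, m) \<in> idx \<alpha> then w (k, m) p else 0) =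
      (if (k, Suc m) \<in> idx \<alpha> then \<lambda>p. if (k, Suc m) \<in> idx \<alpha> then w (k, Suc m) p else 0 else 0)"
    using assms(2)[OF km] by auto
qed

section \<open>Morphisms out of a bipicket\<close>

abbreviation hom_filt :: "nat list \<Rightarrow> nat list \<Rightarrow> 'k::field mat \<Rightarrow> nat \<Rightarrow> nat \<Rightarrow> (nat \<times> nat \<Rightarrow> 'k) set" where
  "hom_filt \<alpha> \<beta> f u v \<equiv> range (mapp (idx \<alpha>) f) \<inter> os.filt (idx \<beta>) (tmat \<beta>) u v (nspace \<beta>)"

text \<open>The image in \<open>B\<close> of the generator of the submodule of the bipicket, under a morphism \<open>g\<close>.\<close>
definition eval_gen :: "nat \<Rightarrow> nat \<Rightarrow> 'k::field mat \<times> 'k mat \<Rightarrow> nat \<times> nat \<Rightarrow> 'k" where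
  "eval_gen u v g = (\<lambda>p. snd g p (0, u) + snd g p (1, v))"

lemma shift_two:
  assumes "\<forall>a\<in>set \<alpha>. a \<le> 2"
  shows "shift \<alpha> (shift \<alpha> w) = 0"
proof
  fix p :: "nat \<times> nat"
  obtain i j where p: "p = (i, j)" by force
  have "j < 2" if "(i, j) \<in> idx \<alpha>" using that assms by (fastforce simp: idx_iff dest: nth_mem)
  then show "shift \<alpha> (shift \<alpha> w) p = 0 p" unfolding p by (auto simp: shift_apply less_2_cases_iff)
qed

text \<open>Rank and nullity of evaluation at the generator. Since \<open>f\<close> is injective, a
  morphism in the kernel has zero first component; the kernel is therefore a space of maps into
  N_\<beta> in which \<open>f\<close> no longer occurs, the same for two objects with equal
  \<beta>.\<close>

lemma dimHom_bipicket:
  fixes f :: "'k::field mat"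
  assumes Y: "obj_S2 (\<alpha>, \<beta>, f)" and vu: "v < u"
  shows "dimHom (bipicket (u + 2) (v + 1)) (\<alpha>, \<beta>, f) = fs.dim (hom_filt \<alpha> \<beta> f u v)
    + hs.dim {g :: 'k mat \<times> 'k mat. fst g = (\<lambda>_ _. 0) \<and> is_hom [u + 2, v + 1] \<beta> (snd g) \<and> eval_gen u v g = 0}"
proof -
  have f: "is_hom \<alpha> \<beta> f" "inj_hom \<alpha> f" "\<forall>a\<in>set \<alpha>. a \<le> 2" using Y by auto
  obtain \<alpha>0 \<beta>0 \<delta> where X: "bipicket (u + 2) (v + 1) = (\<alpha>0, \<beta>0, \<delta> :: 'k mat)" by (metis prod_cases3)
  have \<delta>: "\<alpha>0 = [2]" "\<beta>0 = [u + 2, v + 1]" "\<delta> = (\<lambda>p q. if q \<in> idx [2] \<and> p \<in> idx [u + 2, v + 1] \<and>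
      (p = (0, u + 2 - 2 + snd q) \<or> p = (1, v + 1 - 1 + snd q)) then 1 else 0)"
    using X unfolding bipicket_def by auto
  let ?X = "([2], [u + 2, v + 1], \<delta>)" and ?I = "idx \<alpha>" and ?J = "idx [u + 2, v + 1]"
  have \<delta>0: "mmul ?J N \<delta> p (0, 0) = N p (0, u) + N p (1, v)" for N p
  proof -
    have "mmul ?J N \<delta> p (0, 0) = (\<Sum>j<u + 2. if j = u then N p (0, u) else 0) + (\<Sum>j<v + 1. if j = v then N p (1, v) else 0)"
      unfolding mmul_def sum_idx_pair \<delta>(3)
      by (intro arg_cong2[of _ _ _ _ "(+)"] sum.cong) (auto simp: idx_single_iff idx_pair_iff)
    then show ?thesis by simp
  qed
  have \<delta>1: "mmul ?J N \<delta> p (0, 1) = N p (0, Suc u)" for N p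
  proof -
    have "mmul ?J N \<delta> p (0, 1) = (\<Sum>j<u + 2. if j = Suc u then N p (0, Suc u) else 0) + (\<Sum>j<v + 1. 0)"
      unfolding mmul_def sum_idx_pair \<delta>(3)
      by (intro arg_cong2[of _ _ _ _ "(+)"] sum.cong) (auto simp: idx_single_iff idx_pair_iff)
    then show ?thesis by simp
  qed
  have \<delta>2: "mmul ?J N \<delta> p q = 0" if "q \<notin> idx [2]" for N p q
    using that by (simp add: mmul_def \<delta>(3))
  have idx2: "q \<in> idx [2] \<longleftrightarrow> q = (0, 0) \<or> q = (0, 1)" for q
    by (cases q) (auto simp: idx_single_iff less_2_cases_iff)
  have idx2_eq: "idx [2] = {(0, 0), (0, 1)}"
  proof (rule set_eqI)
    fix q show "q \<in> idx [2] \<longleftrightarrow> q \<in> {(0, 0), (0, 1)}" unfolding idx2 by blast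
  qed
  have Hom: "(M, N) \<in> Hom ?X (\<alpha>, \<beta>, f) \<longleftrightarrow> is_hom [2] \<alpha> M \<and> is_hom [u + 2, v + 1] \<beta> N \<and>
      mapp ?I f (\<lambda>p. M p (0, 0)) = eval_gen u v (M, N) \<and> mapp ?I f (\<lambda>p. M p (0, 1)) = (\<lambda>p. N p (0, Suc u))" for M N
  proof -
    have e: "(\<lambda>p. mmul ?J N \<delta> p (0, 0)) = eval_gen u v (M, N)" "(\<lambda>p. mmul ?J N \<delta> p (0, 1)) = (\<lambda>p. N p (0, Suc u))"
      unfolding \<delta>0 \<delta>1 eval_gen_def by simp_all
    have "mmul ?I f M = mmul ?J N \<delta> \<longleftrightarrow>
        mapp ?I f (\<lambda>p. M p (0, 0)) = eval_gen u v (M, N) \<and> mapp ?I f (\<lambda>p. M p (0, 1)) = (\<lambda>p. N p (0, Suc u))"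
      if M: "is_hom [2] \<alpha> M"
    proof -
      have M0: "M r q = 0" if "q \<notin> idx [2]" for r q using M that unfolding is_hom_def by blast
      have "mmul ?I f M p q = mmul ?J N \<delta> p q" if "q \<notin> idx [2]" for p q
        using \<delta>2[OF that] M0[OF that] by (simp add: mmul_def)
      then have "mmul ?I f M = mmul ?J N \<delta> \<longleftrightarrow> (\<forall>q\<in>idx [2]. (\<lambda>p. mmul ?I f M p q) = (\<lambda>p. mmul ?J N \<delta> p q))"
        by (metis ext)
      also have "\<dots> \<longleftrightarrow> (\<lambda>p. mmul ?I f M p (0, 0)) = (\<lambda>p. mmul ?J N \<delta> p (0, 0)) \<and>
          (\<lambda>p. mmul ?I f M p (0, 1)) = (\<lambda>p. mmul ?J N \<delta> p (0, 1))"
        unfolding idx2_eq by (simp only: ball_simps simp_thms)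
      finally show ?thesis unfolding e mmul_column .
    qed
    then show ?thesis unfolding Hom_def mem_Collect_eq is_morph.simps by blast
  qed
  let ?H = "Hom ?X (\<alpha>, \<beta>, f)"
  have lin: "Vector_Spaces.linear hom_scale fscale (eval_gen u v)"
    unfolding Vector_Spaces.linear_iff
    by (auto simp: eval_gen_def hom_scale_def fscale_def fun_eq_iff algebra_simps
        hs.vector_space_axioms fs.vector_space_axioms)
  have im: "eval_gen u v ` ?H = hom_filt \<alpha> \<beta> f u v"
  proof (intro set_eqI iffI)
    fix z assume "z \<in> eval_gen u v ` ?H"
    then obtain M N where MN: "z = eval_gen u v (M, N)" "is_hom [u + 2, v + 1] \<beta> N"
      "mapp ?I f (\<lambda>p. M p (0, 0)) = eval_gen u v (M, N)" using Hom by auto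
    have N: "(\<lambda>p. N p q) \<in> nspace \<beta>" for q
      using MN(2) unfolding is_hom_def nspace_def supported_def by blast
    note c = hom_column_pow[OF MN(2)]
    have "z = (shift \<beta> ^^ u) (\<lambda>p. N p (0, 0)) + (shift \<beta> ^^ v) (\<lambda>p. N p (1, 0))"
      unfolding MN(1) c eval_gen_def by (auto simp: idx_pair_iff)
    moreover have "(shift \<beta> ^^ (u + 2)) (\<lambda>p. N p (0, 0)) = 0" "(shift \<beta> ^^ (v + 1)) (\<lambda>p. N p (1, 0)) = 0"
      unfolding c by (auto simp: idx_pair_iff)
    ultimately have "z \<in> os.filt (idx \<beta>) (tmat \<beta>) u v (nspace \<beta>)" using os.filtI[OF N N] by metis
    moreover have "z \<in> range (mapp ?I f)" using MN(1,3) by (metis rangeI)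
    ultimately show "z \<in> hom_filt \<alpha> \<beta> f u v" by blast
  next
    fix z assume z: "z \<in> hom_filt \<alpha> \<beta> f u v"
    then obtain a where a: "a \<in> nspace \<alpha>" "z = mapp ?I f a" unfolding hom_range by blast
    obtain b c where bc: "b \<in> nspace \<beta>" "c \<in> nspace \<beta>" "z = (shift \<beta> ^^ u) b + (shift \<beta> ^^ v) c"
      "(shift \<beta> ^^ (u + 2)) b = 0" "(shift \<beta> ^^ (v + 1)) c = 0"
      using z unfolding os.filt_def by blast
    \<comment> \<open>The morphism is built from preimages: \<open>a\<close> is the image of the
      generator of N_(2), and \<open>b\<close>, \<open>c\<close> are those of the two generators of
      N_(u+2,v+1). The columns are their \<open>T\<close>-orbits.\<close>
    define w1 where "w1 q = (if q = (0, 0) then a else shift \<alpha> a)" for q :: "nat \<times> nat"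
    define w2 where "w2 q = (if fst q = 0 then (shift \<beta> ^^ snd q) b else (shift \<beta> ^^ snd q) c)" for q :: "nat \<times> nat"
    define M where "M = (\<lambda>p q. if q \<in> idx [2] then w1 q p else 0)"
    define N where "N = (\<lambda>p q. if q \<in> ?J then w2 q p else 0)"
    have M: "is_hom [2] \<alpha> M" unfolding M_def
    proof (rule is_hom_of_columns)
      fix k m assume km: "(k, m) \<in> idx [2]"
      then show "w1 (k, m) \<in> nspace \<alpha>" using a(1) shift_in by (auto simp: w1_def)
      show "shift \<alpha> (w1 (k, m)) = (if (k, Suc m) \<in> idx [2] then w1 (k, Suc m) else 0)"
        using km shift_two[OF f(3), of a] by (auto simp: idx2 w1_def)
    qed
    have pin: "(shift \<beta> ^^ j) x \<in> nspace \<beta>" if "x \<in> nspace \<beta>" for j and x :: "nat \<times> nat \<Rightarrow> 'k"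
      using os.pow_in[of "idx \<beta>" "tmat \<beta>" "nspace \<beta>"] shift_in that by (metis image_subsetI)
    have N: "is_hom [u + 2, v + 1] \<beta> N" unfolding N_def
    proof (rule is_hom_of_columns)
      fix k m assume km: "(k, m) \<in> ?J"
      show "w2 (k, m) \<in> nspace \<beta>" using pin bc(1,2) by (simp add: w2_def)
      have "shift \<beta> (w2 (k, m)) = w2 (k, Suc m)" by (simp add: w2_def)
      moreover have "w2 (k, Suc m) = 0" if "(k, Suc m) \<notin> ?J"
      proof -
        have "(k = 0 \<and> Suc m = u + 2) \<or> (k = 1 \<and> Suc m = v + 1)"
          using that km unfolding idx_pair_iff by auto
        then show ?thesis using bc(4,5) unfolding w2_def fst_conv snd_conv by auto
      qed
      ultimately show "shift \<beta> (w2 (k, m)) = (if (k, Suc m) \<in> ?J then w2 (k, Suc m) else 0)" by simp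
    qed
    have ev: "eval_gen u v (M, N) = z"
      unfolding eval_gen_def bc(3) N_def w2_def by (auto simp: idx_pair_iff)
    have M0: "(\<lambda>p. M p (0, 0)) = a" "(\<lambda>p. M p (0, 1)) = shift \<alpha> a" unfolding M_def w1_def by (auto simp: idx2)
    \<comment> \<open>Commutation at the second basis vector of N_(2): the part of \<open>c\<close>
      dies because T^(v+1) c = 0, leaving the column at \<open>(0, Suc u)\<close>.\<close>
    have "shift \<beta> z = (shift \<beta> ^^ Suc u) b + (shift \<beta> ^^ Suc v) c"
      unfolding bc(3) os.T_simps os.T_pow ..
    also have "\<dots> = (\<lambda>p. N p (0, Suc u))" using bc(5) unfolding N_def w2_def by (auto simp: idx_pair_iff fun_eq_iff)
    finally have "mapp ?I f (shift \<alpha> a) = (\<lambda>p. N p (0, Suc u))" unfolding a(2) hom_shift[OF f(1)] .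
    then have "(M, N) \<in> ?H" unfolding Hom M0 ev using M N a(2) by simp
    then show "z \<in> eval_gen u v ` ?H" using ev by (metis imageI)
  qed
  have ker: "{g \<in> ?H. eval_gen u v g = 0} = {g. fst g = (\<lambda>_ _. 0) \<and> is_hom [u + 2, v + 1] \<beta> (snd g) \<and> eval_gen u v g = 0}"
  proof (intro set_eqI iffI)
    fix g assume "g \<in> {g \<in> ?H. eval_gen u v g = 0}"
    then obtain M N where g: "g = (M, N)" "(M, N) \<in> ?H" "eval_gen u v (M, N) = 0" by (cases g) auto
    then have h: "is_hom [2] \<alpha> M" "is_hom [u + 2, v + 1] \<beta> N" "mapp ?I f (\<lambda>p. M p (0, 0)) = 0"
      unfolding Hom by auto
    have "supported (\<lambda>p. M p (0, 0)) ?I" using h(1) unfolding is_hom_def supported_def by blast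
    then have M0: "(\<lambda>p. M p (0, 0)) = (\<lambda>_. 0)" using f(2) h(3) unfolding inj_hom_def zero_fun_def by blast
    have "(\<lambda>p. M p (0, 1)) = shift \<alpha> (\<lambda>p. M p (0, 0))"
      using h(1) unfolding is_hom_columns by (simp add: idx2)
    also have "\<dots> = (\<lambda>_. 0)" unfolding M0 by (rule ext) (simp add: mapp_def)
    finally have "M p q = 0" for p q
      using M0 h(1) idx2[of q] unfolding is_hom_def by (metis)
    then have "M = (\<lambda>_ _. 0)" by (intro ext)
    then show "g \<in> {g. fst g = (\<lambda>_ _. 0) \<and> is_hom [u + 2, v + 1] \<beta> (snd g) \<and> eval_gen u v g = 0}"
      using g h by simp
  next
    fix g :: "'k mat \<times> 'k mat" assume "g \<in> {g. fst g = (\<lambda>_ _. 0) \<and> is_hom [u + 2, v + 1] \<beta> (snd g) \<and> eval_gen u v g = 0}"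
    then obtain N where g: "g = (\<lambda>_ _. 0, N)" "is_hom [u + 2, v + 1] \<beta> N" "eval_gen u v (\<lambda>_ _. 0, N) = 0" by (cases g) auto
    note c = g(2)[unfolded is_hom_columns, THEN conjunct2, rule_format]
    have "shift \<beta> (\<lambda>p. N p (0, u)) = (\<lambda>p. N p (0, Suc u))" "shift \<beta> (\<lambda>p. N p (1, v)) = 0"
      using c[of 0 u] c[of 1 v] by (auto simp: idx_pair_iff)
    \<comment> \<open>With zero first component, commutation requires both values on N_(2) to
      vanish. The second is \<open>T\<close> applied to the first, which is zero by
      assumption.\<close>
    then have "(\<lambda>p. N p (0, Suc u)) = shift \<beta> ((\<lambda>p. N p (0, u)) + (\<lambda>p. N p (1, v)))"
      unfolding os.T_simps by simp
    also have "(\<lambda>p. N p (0, u)) + (\<lambda>p. N p (1, v)) = 0" using g(3) by (simp add: eval_gen_def plus_fun_def)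
    finally have "(\<lambda>p. N p (0, Suc u)) = 0" unfolding os.T_simps .
    moreover have "mapp ?I f (\<lambda>_. 0) = 0" by (rule ext) (simp add: mapp_def)
    ultimately have "g \<in> ?H" unfolding g(1) Hom using g(2,3) is_hom_linear(3) by auto
    then show "g \<in> {g \<in> ?H. eval_gen u v g = 0}" using g by simp
  qed
  have "dimHom (bipicket (u + 2) (v + 1)) (\<alpha>, \<beta>, f) = hs.dim ?H"
    unfolding dimHom_def X \<delta>(1,2) ..
  also have "\<dots> = fs.dim (eval_gen u v ` ?H) + hs.dim {g \<in> ?H. eval_gen u v g = 0}"
    by (rule hfp.rank_nullity[OF lin subspace_Hom findim_Hom])
  finally show ?thesis unfolding im ker .
qed

section \<open>Invariants of an object fixed by its partition type\<close>

lemma nil_shift: "\<exists>n. \<forall>b\<in>nspace \<beta>. (shift \<beta> ^^ n) b = (0 :: nat \<times> nat \<Rightarrow> 'k::field)"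
proof -
  have "b \<le> sum_list \<beta>" if "b \<in> set \<beta>" for b using that by (auto intro: member_le_sum_list)
  then show ?thesis using shift_nilpotent by blast
qed

lemma sub_pair_obj:
  assumes "obj_S2 (\<alpha>, \<beta>, f :: 'k::field mat)"
  shows "os.sub_pair (idx \<beta>) (tmat \<beta>) (nspace \<beta>) (range (mapp (idx \<alpha>) f))"
proof -
  have f: "is_hom \<alpha> \<beta> f" "\<forall>a\<in>set \<alpha>. a \<le> 2" using assms by auto
  interpret l: Vector_Spaces.linear fscale fscale "mapp (idx \<alpha>) f" by (rule linear_mapp)
  have s: "fs.subspace (range (mapp (idx \<alpha>) f))" by (rule l.subspace_image) (rule fs.subspace_UNIV)
  have "shift \<beta> a \<in> range (mapp (idx \<alpha>) f) \<and> shift \<beta> (shift \<beta> a) = 0" if "a \<in> range (mapp (idx \<alpha>) f)" for a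
  proof -
    obtain w where w: "a = mapp (idx \<alpha>) f w" using \<open>a \<in> _\<close> by blast
    have "shift \<beta> (shift \<beta> a) = mapp (idx \<alpha>) f 0"
      unfolding w hom_shift[OF f(1)] shift_two[OF f(2)] ..
    moreover have "mapp (idx \<alpha>) f 0 = 0" by (rule l.zero)
    ultimately show ?thesis unfolding w hom_shift[OF f(1)] by simp
  qed
  then show ?thesis unfolding os.sub_pair_def using s subspace_nspace shift_in hom_in[OF f(1)] by blast
qed

lemma exists_diagram:
  assumes Y: "obj_S2 (\<alpha>, \<beta>, f :: 'k::field mat)"
  obtains L where "arc_diagram (\<alpha>, \<beta>, f) (diagram_of L)" "\<forall>s\<in>set L. valid_summand s"
    "\<And>u v. v \<le> u \<Longrightarrow> fs.dim (hom_filt \<alpha> \<beta> f u v) = mark u v (diagram_of L)"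
proof -
  have f: "is_hom \<alpha> \<beta> f" "inj_hom \<alpha> f" using Y by auto
  note sp = sub_pair_obj[OF Y]
  obtain L where L: "os.decomposition (idx \<beta>) (tmat \<beta>) L (nspace \<beta>) (range (mapp (idx \<alpha>) f))"
    "\<forall>s\<in>set L. valid_summand s"
    using os.exists_decomposition[OF sp findim_nspace nil_shift] by blast
  obtain \<alpha>' \<beta>' f' where S: "sum_obj L = (\<alpha>', \<beta>', f' :: 'k mat)" by (metis prod_cases3)
  have "obj_iso (\<alpha>, \<beta>, f) (sum_obj L)"
    using realizes_iso[OF f] os.realizes_decomposition[OF L(1)] unfolding S by blast
  then have "arc_diagram (\<alpha>, \<beta>, f) (diagram_of L)" unfolding arc_diagram_def using L(2) by blast
  then show thesis using that L(2) os.decomposition_mark[OF L(1) sp findim_nspace] by blast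
qed

text \<open>As T^2 kills the submodule, its intersection with \<open>filt u u\<close> is its
  intersection with T^u N_\<beta>. This is the kernel of the surjection from T^u N_\<beta> to T^u
  N_\<gamma> induced by the cokernel map, so its dimension depends only on \<beta> and
  \<gamma>.\<close>

lemma dim_filt_diag:
  fixes f :: "'k::field mat"
  assumes Y: "obj_S2 (\<alpha>, \<beta>, f)" and c: "coker_is (\<alpha>, \<beta>, f) \<gamma>"
  shows "fs.dim (hom_filt \<alpha> \<beta> f u u) + fs.dim ((shift \<gamma> ^^ u) ` nspace \<gamma> :: (nat \<times> nat \<Rightarrow> 'k) set)
    = fs.dim ((shift \<beta> ^^ u) ` nspace \<beta> :: (nat \<times> nat \<Rightarrow> 'k) set)"
proof -
  have f: "is_hom \<alpha> \<beta> f" using Y by auto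
  obtain g where g: "is_hom \<beta> \<gamma> g" "surj_hom \<beta> \<gamma> g" and ker: "\<And>w. supported w (idx \<beta>) \<Longrightarrow>
      mapp (idx \<beta>) g w = (\<lambda>_. 0) \<longleftrightarrow> (\<exists>v. supported v (idx \<alpha>) \<and> mapp (idx \<alpha>) f v = w)"
    using c by (auto simp only: coker_is.simps)
  let ?S = "(shift \<beta> ^^ u) ` nspace \<beta> :: (nat \<times> nat \<Rightarrow> 'k) set"
  have T: "shift \<beta> ` nspace \<beta> \<subseteq> (nspace \<beta> :: (nat \<times> nat \<Rightarrow> 'k) set)" using shift_in by blast
  have SB: "?S \<subseteq> nspace \<beta>" using os.pow_in[OF T] by blast
  have S: "fs.subspace ?S" by (rule os.subspace_pow_image[OF subspace_nspace])
  have rn: "fs.dim ?S = fs.dim (mapp (idx \<beta>) g ` ?S) + fs.dim {x \<in> ?S. mapp (idx \<beta>) g x = 0}"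
    by (rule fsp.rank_nullity[OF linear_mapp S fs.findim_subset[OF findim_nspace SB]])
  have gT: "mapp (idx \<beta>) g ((shift \<beta> ^^ j) x) = (shift \<gamma> ^^ j) (mapp (idx \<beta>) g x)" for j x
    by (induction j) (simp_all add: hom_shift[OF g(1), symmetric])
  have gB: "mapp (idx \<beta>) g ` nspace \<beta> = nspace \<gamma>"
  proof
    show "mapp (idx \<beta>) g ` nspace \<beta> \<subseteq> nspace \<gamma>" using hom_in[OF g(1)] by blast
    show "nspace \<gamma> \<subseteq> mapp (idx \<beta>) g ` nspace \<beta>"
      using g(2) unfolding surj_hom_def nspace_def by blast
  qed
  have "mapp (idx \<beta>) g ` ?S = (shift \<gamma> ^^ u) ` nspace \<gamma>"
    unfolding gB[symmetric] image_image gT ..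
  moreover have "{x \<in> ?S. mapp (idx \<beta>) g x = 0} = hom_filt \<alpha> \<beta> f u u"
  proof (intro set_eqI iffI)
    fix x assume x: "x \<in> {x \<in> ?S. mapp (idx \<beta>) g x = 0}"
    then have "supported x (idx \<beta>)" using SB unfolding nspace_def by blast
    moreover have "mapp (idx \<beta>) g x = (\<lambda>_. 0)" using x by (simp add: zero_fun_def)
    ultimately obtain w where "mapp (idx \<alpha>) f w = x" using ker by blast
    then have xr: "x \<in> range (mapp (idx \<alpha>) f)" by blast
    obtain b where b: "x = (shift \<beta> ^^ u) b" "b \<in> nspace \<beta>" using x by blast
    have "shift \<beta> (shift \<beta> x) = 0" using sub_pair_obj[OF Y] xr unfolding os.sub_pair_def by blast
    then have "(shift \<beta> ^^ (u + 2)) b = 0" unfolding b(1) by simp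
    then have "(shift \<beta> ^^ u) b + (shift \<beta> ^^ u) 0 \<in> os.filt (idx \<beta>) (tmat \<beta>) u u (nspace \<beta>)"
      by (intro os.filtI b(2) fs.subspace_0[OF subspace_nspace] os.pow_simps(4))
    then show "x \<in> hom_filt \<alpha> \<beta> f u u" using xr unfolding b(1) os.pow_simps by simp
  next
    fix x assume x: "x \<in> hom_filt \<alpha> \<beta> f u u"
    then obtain b c where "x = (shift \<beta> ^^ u) (b + c)" "b \<in> nspace \<beta>" "c \<in> nspace \<beta>"
      unfolding os.filt_def os.pow_simps by blast
    then have xS: "x \<in> ?S" using fs.subspace_add[OF subspace_nspace] by blast
    moreover have "\<exists>v. supported v (idx \<alpha>) \<and> mapp (idx \<alpha>) f v = x"
      using x unfolding hom_range nspace_def by blast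
    ultimately show "x \<in> {x \<in> ?S. mapp (idx \<beta>) g x = 0}"
      using ker[of x] SB unfolding nspace_def by (auto simp: zero_fun_def)
  qed
  ultimately show ?thesis using rn by simp
qed

text \<open>Once T^u vanishes, \<open>filt u 0\<close> is the kernel of \<open>T\<close>, and its
  intersection with the submodule corresponds to the kernel of \<open>T\<close> on N_\<alpha>. The
  dimension thus depends on \<alpha> only; through \<open>mark\<close> it gives the total number of
  arcs and poles.\<close>

lemma dim_filt_socle:
  fixes f :: "'k::field mat"
  assumes Y: "obj_S2 (\<alpha>, \<beta>, f)" and u: "\<And>b. b \<in> nspace \<beta> \<Longrightarrow> (shift \<beta> ^^ u) b = (0 :: nat \<times> nat \<Rightarrow> 'k)"
  shows "fs.dim (hom_filt \<alpha> \<beta> f u 0) = fs.dim {a \<in> nspace \<alpha>. shift \<alpha> a = (0 :: nat \<times> nat \<Rightarrow> 'k)}"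
proof -
  have f: "is_hom \<alpha> \<beta> f" "inj_hom \<alpha> f" using Y by auto
  let ?K = "{a \<in> nspace \<alpha>. shift \<alpha> a = (0 :: nat \<times> nat \<Rightarrow> 'k)}"
  interpret l: Vector_Spaces.linear fscale fscale "mapp (idx \<alpha>) f" by (rule linear_mapp)
  have inj: "a = 0" if "a \<in> nspace \<alpha>" "mapp (idx \<alpha>) f a = 0" for a
    using f(2) that unfolding inj_hom_def nspace_def zero_fun_def by blast
  have K: "fs.subspace ?K" using subspace_nspace[of \<alpha>] by (auto simp: fs.subspace_def)
  have 0: "{x \<in> ?K. mapp (idx \<alpha>) f x = 0} = {0}"
    using inj fs.subspace_0[OF K] l.zero by auto
  have "fs.dim ?K = fs.dim (mapp (idx \<alpha>) f ` ?K) + fs.dim {x \<in> ?K. mapp (idx \<alpha>) f x = 0}"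
    by (rule fsp.rank_nullity[OF linear_mapp K fs.findim_subset[OF findim_nspace]]) auto
  moreover have "mapp (idx \<alpha>) f ` ?K = hom_filt \<alpha> \<beta> f u 0"
  proof (intro set_eqI iffI)
    fix x assume "x \<in> mapp (idx \<alpha>) f ` ?K"
    then obtain a where a: "x = mapp (idx \<alpha>) f a" "a \<in> nspace \<alpha>" "shift \<alpha> a = 0" by blast
    have "shift \<beta> x = 0" unfolding a(1) hom_shift[OF f(1)] a(3) by (rule l.zero)
    then have "(shift \<beta> ^^ u) 0 + (shift \<beta> ^^ 0) x \<in> os.filt (idx \<beta>) (tmat \<beta>) u 0 (nspace \<beta>)"
      using hom_in[OF f(1)] a(1) by (intro os.filtI fs.subspace_0[OF subspace_nspace] os.pow_simps(4)) auto
    then show "x \<in> hom_filt \<alpha> \<beta> f u 0" using a(1) by simp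
  next
    fix x assume x: "x \<in> hom_filt \<alpha> \<beta> f u 0"
    then obtain b c where bc: "x = (shift \<beta> ^^ u) b + c" "b \<in> nspace \<beta>" "shift \<beta> c = 0"
      unfolding os.filt_def by auto
    then have "shift \<beta> x = 0" using u[OF bc(2)] by simp
    obtain a where a: "a \<in> nspace \<alpha>" "x = mapp (idx \<alpha>) f a" using x unfolding hom_range by blast
    have "shift \<alpha> a = 0" using inj[OF shift_in] \<open>shift \<beta> x = 0\<close> unfolding a(2) hom_shift[OF f(1)] by blast
    then show "x \<in> mapp (idx \<alpha>) f ` ?K" using a by blast
  qed
  ultimately show ?thesis unfolding 0 fs.dim_zero by simp
qed

lemma diagram_of_valid:
  assumes "\<forall>s\<in>set L. valid_summand s" "diagram_of L = (A, P)"
  shows "\<forall>(n, q) \<in># A. 1 \<le> q \<and> q < n" "\<forall>p \<in># P. 1 \<le> p"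
proof -
  have "(\<forall>(n, q) \<in># fst (diagram_of L). 1 \<le> q \<and> q < n) \<and> (\<forall>p \<in># snd (diagram_of L). 1 \<le> p)"
    using assms(1)
  proof (induction L)
    case (Cons s L)
    then show ?case by (cases s) (auto simp: diagram_of_def)
  qed (simp add: diagram_of_def)
  then show "\<forall>(n, q) \<in># A. 1 \<le> q \<and> q < n" "\<forall>p \<in># P. 1 \<le> p" using assms(2) by auto
qed

lemma mark_size:
  assumes "\<forall>(n, q) \<in># A. 1 \<le> q \<and> q < n \<and> n \<le> u" "\<forall>p \<in># P. 1 \<le> p"
  shows "mark u 0 (A, P) = size A + size P"
proof -
  have "filter_mset (\<lambda>p. 0 < p) P = P" using assms(2) by (intro filter_mset_cong[of P P _ "\<lambda>_. True", simplified]) auto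
  moreover have "filter_mset (\<lambda>(n, q). 0 < n) A = A"
    using filter_mset_cong[of A A "\<lambda>(n, q). 0 < n" "\<lambda>_. True"] assms(1) by fastforce
  moreover have "size (filter_mset (\<lambda>(n, q). u + 2 \<le> n \<and> 0 < q) A) = 0"
    using assms(1) by fastforce
  ultimately show ?thesis by simp
qed

theorem theorem4p1:
  fixes Y Z :: "'k::field obj"
  assumes "obj_S2 Y" and "obj_S2 Z"
    and "same_ptype Y Z"
    and "hom_le Y Z"
  shows "arc_le Y Z"
proof -
  obtain t where "has_ptype Y t" "has_ptype Z t" using assms(3) unfolding same_ptype_def by blast
  then obtain \<alpha> \<beta> \<gamma> f f' where eq: "Y = (\<alpha>, \<beta>, f)" "Z = (\<alpha>, \<beta>, f')"
    and cok: "coker_is (\<alpha>, \<beta>, f) \<gamma>" "coker_is (\<alpha>, \<beta>, f') \<gamma>"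
    by (cases Y; cases Z; cases t) auto
  have Y: "obj_S2 (\<alpha>, \<beta>, f)" and Z: "obj_S2 (\<alpha>, \<beta>, f')" using assms(1,2) eq by auto
  obtain L where L: "arc_diagram (\<alpha>, \<beta>, f) (diagram_of L)" "\<forall>s\<in>set L. valid_summand s"
    "\<And>u v. v \<le> u \<Longrightarrow> fs.dim (hom_filt \<alpha> \<beta> f u v) = mark u v (diagram_of L)"
    using exists_diagram[OF Y] by metis
  obtain L' where L': "arc_diagram (\<alpha>, \<beta>, f') (diagram_of L')" "\<forall>s\<in>set L'. valid_summand s"
    "\<And>u v. v \<le> u \<Longrightarrow> fs.dim (hom_filt \<alpha> \<beta> f' u v) = mark u v (diagram_of L')"
    using exists_diagram[OF Z] by metis
  obtain A P A' P' where D: "diagram_of L = (A, P)" "diagram_of L' = (A', P')" by fastforce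
  note val = diagram_of_valid[OF L(2) D(1)] diagram_of_valid[OF L'(2) D(2)]
  have "arc_move\<^sup>*\<^sup>* (A', P') (A, P)"
  proof (rule diagram_moves[OF val])
    obtain n where n: "\<And>b. b \<in> nspace \<beta> \<Longrightarrow> (shift \<beta> ^^ n) b = (0 :: nat \<times> nat \<Rightarrow> 'k)"
      using nil_shift by blast
    \<comment> \<open>Large enough both to kill N_\<beta> and to lie at or above all upper ends of
      arcs, as required by \<open>dim_filt_socle\<close> and \<open>mark_size\<close>
      respectively.\<close>
    define u where "u = Max (insert n (fst ` set_mset (A + A')))"
    have fin: "finite (insert n (fst ` set_mset (A + A')))" by simp
    have un: "n \<le> u" unfolding u_def using Max_ge[OF fin] by simp
    have mu: "m \<le> u" if "(m, q) \<in># A + A'" for m q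
    proof -
      have "m \<in> insert n (fst ` set_mset (A + A'))" using that by force
      then show ?thesis unfolding u_def using Max_ge[OF fin] by blast
    qed
    have u: "(shift \<beta> ^^ u) b = (0 :: nat \<times> nat \<Rightarrow> 'k)" if "b \<in> nspace \<beta>" for b
      using os.pow_zero[OF n[OF that] un] .
    have "mark u 0 (A, P) = mark u 0 (A', P')"
      using dim_filt_socle[OF Y u] dim_filt_socle[OF Z u] L(3)[of 0 u] L'(3)[of 0 u] D by simp
    moreover have "mark u 0 (A, P) = size A + size P" "mark u 0 (A', P') = size A' + size P'"
      by (rule mark_size; use val mu in fastforce)+
    ultimately show "size A + size P = size A' + size P'" by simp
  next
    fix u
    show "mark u u (A, P) = mark u u (A', P')"
      using dim_filt_diag[OF Y cok(1), of u] dim_filt_diag[OF Z cok(2), of u] L(3)[of u u] L'(3)[of u u] D by simp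
  next
    fix u v :: nat assume vu: "v < u"
    obtain \<alpha>0 \<beta>0 \<delta> where X: "bipicket (u + 2) (v + 1) = (\<alpha>0, \<beta>0, \<delta> :: 'k mat)" by (metis prod_cases3)
    have le: "1 \<le> v + 1" "v + 1 + 2 \<le> u + 2" using vu by auto
    \<comment> \<open>The bipicket is the test object, so it must be an object of S(k); in
      particular \<open>[u + 2, v + 1]\<close> has to be weakly decreasing.\<close>
    have "obj_S (bipicket (u + 2) (v + 1) :: 'k obj)"
      using bipicket_hom[OF X le] mapp_bipicket(1,2)[OF X le] vu unfolding X by (simp add: partition_def)
    then have "dimHom (bipicket (u + 2) (v + 1)) (\<alpha>, \<beta>, f) \<le> dimHom (bipicket (u + 2) (v + 1)) (\<alpha>, \<beta>, f')"
      using assms(4) unfolding hom_le_def eq by blast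
    then show "mark u v (A, P) \<le> mark u v (A', P')"
      using dimHom_bipicket[OF Y vu] dimHom_bipicket[OF Z vu] L(3)[of v u] L'(3)[of v u] D vu by simp
  qed
  then show ?thesis unfolding arc_le_def eq using L(1) L'(1) unfolding D by blast
qed

end
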